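(* Let $M$ be a smooth manifold with $\dim M\ge 3$ and let $\mathcal{C}\subset \mathsf{Sym}^+(TM)$ be a generic generalized conformal structure on $M$. Then $\mathcal{C}$ is $d$-rigid for every integer $d\ge 2$; that is, for every $p\in M$, every $(d+1)$-isometry $\phi$ of $\mathcal{C}$ at $p$ which has a trivial $d$-jet at $p$ has a trivial $(d+1)$-jet at $p$.
   Context: For a real vector space $E$, $\mathsf{Sym}(E)$ is the space of symmetric bilinear forms on $E$, $\mathsf{Sym}^+(E)$ the open subset of positive definite ones, and $\mathsf{Sym}^*(E)$ the subset of non-degenerate ones. $\mathsf{Sym}(TM)$, $\mathsf{Sym}^+(TM)$, $\mathsf{Sym}^*(TM)$ are the corresponding fiber bundles over $M$. Everything is smooth. A generalized conformal structure (GCS) on $M$ is a (embedded, smooth) submanifold $\mathcal{C}\subset\mathsf{Sym}^+(TM)$ of dimension $\dim M+1$ which is transverse to the fibers of $\mathsf{Sym}^+(TM)\to M$, with all fibers $\mathcal{C}_x=\mathcal{C}\cap\mathsf{Sym}^+(T_xM)$ non-empty; equivalently the projection $\mathcal{C}\to M$ is a (surjective) submersion and $\dim\mathcal{C}=\dim M+1$. Each $\mathcal{C}_x$ is a (not necessarily connected) embedded 1-dimensional submanifold of $\mathsf{Sym}^+(T_xM)$. $\mathcal{C}$ is generic if for every $x\in M$ the tangent direction of $\mathcal{C}_x\subset\mathsf{Sym}(T_xM)$ at each of its points is spanned by an element of $\mathsf{Sym}^*(T_xM)$, i.e. if $t\mapsto c_x(t)$ is a local regular parameterization of $\mathcal{C}_x$,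 then $c_x'(t)$ is a non-degenerate form. For a (local) diffeomorphism $\phi$ of $M$, $\phi^*(\mathcal{C})$ denotes the image of $\mathcal{C}$ under the action induced by $\phi$ on $\mathsf{Sym}^+(TM)$ (pull-back of forms by the derivative of $\phi$). For $d\ge1$, a (local) diffeomorphism $\phi$ of $M$ with $\phi(p)=p$ is a $d$-isometry of $\mathcal{C}$ at $p$ if $(\phi^*(\mathcal{C}))_p=\mathcal{C}_p$ and $\phi^*(\mathcal{C})$ and $\mathcal{C}$ have contact of order $d-1$ along $\mathcal{C}_p$. Here two $k$-dimensional submanifolds $V,W$ of an $N$-manifold have contact of order $s$ along a common curve if, locally, in suitable coordinates, $V=\mathbb{R}^k\subset\mathbb{R}^N$, the curve is $\mathbb{R}\subset\mathbb{R}^k$, and $W$ is the graph of a function $f:\mathbb{R}^k\to\mathbb{R}^{N-k}$ whose Taylor expansion vanishes up to order $s$ at all points of the curve. $\phi$ has a trivial $d$-jet at $p$ if it has the same $d$-jet at $p$ as the identity. *)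

theory Defs
  imports "HOL-Analysis.Analysis" "HOL-Library.Uprod"
begin

section \<open>Iterated derivatives and smoothness in Euclidean spaces\<close>

text \<open>\<open>iter_deriv [v\<^sub>1, \<dots>, v\<^sub>k] f\<close> is the iterated directional derivative of \<open>f\<close>, in direction
  \<open>v\<^sub>1\<close> first.  Functions are total; at a point of an open set the value depends only on the
  restriction of \<open>f\<close> to that set.\<close>

fun iter_deriv ::
  "'a list \<Rightarrow> ('a::euclidean_space \<Rightarrow> 'b::euclidean_space) \<Rightarrow> 'a \<Rightarrow> 'b" where
  "iter_deriv [] f = f"
| "iter_deriv (v # vs) f = iter_deriv vs (\<lambda>x. frechet_derivative f (at x) v)"

text \<open>Being smooth on \<open>S\<close> includes that \<open>S\<close> is open.\<close>

definition smooth_on ::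
  "'a::euclidean_space set \<Rightarrow> ('a \<Rightarrow> 'b::euclidean_space) \<Rightarrow> bool" where
  "smooth_on S f \<longleftrightarrow> open S \<and> (\<forall>vs. \<forall>x\<in>S. iter_deriv vs f differentiable (at x))"


section \<open>Smooth manifolds\<close>

text \<open>A manifold is given by an atlas, whose charts are pairs of a domain and a coordinate map.
  Carrier and topology are recovered from the atlas: the chart domains cover the carrier, and the
  topology is the one for which all charts are homeomorphisms onto open subsets of the model
  space \<open>'e\<close>.\<close>

type_synonym ('m, 'e) chart = "'m set \<times> ('m \<Rightarrow> 'e)"

definition chart_inv :: "('m, 'e) chart \<Rightarrow> 'e \<Rightarrow> 'm" where
  "chart_inv \<kappa> = the_inv_into (fst \<kappa>) (snd \<kappa>)"

definition local_rep ::
  "('m, 'e) chart \<Rightarrow> ('n, 'f) chart \<Rightarrow> ('m \<Rightarrow> 'n) \<Rightarrow> 'e \<Rightarrow> 'f" where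
  "local_rep \<kappa> \<mu> f = snd \<mu> \<circ> f \<circ> chart_inv \<kappa>"

definition smooth_atlas :: "('m, 'e::euclidean_space) chart set \<Rightarrow> bool" where
  "smooth_atlas A \<longleftrightarrow>
     (\<forall>(U, \<phi>)\<in>A. inj_on \<phi> U \<and> open (\<phi> ` U)) \<and>
     (\<forall>\<kappa>\<in>A. \<forall>\<mu>\<in>A. smooth_on (snd \<kappa> ` (fst \<kappa> \<inter> fst \<mu>)) (local_rep \<kappa> \<mu> (\<lambda>x. x)))"

definition mcarrier :: "('m, 'e) chart set \<Rightarrow> 'm set" where
  "mcarrier A = \<Union> (fst ` A)"

definition mtopology :: "('m, 'e::euclidean_space) chart set \<Rightarrow> 'm topology" where
  "mtopology A = topology_generated_by {W. \<exists>(U, \<phi>)\<in>A. W \<subseteq> U \<and> open (\<phi> ` W)}"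

definition smooth_manifold :: "('m, 'e::euclidean_space) chart set \<Rightarrow> bool" where
  "smooth_manifold A \<longleftrightarrow>
     smooth_atlas A \<and> Hausdorff_space (mtopology A) \<and> second_countable (mtopology A)"

definition maximal_atlas ::
  "('m, 'e::euclidean_space) chart set \<Rightarrow> ('m, 'e) chart set" where
  "maximal_atlas A = {\<kappa>. fst \<kappa> \<subseteq> mcarrier A \<and> smooth_atlas (insert \<kappa> A)}"

definition euclidean_atlas :: "('e::euclidean_space, 'e) chart set" where
  "euclidean_atlas = {(UNIV, \<lambda>x. x)}"

text \<open>Continuity of \<open>f\<close> is contained in the openness required by \<^const>\<open>smooth_on\<close>.\<close>

definition smooth_map ::
  "('m, 'e::euclidean_space) chart set \<Rightarrow> ('n, 'f::euclidean_space) chart set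
     \<Rightarrow> 'm set \<Rightarrow> ('m \<Rightarrow> 'n) \<Rightarrow> bool" where
  "smooth_map A B U f \<longleftrightarrow>
     openin (mtopology A) U \<and> f ` U \<subseteq> mcarrier B \<and>
     (\<forall>\<kappa>\<in>A. \<forall>\<mu>\<in>B. smooth_on (snd \<kappa> ` {x \<in> U \<inter> fst \<kappa>. f x \<in> fst \<mu>}) (local_rep \<kappa> \<mu> f))"

text \<open>A local diffeomorphism of the manifold, defined on the open set \<open>U\<close>; for \<open>U\<close> the whole
  carrier and \<open>f\<close> surjective this is a global diffeomorphism.\<close>

definition local_diffeo ::
  "('m, 'e::euclidean_space) chart set \<Rightarrow> 'm set \<Rightarrow> ('m \<Rightarrow> 'm) \<Rightarrow> bool" where
  "local_diffeo A U f \<longleftrightarrow>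
     inj_on f U \<and> smooth_map A A U f \<and> smooth_map A A (f ` U) (the_inv_into U f)"

text \<open>The \<open>d\<close>-jet at \<open>p\<close> agrees with the \<open>d\<close>-jet of the identity.\<close>

definition trivial_jet ::
  "('m, 'e::euclidean_space) chart set \<Rightarrow> nat \<Rightarrow> ('m \<Rightarrow> 'm) \<Rightarrow> 'm \<Rightarrow> bool" where
  "trivial_jet A d f p \<longleftrightarrow>
     f p = p \<and>
     (\<forall>\<kappa>\<in>A. p \<in> fst \<kappa> \<longrightarrow>
        (\<forall>vs. length vs \<le> d \<longrightarrow>
           iter_deriv vs (local_rep \<kappa> \<kappa> f) (snd \<kappa> p) = iter_deriv vs (\<lambda>x. x) (snd \<kappa> p)))"


section \<open>Tangent spaces\<close>

text \<open>A tangent vector at \<open>p\<close> is a family of coordinate vectors, one for each chart around \<open>p\<close>,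
  that transforms by the derivatives of the coordinate changes (and is \<open>0\<close> at the other charts).
  Vector space operations are pointwise.\<close>

type_synonym ('m, 'e) tvec = "('m, 'e) chart \<Rightarrow> 'e"

definition tspace ::
  "('m, 'e::euclidean_space) chart set \<Rightarrow> 'm \<Rightarrow> ('m, 'e) tvec set" where
  "tspace A p =
     {v. (\<forall>\<kappa>\<in>A. \<forall>\<mu>\<in>A. p \<in> fst \<kappa> \<longrightarrow> p \<in> fst \<mu> \<longrightarrow>
            v \<mu> = frechet_derivative (local_rep \<kappa> \<mu> (\<lambda>x. x)) (at (snd \<kappa> p)) (v \<kappa>)) \<and>
         (\<forall>\<kappa>. \<kappa> \<notin> A \<or> p \<notin> fst \<kappa> \<longrightarrow> v \<kappa> = 0)}"

text \<open>The tangent vector at \<open>p\<close> whose coordinate vector in the chart \<open>\<kappa>\<close> is \<open>e\<close>.\<close>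

definition coord_vec ::
  "('m, 'e::euclidean_space) chart set \<Rightarrow> 'm \<Rightarrow> ('m, 'e) chart \<Rightarrow> 'e \<Rightarrow> ('m, 'e) tvec" where
  "coord_vec A p \<kappa> e =
     (\<lambda>\<mu>. if \<mu> \<in> A \<and> p \<in> fst \<mu>
          then frechet_derivative (local_rep \<kappa> \<mu> (\<lambda>x. x)) (at (snd \<kappa> p)) e else 0)"

text \<open>The derivative of \<open>f\<close> at \<open>p\<close>, computed in an arbitrary chart around \<open>p\<close>.\<close>

definition tangent_map ::
  "('m, 'e::euclidean_space) chart set \<Rightarrow> ('n, 'f::euclidean_space) chart set
     \<Rightarrow> ('m \<Rightarrow> 'n) \<Rightarrow> 'm \<Rightarrow> ('m, 'e) tvec \<Rightarrow> ('n, 'f) tvec" where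
  "tangent_map A B f p v =
     (let \<kappa> = (SOME \<kappa>. \<kappa> \<in> A \<and> p \<in> fst \<kappa>) in
      (\<lambda>\<mu>. if \<mu> \<in> B \<and> f p \<in> fst \<mu>
           then frechet_derivative (local_rep \<kappa> \<mu> f) (at (snd \<kappa> p)) (v \<kappa>) else 0))"

definition velocity ::
  "('m, 'e::euclidean_space) chart set \<Rightarrow> (real \<Rightarrow> 'm) \<Rightarrow> real \<Rightarrow> ('m, 'e) tvec" where
  "velocity A c t =
     (\<lambda>\<kappa>. if \<kappa> \<in> A \<and> c t \<in> fst \<kappa> then vector_derivative (snd \<kappa> \<circ> c) (at t) else 0)"


section \<open>Submanifolds, transversality and contact\<close>

text \<open>In the model space, the coordinate subspaces \<open>\<real>\<^sup>k \<subseteq> \<real>\<^sup>N\<close> are the spans of \<open>k\<close>-element sets \<open>K\<close>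
  of standard basis vectors.\<close>

definition submanifold ::
  "('q, 'f::euclidean_space) chart set \<Rightarrow> nat \<Rightarrow> 'q set \<Rightarrow> bool" where
  "submanifold B k S \<longleftrightarrow>
     S \<subseteq> mcarrier B \<and>
     (\<forall>q\<in>S. \<exists>(U, \<psi>)\<in>maximal_atlas B. \<exists>K\<subseteq>Basis.
        q \<in> U \<and> card K = k \<and> \<psi> ` (S \<inter> U) = span K \<inter> \<psi> ` U)"

text \<open>Tangent space at \<open>q\<close> of a submanifold \<open>S\<close>, inside the tangent space of the ambient
  manifold.\<close>

definition sub_tspace ::
  "('q, 'f::euclidean_space) chart set \<Rightarrow> 'q set \<Rightarrow> 'q \<Rightarrow> ('q, 'f) tvec set" where
  "sub_tspace B S q =
     {velocity B c 0 | c \<epsilon>. \<epsilon> > 0 \<and> c 0 = q \<and> c ` {-\<epsilon><..<\<epsilon>} \<subseteq> S \<and>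
                            smooth_map euclidean_atlas B {-\<epsilon><..<\<epsilon>} c}"

definition transverse ::
  "('q, 'f::euclidean_space) chart set \<Rightarrow> 'q set \<Rightarrow> 'q set \<Rightarrow> bool" where
  "transverse B S T \<longleftrightarrow>
     (\<forall>q\<in>S \<inter> T. \<forall>w\<in>tspace B q.
        \<exists>u\<in>sub_tspace B S q. \<exists>v\<in>sub_tspace B T q. \<forall>\<kappa>. w \<kappa> = u \<kappa> + v \<kappa>)"

text \<open>Contact of order \<open>s\<close> of the \<open>k\<close>-dimensional submanifolds \<open>V\<close>, \<open>W\<close> along the curve \<open>\<gamma>\<close>:
  near each point of \<open>\<gamma>\<close> there are coordinates in which \<open>V\<close> is \<open>span K\<close>, \<open>\<gamma>\<close> is the line spanned
  by \<open>b \<in> K\<close>, and \<open>W\<close> is the graph of \<open>f : span K \<rightarrow> span (Basis - K)\<close>.  The values of \<open>f\<close>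
  outside \<open>span K\<close> play no role.\<close>

definition contact ::
  "('q, 'f::euclidean_space) chart set \<Rightarrow> nat \<Rightarrow> nat \<Rightarrow> 'q set \<Rightarrow> 'q set \<Rightarrow> 'q set \<Rightarrow> bool" where
  "contact B k s \<gamma> V W \<longleftrightarrow>
     \<gamma> \<subseteq> V \<inter> W \<and>
     (\<forall>q\<in>\<gamma>. \<exists>(U, \<psi>)\<in>maximal_atlas B. \<exists>K\<subseteq>Basis. \<exists>b\<in>K. \<exists>f.
        q \<in> U \<and> card K = k \<and>
        \<psi> ` (V \<inter> U) = span K \<inter> \<psi> ` U \<and>
        \<psi> ` (\<gamma> \<inter> U) = span {b} \<inter> \<psi> ` U \<and>
        smooth_on UNIV f \<and> f ` span K \<subseteq> span (Basis - K) \<and>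
        \<psi> ` (W \<inter> U) = (\<lambda>x. x + f x) ` span K \<inter> \<psi> ` U \<and>
        (\<forall>x\<in>\<psi> ` (\<gamma> \<inter> U). \<forall>vs. set vs \<subseteq> span K \<longrightarrow> length vs \<le> s \<longrightarrow> iter_deriv vs f x = 0))"


section \<open>Symmetric bilinear forms on tangent spaces\<close>

text \<open>Forms on \<open>tspace A p\<close> are extended by \<open>0\<close> outside of it.\<close>

type_synonym ('m, 'e) tform = "('m, 'e) tvec \<Rightarrow> ('m, 'e) tvec \<Rightarrow> real"

definition Sym ::
  "('m, 'e::euclidean_space) chart set \<Rightarrow> 'm \<Rightarrow> ('m, 'e) tform set" where
  "Sym A p =
     {g. (\<forall>u\<in>tspace A p. \<forall>v\<in>tspace A p. g u v = g v u) \<and>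
         (\<forall>u\<in>tspace A p. \<forall>u'\<in>tspace A p. \<forall>v\<in>tspace A p. \<forall>a a'.
            g (\<lambda>\<kappa>. a *\<^sub>R u \<kappa> + a' *\<^sub>R u' \<kappa>) v = a * g u v + a' * g u' v) \<and>
         (\<forall>u v. u \<notin> tspace A p \<or> v \<notin> tspace A p \<longrightarrow> g u v = 0)}"

definition Sym_pos ::
  "('m, 'e::euclidean_space) chart set \<Rightarrow> 'm \<Rightarrow> ('m, 'e) tform set" where
  "Sym_pos A p = {g \<in> Sym A p. \<forall>u\<in>tspace A p. u \<noteq> (\<lambda>\<kappa>. 0) \<longrightarrow> g u u > 0}"

definition Sym_nondeg ::
  "('m, 'e::euclidean_space) chart set \<Rightarrow> 'm \<Rightarrow> ('m, 'e) tform set" where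
  "Sym_nondeg A p =
     {g \<in> Sym A p. \<forall>u\<in>tspace A p. (\<forall>v\<in>tspace A p. g u v = 0) \<longrightarrow> u = (\<lambda>\<kappa>. 0)}"

text \<open>A symmetric matrix is encoded as a vector indexed by the unordered pairs of indices, so that
  the space of symmetric matrices is a Euclidean space of dimension \<open>n (n + 1) / 2\<close>.\<close>

instance uprod :: (finite) finite
proof
  have "(UNIV :: 'a uprod set) = (\<lambda>(x, y). Upair x y) ` UNIV"
  proof (intro equalityI subsetI)
    fix q :: "'a uprod"
    show "q \<in> (\<lambda>(x, y). Upair x y) ` UNIV"
      by (cases q) force
  qed simp
  then show "finite (UNIV :: 'a uprod set)"
    by (metis finite finite_imageI)
qed

definition sym_coords :: "('n::finite \<Rightarrow> 'n \<Rightarrow> real) \<Rightarrow> real ^ ('n uprod)" where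
  "sym_coords h = (\<chi> q. THE r. \<exists>i j. q = Upair i j \<and> r = h i j)"

lemma sym_coords_Upair:
  assumes "\<And>i j. h i j = h j i"
  shows "sym_coords h $ Upair i j = h i j"
  unfolding sym_coords_def by (auto intro!: the_equality simp: assms)


section \<open>The bundle of positive definite forms\<close>

text \<open>The total space consists of the pairs \<open>(x, g)\<close> with \<open>g\<close> a positive definite form on the
  tangent space at \<open>x\<close>.  A chart of the base induces the bundle chart given by the coordinates of
  \<open>x\<close> and the components of \<open>g\<close> in the coordinate basis.\<close>

type_synonym ('m, 'n) bpoint = "'m \<times> ('m, real ^ 'n) tform"

definition sym_fiber ::
  "('m, real ^ 'n::finite) chart set \<Rightarrow> 'm \<Rightarrow> ('m, 'n) bpoint set" where
  "sym_fiber A x = {x} \<times> Sym_pos A x"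

definition sym_chart ::
  "('m, real ^ 'n::finite) chart set \<Rightarrow> ('m, real ^ 'n) chart
     \<Rightarrow> (('m, 'n) bpoint, (real ^ 'n) \<times> (real ^ ('n uprod))) chart" where
  "sym_chart A \<kappa> =
     (\<Union>x\<in>fst \<kappa>. sym_fiber A x,
      \<lambda>(x, g). (snd \<kappa> x,
        sym_coords (\<lambda>i j. g (coord_vec A x \<kappa> (axis i 1)) (coord_vec A x \<kappa> (axis j 1)))))"

definition sym_bundle ::
  "('m, real ^ 'n::finite) chart set
     \<Rightarrow> (('m, 'n) bpoint, (real ^ 'n) \<times> (real ^ ('n uprod))) chart set" where
  "sym_bundle A = sym_chart A ` A"


section \<open>Generalized conformal structures\<close>

definition fiber :: "('m \<times> 'g) set \<Rightarrow> 'm \<Rightarrow> 'g set" where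
  "fiber C x = {g. (x, g) \<in> C}"

definition gcs ::
  "('m, real ^ 'n::finite) chart set \<Rightarrow> ('m, 'n) bpoint set \<Rightarrow> bool" where
  "gcs A C \<longleftrightarrow>
     submanifold (sym_bundle A) (CARD('n) + 1) C \<and>
     (\<forall>x\<in>mcarrier A. transverse (sym_bundle A) C (sym_fiber A x)) \<and>
     (\<forall>x\<in>mcarrier A. fiber C x \<noteq> {})"

text \<open>Derivative of a curve of forms on a fixed finite-dimensional space, taken entrywise.\<close>

definition form_deriv :: "(real \<Rightarrow> 'v \<Rightarrow> 'v \<Rightarrow> real) \<Rightarrow> real \<Rightarrow> 'v \<Rightarrow> 'v \<Rightarrow> real" where
  "form_deriv c t = (\<lambda>u v. deriv (\<lambda>s. c s u v) t)"

text \<open>Smooth regular curves in the fiber over \<open>x\<close>; as the fiber of a generalized conformal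
  structure is one-dimensional, these are its local regular parameterizations.\<close>

definition regular_param ::
  "('m, real ^ 'n::finite) chart set \<Rightarrow> ('m, 'n) bpoint set \<Rightarrow> 'm
     \<Rightarrow> real set \<Rightarrow> (real \<Rightarrow> ('m, real ^ 'n) tform) \<Rightarrow> bool" where
  "regular_param A C x I c \<longleftrightarrow>
     (\<exists>a b. I = {a<..<b}) \<and> c ` I \<subseteq> fiber C x \<and>
     (\<forall>u\<in>tspace A x. \<forall>v\<in>tspace A x. smooth_on I (\<lambda>t. c t u v)) \<and>
     (\<forall>t\<in>I. form_deriv c t \<noteq> (\<lambda>u v. 0))"

definition generic_gcs ::
  "('m, real ^ 'n::finite) chart set \<Rightarrow> ('m, 'n) bpoint set \<Rightarrow> bool" where
  "generic_gcs A C \<longleftrightarrow>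
     gcs A C \<and>
     (\<forall>x\<in>mcarrier A. \<forall>I c. regular_param A C x I c \<longrightarrow>
        (\<forall>t\<in>I. form_deriv c t \<in> Sym_nondeg A x))"

text \<open>The action of a local diffeomorphism \<open>\<phi>\<close> with domain \<open>U\<close>; the result lies over \<open>U\<close>.\<close>

definition pull_form ::
  "('m, 'e::euclidean_space) chart set \<Rightarrow> ('m \<Rightarrow> 'm) \<Rightarrow> 'm \<Rightarrow> ('m, 'e) tform \<Rightarrow> ('m, 'e) tform" where
  "pull_form A \<phi> x g =
     (\<lambda>u v. if u \<in> tspace A x \<and> v \<in> tspace A x
            then g (tangent_map A A \<phi> x u) (tangent_map A A \<phi> x v) else 0)"

definition pull_gcs ::
  "('m, real ^ 'n::finite) chart set \<Rightarrow> 'm set \<Rightarrow> ('m \<Rightarrow> 'm)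
     \<Rightarrow> ('m, 'n) bpoint set \<Rightarrow> ('m, 'n) bpoint set" where
  "pull_gcs A U \<phi> C = {(x, pull_form A \<phi> x g) | x g. x \<in> U \<and> (\<phi> x, g) \<in> C}"

definition d_isometry ::
  "('m, real ^ 'n::finite) chart set \<Rightarrow> ('m, 'n) bpoint set \<Rightarrow> nat
     \<Rightarrow> 'm set \<Rightarrow> ('m \<Rightarrow> 'm) \<Rightarrow> 'm \<Rightarrow> bool" where
  "d_isometry A C d U \<phi> p \<longleftrightarrow>
     d \<ge> 1 \<and> local_diffeo A U \<phi> \<and> p \<in> U \<and> \<phi> p = p \<and>
     fiber (pull_gcs A U \<phi> C) p = fiber C p \<and>
     contact (sym_bundle A) (CARD('n) + 1) (d - 1) ({p} \<times> fiber C p) (pull_gcs A U \<phi> C) C"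

definition d_rigid ::
  "('m, real ^ 'n::finite) chart set \<Rightarrow> ('m, 'n) bpoint set \<Rightarrow> nat \<Rightarrow> bool" where
  "d_rigid A C d \<longleftrightarrow>
     (\<forall>p\<in>mcarrier A. \<forall>U \<phi>. d_isometry A C (d + 1) U \<phi> p \<longrightarrow> trivial_jet A d \<phi> p
        \<longrightarrow> trivial_jet A (d + 1) \<phi> p)"

end

(* A contact chart at a point (p, g) of C turns the second structure into the graph of a
  function that is flat to order d along the fibre.  Transversality provides, for every direction v,
  a curve in C over a curve leaving p with velocity v; pulling it back by phi changes it at order
  s^d by the symmetrization of g(D^(d+1) phi(v, ..., v, -), -), and flatness of the graph forces this
  difference to be tangent to C, hence a multiple of the tangent h of the fibre C_p.  Polarizing,
  the (d+1)-st derivative B of phi satisfies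

    g(B(x, ..., u), w) + g(B(x, ..., w), u) = L(x, ...) h(u, w),

  and since B is symmetric in all its arguments, a Koszul argument expresses it through L and h.  For
  d >= 2 the symmetry of that expression makes the Kulkarni-Nomizu product of L and h vanish; tracing
  with the inverse of the non-degenerate form h gives L = 0 in dimension n >= 3, hence B = 0. *)

theory Submission
  imports Defs
begin

section \<open>Calculus of iterated derivatives\<close>

text \<open>The pulled-back curve lies over the phi-preimages of the base points. Since phi - id
  vanishes to order d at p, the two base curves differ by o(s^d), while the forms differ at order
  s^d through the derivative of phi - id; so the rescaled difference becomes vertical in the limit.
  Both curves are at distance O(s) from (p, g), far more than their mutual distance O(s^d), so
  passing to contact coordinates calls for strict differentiability. There the pull-back lies in a
  linear subspace and C is the graph over it. That subspace has dimension n + 1 and its image under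
  the projection is all of T_pM, which is why vertical tangent vectors of C form a line.

  The preimage curve is controlled only through the limit of its difference quotients as s -> 0+, so
  Taylor's theorem is stated as a limit along x0 + s \<beta>(s) with \<beta>(s) -> v.

  With only two symmetric arguments the Koszul formula would be consistent for every L; the third
  argument, present for d \<ge> 2, gives the condition on L. Its trace is (n - 2) L = - t H, with t
  the trace of L, and this is where n \<ge> 3 enters.\<close>

lemma smooth_on_open: "smooth_on S f \<Longrightarrow> open S"
  by (simp add: smooth_on_def)

lemma smooth_on_differentiable: "smooth_on S f \<Longrightarrow> x \<in> S \<Longrightarrow> f differentiable (at x)"
  unfolding smooth_on_def by (metis iter_deriv.simps(1))

lemma smooth_on_has_derivative:
  "smooth_on S f \<Longrightarrow> x \<in> S \<Longrightarrow> (f has_derivative frechet_derivative f (at x)) (at x)"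
  using smooth_on_differentiable frechet_derivative_works by blast

lemma smooth_on_frechet_derivative:
  "smooth_on S f \<Longrightarrow> smooth_on S (\<lambda>x. frechet_derivative f (at x) v)"
  unfolding smooth_on_def by (metis iter_deriv.simps(2))

lemma smooth_on_continuous: "smooth_on S f \<Longrightarrow> x \<in> S \<Longrightarrow> isCont f x"
  using smooth_on_differentiable differentiable_imp_continuous_within by blast

text \<open>The recursion peels off the innermost derivative, the head of the list. Taylor expansion
  peels off the outermost one, and gets at it through this splitting.\<close>

lemma iter_deriv_append: "iter_deriv (vs @ ws) f = iter_deriv ws (iter_deriv vs f)"
  by (induction vs arbitrary: f) auto

lemma smooth_on_iter_deriv: "smooth_on S f \<Longrightarrow> smooth_on S (iter_deriv vs f)"
  unfolding smooth_on_def by (simp flip: iter_deriv_append)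

lemma frechet_derivative_cong_open:
  assumes "open S" "x \<in> S" "\<And>y. y \<in> S \<Longrightarrow> f y = g y"
  shows "frechet_derivative f (at x) = frechet_derivative g (at x)"
proof -
  have "(f has_derivative D) (at x) \<longleftrightarrow> (g has_derivative D) (at x)" for D
    using assms has_derivative_transform_within_open[of f D x UNIV S g]
      has_derivative_transform_within_open[of g D x UNIV S f] by auto
  then show ?thesis
    unfolding frechet_derivative_def by simp
qed

lemma iter_deriv_cong_open:
  assumes "open S" "x \<in> S" "\<And>y. y \<in> S \<Longrightarrow> f y = g y"
  shows "iter_deriv vs f x = iter_deriv vs g x"
  using assms
proof (induction vs arbitrary: f g x)
  case (Cons v vs)
  have "frechet_derivative f (at y) v = frechet_derivative g (at y) v" if "y \<in> S" for y
    using frechet_derivative_cong_open[OF Cons.prems(1) that Cons.prems(3)] by simp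
  then show ?case
    unfolding iter_deriv.simps by (intro Cons.IH[OF Cons.prems(1,2)])
qed simp

lemma smooth_on_cong:
  assumes "smooth_on S f" "\<And>y. y \<in> S \<Longrightarrow> f y = g y"
  shows "smooth_on S g"
  unfolding smooth_on_def
proof (intro conjI allI ballI)
  show S: "open S" using assms(1) by (rule smooth_on_open)
  fix vs x assume x: "x \<in> S"
  have "iter_deriv vs f differentiable at x"
    using assms(1) x by (simp add: smooth_on_def)
  then obtain D where D: "(iter_deriv vs f has_derivative D) (at x)"
    unfolding differentiable_def by auto
  have "(iter_deriv vs g has_derivative D) (at x)"
    by (rule has_derivative_transform_within_open[OF D S x])
      (rule iter_deriv_cong_open[OF S _ assms(2)])
  then show "iter_deriv vs g differentiable at x"
    unfolding differentiable_def by auto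
qed

lemma iter_deriv_bounded_linear:
  assumes "bounded_linear L" "smooth_on S f" "x \<in> S"
  shows "iter_deriv vs (\<lambda>x. L (f x)) x = L (iter_deriv vs f x)"
  using assms(2,3)
proof (induction vs arbitrary: f x)
  case (Cons v vs)
  have "frechet_derivative (\<lambda>x. L (f x)) (at y) v = L (frechet_derivative f (at y) v)"
    if "y \<in> S" for y
    using bounded_linear.has_derivative[OF assms(1) smooth_on_has_derivative[OF Cons.prems(1) that]]
    by (metis frechet_derivative_at)
  then have "iter_deriv vs (\<lambda>y. frechet_derivative (\<lambda>x. L (f x)) (at y) v) x
      = iter_deriv vs (\<lambda>y. L (frechet_derivative f (at y) v)) x"
    using Cons.prems by (intro iter_deriv_cong_open[of S]) (auto intro: smooth_on_open)
  also have "\<dots> = L (iter_deriv vs (\<lambda>y. frechet_derivative f (at y) v) x)"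
    using Cons.IH[OF smooth_on_frechet_derivative[OF Cons.prems(1)] Cons.prems(2)] .
  finally show ?case by simp
qed simp

lemma smooth_on_bounded_linear:
  assumes "bounded_linear L" "smooth_on S f"
  shows "smooth_on S (\<lambda>x. L (f x))"
  unfolding smooth_on_def
proof (intro conjI allI ballI)
  show S: "open S" using assms(2) by (rule smooth_on_open)
  fix vs x assume x: "x \<in> S"
  have D: "((\<lambda>x. L (iter_deriv vs f x)) has_derivative
      (\<lambda>h. L (frechet_derivative (iter_deriv vs f) (at x) h))) (at x)"
    by (rule bounded_linear.has_derivative[OF assms(1)])
      (rule smooth_on_has_derivative[OF smooth_on_iter_deriv[OF assms(2)] x])
  have "(iter_deriv vs (\<lambda>x. L (f x)) has_derivative
      (\<lambda>h. L (frechet_derivative (iter_deriv vs f) (at x) h))) (at x)"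
    by (rule has_derivative_transform_within_open[OF D S x])
      (simp add: iter_deriv_bounded_linear[OF assms])
  then show "iter_deriv vs (\<lambda>x. L (f x)) differentiable at x"
    unfolding differentiable_def by auto
qed

lemma iter_deriv_add:
  assumes "smooth_on S f" "smooth_on S g" "x \<in> S"
  shows "iter_deriv vs (\<lambda>x. f x + g x) x = iter_deriv vs f x + iter_deriv vs g x"
  using assms
proof (induction vs arbitrary: f g x)
  case (Cons v vs)
  have "frechet_derivative (\<lambda>x. f x + g x) (at y) v
      = frechet_derivative f (at y) v + frechet_derivative g (at y) v" if "y \<in> S" for y
    using has_derivative_add[OF smooth_on_has_derivative[OF Cons.prems(1) that]
        smooth_on_has_derivative[OF Cons.prems(2) that]]
    by (simp add: frechet_derivative_at[symmetric])
  then have "iter_deriv vs (\<lambda>y. frechet_derivative (\<lambda>x. f x + g x) (at y) v) x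
      = iter_deriv vs (\<lambda>y. frechet_derivative f (at y) v + frechet_derivative g (at y) v) x"
    using Cons.prems by (intro iter_deriv_cong_open[of S]) (auto intro: smooth_on_open)
  also have "\<dots> = iter_deriv vs (\<lambda>y. frechet_derivative f (at y) v) x
      + iter_deriv vs (\<lambda>y. frechet_derivative g (at y) v) x"
    using Cons.IH[OF smooth_on_frechet_derivative[OF Cons.prems(1)]
        smooth_on_frechet_derivative[OF Cons.prems(2)] Cons.prems(3)] .
  finally show ?case by simp
qed simp

lemma smooth_on_add:
  assumes "smooth_on S f" "smooth_on S g"
  shows "smooth_on S (\<lambda>x. f x + g x)"
  unfolding smooth_on_def
proof (intro conjI allI ballI)
  show S: "open S" using assms(1) by (rule smooth_on_open)
  fix vs x assume x: "x \<in> S"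
  have D: "((\<lambda>x. iter_deriv vs f x + iter_deriv vs g x) has_derivative
      (\<lambda>h. frechet_derivative (iter_deriv vs f) (at x) h
         + frechet_derivative (iter_deriv vs g) (at x) h)) (at x)"
    by (intro has_derivative_add smooth_on_has_derivative[OF smooth_on_iter_deriv[OF assms(1)] x]
        smooth_on_has_derivative[OF smooth_on_iter_deriv[OF assms(2)] x])
  have "(iter_deriv vs (\<lambda>x. f x + g x) has_derivative
      (\<lambda>h. frechet_derivative (iter_deriv vs f) (at x) h
         + frechet_derivative (iter_deriv vs g) (at x) h)) (at x)"
    by (rule has_derivative_transform_within_open[OF D S x])
      (simp add: iter_deriv_add[OF assms])
  then show "iter_deriv vs (\<lambda>x. f x + g x) differentiable at x"
    unfolding differentiable_def by auto
qed

lemma iter_deriv_const: "vs \<noteq> [] \<Longrightarrow> iter_deriv vs (\<lambda>x. c) x = 0"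
proof (induction vs arbitrary: c)
  case (Cons v vs)
  then show ?case by (cases "vs = []") auto
qed simp

lemma smooth_on_const: "open S \<Longrightarrow> smooth_on S (\<lambda>x. c)"
proof -
  have "iter_deriv vs (\<lambda>x. c) = (if vs = [] then (\<lambda>x. c) else (\<lambda>x. 0))" for vs :: "'a list" and c :: 'b
    using iter_deriv_const by fastforce
  then show "open S \<Longrightarrow> smooth_on S (\<lambda>x. c)"
    unfolding smooth_on_def by simp
qed

section \<open>Multilinearity and symmetry of iterated derivatives\<close>

lemma iter_deriv_Cons_linear:
  assumes "smooth_on S f" "x \<in> S"
  shows "linear (\<lambda>v. iter_deriv (v # vs) f x)"
proof
  have lin: "linear (frechet_derivative f (at y))" if "y \<in> S" for y
    using smooth_on_differentiable[OF assms(1) that] by (rule linear_frechet_derivative)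
  note S = smooth_on_open[OF assms(1)]
  fix v w r
  have "iter_deriv ((v + w) # vs) f x
      = iter_deriv vs (\<lambda>y. frechet_derivative f (at y) v + frechet_derivative f (at y) w) x"
    using S assms by (auto intro!: iter_deriv_cong_open[of S] simp: linear_add lin)
  also have "\<dots> = iter_deriv (v # vs) f x + iter_deriv (w # vs) f x"
    using iter_deriv_add[OF smooth_on_frechet_derivative[OF assms(1)]
        smooth_on_frechet_derivative[OF assms(1)] assms(2)] by simp
  finally show "iter_deriv ((v + w) # vs) f x = iter_deriv (v # vs) f x + iter_deriv (w # vs) f x" .
  have "iter_deriv ((r *\<^sub>R v) # vs) f x
      = iter_deriv vs (\<lambda>y. r *\<^sub>R frechet_derivative f (at y) v) x"
    using S assms by (auto intro!: iter_deriv_cong_open[of S] simp: linear_scale lin)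
  also have "\<dots> = r *\<^sub>R iter_deriv (v # vs) f x"
    using iter_deriv_bounded_linear[OF bounded_linear_scaleR_right
        smooth_on_frechet_derivative[OF assms(1)] assms(2)] by simp
  finally show "iter_deriv ((r *\<^sub>R v) # vs) f x = r *\<^sub>R iter_deriv (v # vs) f x" .
qed

lemma smooth_on_line_derivative:
  assumes "smooth_on S f" "x + t *\<^sub>R h \<in> S"
  shows "((\<lambda>t. f (x + t *\<^sub>R h)) has_vector_derivative
    frechet_derivative f (at (x + t *\<^sub>R h)) h) (at t)"
proof -
  let ?D = "frechet_derivative f (at (x + t *\<^sub>R h))"
  have D: "(f has_derivative ?D) (at (x + t *\<^sub>R h))"
    by (rule smooth_on_has_derivative[OF assms])
  have "((\<lambda>t. x + t *\<^sub>R h) has_derivative (\<lambda>s. s *\<^sub>R h)) (at t)"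
    by (auto intro!: derivative_eq_intros)
  from has_derivative_compose[OF this D]
  show ?thesis
    unfolding has_vector_derivative_def
    using has_derivative_linear[OF D] by (simp add: linear_scale)
qed

text \<open>Mean value theorem twice: along \<open>v\<close> for the difference in direction
  \<open>w\<close>, then along \<open>w\<close> for the derivative in direction
  \<open>v\<close>.\<close>

lemma second_difference_eq_iter_deriv:
  fixes f :: "'a::euclidean_space \<Rightarrow> real"
  assumes f: "smooth_on S f" and s: "s > 0"
    and inS: "\<And>a b. 0 \<le> a \<Longrightarrow> a \<le> s \<Longrightarrow> 0 \<le> b \<Longrightarrow> b \<le> s \<Longrightarrow> x + a *\<^sub>R v + b *\<^sub>R w \<in> S"
  shows "\<exists>a b. 0 < a \<and> a < s \<and> 0 < b \<and> b < s \<and>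
    f (x + s *\<^sub>R v + s *\<^sub>R w) - f (x + s *\<^sub>R v) - f (x + s *\<^sub>R w) + f x
      = s * (s * iter_deriv [v, w] f (x + a *\<^sub>R v + b *\<^sub>R w))"
proof -
  define g where "g = (\<lambda>y. frechet_derivative f (at y) v)"
  have g: "smooth_on S g"
    unfolding g_def by (rule smooth_on_frechet_derivative[OF f])
  have d1: "((\<lambda>a. f (x + a *\<^sub>R v + s *\<^sub>R w) - f (x + a *\<^sub>R v)) has_real_derivative
      g (x + a *\<^sub>R v + s *\<^sub>R w) - g (x + a *\<^sub>R v)) (at a)" if "0 \<le> a" "a \<le> s" for a
    using smooth_on_line_derivative[OF f, of "x + s *\<^sub>R w" a v] smooth_on_line_derivative[OF f, of x a v]
      inS[OF that, of s] inS[OF that, of 0] s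
    unfolding has_real_derivative_iff_has_vector_derivative g_def
    by (intro has_vector_derivative_diff) (simp_all add: algebra_simps)
  obtain a where a: "0 < a" "a < s"
    "f (x + s *\<^sub>R v + s *\<^sub>R w) - f (x + s *\<^sub>R v) - (f (x + 0 *\<^sub>R v + s *\<^sub>R w) - f (x + 0 *\<^sub>R v))
      = (s - 0) * (g (x + a *\<^sub>R v + s *\<^sub>R w) - g (x + a *\<^sub>R v))"
    using MVT2[OF s, of "\<lambda>a. f (x + a *\<^sub>R v + s *\<^sub>R w) - f (x + a *\<^sub>R v)"
        "\<lambda>a. g (x + a *\<^sub>R v + s *\<^sub>R w) - g (x + a *\<^sub>R v)"] d1 by blast
  have d2: "((\<lambda>b. g (x + a *\<^sub>R v + b *\<^sub>R w)) has_real_derivative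
      iter_deriv [v, w] f (x + a *\<^sub>R v + b *\<^sub>R w)) (at b)" if "0 \<le> b" "b \<le> s" for b
    using smooth_on_line_derivative[OF g, of "x + a *\<^sub>R v" b w] inS[of a b] a that
    unfolding has_real_derivative_iff_has_vector_derivative by (simp add: g_def)
  obtain b where b: "0 < b" "b < s"
    "g (x + a *\<^sub>R v + s *\<^sub>R w) - g (x + a *\<^sub>R v + 0 *\<^sub>R w)
      = (s - 0) * iter_deriv [v, w] f (x + a *\<^sub>R v + b *\<^sub>R w)"
    using MVT2[OF s, of "\<lambda>b. g (x + a *\<^sub>R v + b *\<^sub>R w)"
        "\<lambda>b. iter_deriv [v, w] f (x + a *\<^sub>R v + b *\<^sub>R w)"] d2 by blast
  show ?thesis
    using a b by (intro exI[of _ a] exI[of _ b]) auto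
qed

text \<open>Schwarz's theorem: \<open>\<Delta>\<close> is symmetric in \<open>v\<close> and
  \<open>w\<close>, so the same quotient \<open>\<Delta> s / (s * s)\<close> converges to both mixed
  derivatives.\<close>

lemma iter_deriv_swap_real:
  fixes f :: "'a::euclidean_space \<Rightarrow> real"
  assumes f: "smooth_on S f" and x: "x \<in> S"
  shows "iter_deriv [v, w] f x = iter_deriv [w, v] f x"
proof -
  define \<Delta> where
    "\<Delta> s = f (x + s *\<^sub>R v + s *\<^sub>R w) - f (x + s *\<^sub>R v) - f (x + s *\<^sub>R w) + f x" for s
  obtain e where e: "e > 0" "ball x e \<subseteq> S"
    using smooth_on_open[OF f] x open_contains_ball by blast
  \<comment> \<open>A parallelogram with sides \<open>s *\<^sub>R v\<close> and
    \<open>s *\<^sub>R w\<close> stays within \<open>s * (1 + norm v + norm w)\<close> of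
    \<open>x\<close>; the summand 1 keeps the denominator positive when both directions
    vanish.\<close>
  define \<delta> where "\<delta> = e / (2 * (1 + norm v + norm w))"
  have n: "1 + norm v + norm w > 0" by (smt (verit) norm_ge_zero)
  have \<delta>: "\<delta> > 0" using e n unfolding \<delta>_def by simp
  have lt: "norm (a *\<^sub>R v + b *\<^sub>R w) \<le> s * (1 + norm v + norm w)"
    if "0 \<le> a" "a \<le> s" "0 \<le> b" "b \<le> s" for a b s
  proof -
    have "norm (a *\<^sub>R v + b *\<^sub>R w) \<le> a * norm v + b * norm w"
      using norm_triangle_ineq[of "a *\<^sub>R v" "b *\<^sub>R w"] that by simp
    also have "\<dots> \<le> s * norm v + s * norm w"
      using that by (intro add_mono mult_right_mono) auto
    finally show ?thesis using that by (simp add: algebra_simps)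
  qed
  have inS: "x + a *\<^sub>R v + b *\<^sub>R w \<in> S"
    if "0 \<le> a" "a \<le> s" "0 \<le> b" "b \<le> s" "s < \<delta>" for a b s
  proof -
    have "s * (1 + norm v + norm w) < e"
      using that n e unfolding \<delta>_def by (auto simp: field_simps)
    with lt[OF that(1-4)] have "x + a *\<^sub>R v + b *\<^sub>R w \<in> ball x e"
      by (simp add: dist_norm algebra_simps norm_minus_commute)
    then show ?thesis using e by blast
  qed
  have lim: "((\<lambda>s. \<Delta> s / (s * s)) \<longlongrightarrow> iter_deriv [v', w'] f x) (at_right 0)"
    if vw: "v' = v \<and> w' = w \<or> v' = w \<and> w' = v" for v' w'
  proof (rule tendstoI)
    fix r :: real assume r: "r > 0"
    have "isCont (iter_deriv [v', w'] f) x"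
      by (rule smooth_on_continuous[OF smooth_on_iter_deriv[OF f] x])
    then obtain d where d: "d > 0"
      "\<And>y. dist y x < d \<Longrightarrow> dist (iter_deriv [v', w'] f y) (iter_deriv [v', w'] f x) < r"
      using r unfolding continuous_at_eps_delta by metis
    have "eventually (\<lambda>s. s < min \<delta> (d / (1 + norm v + norm w))) (at_right (0::real))"
      using \<delta> d n by (intro order_tendstoD[OF tendsto_ident_at]) simp
    moreover have "eventually (\<lambda>s. s > 0) (at_right (0::real))"
      by (rule eventually_at_right_less)
    ultimately show "eventually (\<lambda>s. dist (\<Delta> s / (s * s)) (iter_deriv [v', w'] f x) < r) (at_right 0)"
    proof eventually_elim
      case (elim s)
      have "\<exists>a b. 0 < a \<and> a < s \<and> 0 < b \<and> b < s \<and>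
          \<Delta> s = s * (s * iter_deriv [v', w'] f (x + a *\<^sub>R v' + b *\<^sub>R w'))"
        using vw
      proof
        assume "v' = v \<and> w' = w"
        then show ?thesis
          using second_difference_eq_iter_deriv[OF f, of s x v w] inS[of _ s] elim
          unfolding \<Delta>_def by auto
      next
        assume vw': "v' = w \<and> w' = v"
        have "x + a *\<^sub>R w + b *\<^sub>R v \<in> S" if "0 \<le> a" "a \<le> s" "0 \<le> b" "b \<le> s" for a b
          using inS[of b s a] that elim by (simp add: algebra_simps)
        from second_difference_eq_iter_deriv[OF f elim(2) this]
        show ?thesis
          using vw' unfolding \<Delta>_def by (simp add: algebra_simps)
      qed
      then obtain a b where ab: "0 < a" "a < s" "0 < b" "b < s"
        and eq: "\<Delta> s = s * (s * iter_deriv [v', w'] f (x + a *\<^sub>R v' + b *\<^sub>R w'))" by blast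
      have "norm (a *\<^sub>R v' + b *\<^sub>R w') \<le> s * (1 + norm v + norm w)"
        using lt[of a s b] lt[of b s a] ab vw by (auto simp: add.commute)
      also have "\<dots> < d" using elim n by (simp add: field_simps)
      finally have "dist (x + a *\<^sub>R v' + b *\<^sub>R w') x < d" by (simp add: dist_norm algebra_simps)
      from d(2)[OF this] show ?case using eq elim by simp
    qed
  qed
  show ?thesis
    using tendsto_unique[OF _ lim[of v w] lim[of w v]] by simp
qed

text \<open>The real case componentwise. The identity holds on all of \<open>S\<close>, so the later
  directions \<open>vs\<close> may be applied to both sides.\<close>

lemma iter_deriv_swap:
  fixes f :: "'a::euclidean_space \<Rightarrow> 'b::euclidean_space"
  assumes f: "smooth_on S f" and x: "x \<in> S"
  shows "iter_deriv (v # w # vs) f x = iter_deriv (w # v # vs) f x"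
proof -
  have "iter_deriv [v, w] f y = iter_deriv [w, v] f y" if y: "y \<in> S" for y
  proof (rule euclidean_eqI)
    fix b :: 'b
    have "iter_deriv us f y \<bullet> b = iter_deriv us (\<lambda>y. f y \<bullet> b) y" for us
      by (rule iter_deriv_bounded_linear[OF bounded_linear_inner_left f y, symmetric])
    then show "iter_deriv [v, w] f y \<bullet> b = iter_deriv [w, v] f y \<bullet> b"
      using iter_deriv_swap_real[OF smooth_on_bounded_linear[OF bounded_linear_inner_left f] y]
      by metis
  qed
  then have "iter_deriv vs (iter_deriv [v, w] f) x = iter_deriv vs (iter_deriv [w, v] f) x"
    by (intro iter_deriv_cong_open[OF smooth_on_open[OF f] x]) auto
  then show ?thesis by (simp flip: iter_deriv_append)
qed

lemma iter_deriv_move: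
  assumes f: "smooth_on S f" and x: "x \<in> S"
  shows "iter_deriv (us @ v # vs) f x = iter_deriv (v # us @ vs) f x"
  using f
proof (induction us arbitrary: f)
  case (Cons u us)
  have "iter_deriv ((u # us) @ v # vs) f x = iter_deriv (u # v # us @ vs) f x"
    using Cons.IH[OF smooth_on_frechet_derivative[OF Cons.prems]] by simp
  then show ?case
    using iter_deriv_swap[OF Cons.prems x] by simp
qed simp

lemma iter_deriv_perm:
  assumes f: "smooth_on S f" and x: "x \<in> S" and "mset vs = mset ws"
  shows "iter_deriv vs f x = iter_deriv ws f x"
  using f assms(3)
proof (induction vs arbitrary: ws f)
  case (Cons v vs)
  then obtain as bs where ws: "ws = as @ v # bs"
    by (metis list.set_intros(1) mset_eq_setD split_list)
  with Cons.prems have "mset vs = mset (as @ bs)" by simp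
  from Cons.IH[OF smooth_on_frechet_derivative[OF Cons.prems(1)] this]
  have "iter_deriv (v # vs) f x = iter_deriv (v # as @ bs) f x" by simp
  then show ?case
    unfolding ws using iter_deriv_move[OF Cons.prems(1) x] by simp
qed simp

section \<open>Taylor and mean value limits with moving points and directions\<close>

lemma tendsto_iter_deriv_replicate:
  assumes "smooth_on S f" "x0 \<in> S"
    and "(x \<longlongrightarrow> x0) F" "(v \<longlongrightarrow> v0) F"
  shows "((\<lambda>s. iter_deriv (replicate k (v s)) f (x s)) \<longlongrightarrow> iter_deriv (replicate k v0) f x0) F"
  using assms(1)
proof (induction k arbitrary: f)
  case 0
  then show ?case
    using isCont_tendsto_compose[OF smooth_on_continuous[OF _ assms(2)] assms(3)] by auto
next
  case (Suc k)
  \<comment> \<open>Expanding the first direction in the basis turns it into scalar coefficients and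
    leaves \<open>k\<close> copies of \<open>w\<close> acting on fixed partial derivatives of
    \<open>f\<close>, to which the induction hypothesis applies.\<close>
  have exp: "iter_deriv (replicate (Suc k) w) f y
      = (\<Sum>i\<in>Basis. (w \<bullet> i) *\<^sub>R iter_deriv (replicate k w) (\<lambda>z. frechet_derivative f (at z) i) y)"
    if "y \<in> S" for w y
  proof -
    note lin = iter_deriv_Cons_linear[OF Suc.prems that, of "replicate k w"]
    have "iter_deriv (w # replicate k w) f y
        = iter_deriv ((\<Sum>i\<in>Basis. (w \<bullet> i) *\<^sub>R i) # replicate k w) f y"
      by (simp only: euclidean_representation)
    also have "\<dots> = (\<Sum>i\<in>Basis. (w \<bullet> i) *\<^sub>R iter_deriv (i # replicate k w) f y)"
      using linear_sum[OF lin, of "\<lambda>i. (w \<bullet> i) *\<^sub>R i"] linear_scale[OF lin] by simp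
    finally show ?thesis by simp
  qed
  have "((\<lambda>s. \<Sum>i\<in>Basis. (v s \<bullet> i) *\<^sub>R
        iter_deriv (replicate k (v s)) (\<lambda>z. frechet_derivative f (at z) i) (x s))
      \<longlongrightarrow> iter_deriv (replicate (Suc k) v0) f x0) F"
    unfolding exp[OF assms(2)]
    by (intro tendsto_intros assms(4) Suc.IH smooth_on_frechet_derivative Suc.prems)
  moreover have "eventually (\<lambda>s. x s \<in> S) F"
    using assms(2,3) smooth_on_open[OF Suc.prems] by (metis topological_tendstoD)
  ultimately show ?case
    by (rule Lim_transform_eventually[OF _ eventually_mono]) (metis exp)
qed

text \<open>Lagrange remainder on the segment from \<open>x0\<close> to
  \<open>x0 + s *\<^sub>R \<beta> s\<close>, then joint continuity in point and direction. The lower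
  derivatives are asked to vanish only along \<open>\<beta> s\<close>, because the graph function of
  a contact chart is flat only in directions of \<open>span K\<close>.\<close>

lemma taylor_tendsto_real:
  fixes f :: "'a::euclidean_space \<Rightarrow> real"
  assumes f: "smooth_on S f" and x0: "x0 \<in> S" and \<beta>: "(\<beta> \<longlongrightarrow> v) (at_right 0)"
    and vanish: "eventually (\<lambda>s. \<forall>k<d. iter_deriv (replicate k (\<beta> s)) f x0 = 0) (at_right (0::real))"
  shows "((\<lambda>s. f (x0 + s *\<^sub>R \<beta> s) / s ^ d) \<longlongrightarrow> iter_deriv (replicate d v) f x0 / fact d) (at_right 0)"
proof -
  obtain e where e: "e > 0" "ball x0 e \<subseteq> S"
    using smooth_on_open[OF f] x0 open_contains_ball by blast
  have lim0: "((\<lambda>s. s * norm (\<beta> s)) \<longlongrightarrow> 0) (at_right 0)"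
    using tendsto_mult[OF tendsto_ident_at tendsto_norm[OF \<beta>]] by simp
  define P where "P s t \<longleftrightarrow> 0 < t \<and> t \<le> s \<and>
    f (x0 + s *\<^sub>R \<beta> s) / s ^ d = iter_deriv (replicate d (\<beta> s)) f (x0 + t *\<^sub>R \<beta> s) / fact d" for s t
  have "eventually (\<lambda>s. s * norm (\<beta> s) < e) (at_right 0)"
    by (rule order_tendstoD(2)[OF lim0 e(1)])
  moreover have "eventually (\<lambda>s. s > 0) (at_right (0::real))"
    by (rule eventually_at_right_less)
  ultimately have ex: "eventually (\<lambda>s. \<exists>t. P s t) (at_right 0)"
    using vanish
  proof eventually_elim
    case (elim s)
    have inS: "x0 + t *\<^sub>R \<beta> s \<in> S" if "0 \<le> t" "t \<le> s" for t
    proof -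
      have "t * norm (\<beta> s) \<le> s * norm (\<beta> s)" using that by (intro mult_right_mono) auto
      then have "x0 + t *\<^sub>R \<beta> s \<in> ball x0 e" using elim that by (simp add: dist_norm)
      then show ?thesis using e by blast
    qed
    define diff where "diff m t = iter_deriv (replicate m (\<beta> s)) f (x0 + t *\<^sub>R \<beta> s)" for m t
    have diff_0: "diff 0 = (\<lambda>t. f (x0 + t *\<^sub>R \<beta> s))"
      by (simp add: diff_def[abs_def])
    have "(diff m has_real_derivative diff (Suc m) t) (at t)" if "0 \<le> t" "t \<le> s" for m t
    proof -
      \<comment> \<open>Differentiating in \<open>t\<close> adds an outermost derivative, that is,
        an entry at the end of the list.\<close>
      have "diff (Suc m) t = iter_deriv (replicate m (\<beta> s) @ [\<beta> s]) f (x0 + t *\<^sub>R \<beta> s)"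
        unfolding diff_def by (simp add: replicate_append_same)
      then show ?thesis
        using smooth_on_line_derivative[OF smooth_on_iter_deriv[OF f] inS[OF that], of "replicate m (\<beta> s)"]
        unfolding has_real_derivative_iff_has_vector_derivative
        by (simp add: diff_def[abs_def] iter_deriv_append)
    qed
    then obtain t where t: "0 < t" "t \<le> s" "f (x0 + s *\<^sub>R \<beta> s)
        = (\<Sum>m<d. diff m 0 / fact m * s ^ m) + diff d t / fact d * s ^ d"
      using Maclaurin2[of s diff "\<lambda>t. f (x0 + t *\<^sub>R \<beta> s)" d] elim
      by (metis (no_types, lifting) diff_0)
    have "(\<Sum>m<d. diff m 0 / fact m * s ^ m) = 0"
      using elim by (auto simp: diff_def intro!: sum.neutral)
    then show ?case using t elim by (auto simp: P_def diff_def intro!: exI[of _ t])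
  qed
  \<comment> \<open>Choosing one remainder point for each \<open>s\<close> yields a function of
    \<open>s\<close>, so that limits can be taken.\<close>
  define \<tau> where "\<tau> s = (SOME t. P s t)" for s
  have P: "eventually (\<lambda>s. P s (\<tau> s)) (at_right 0)"
    using ex by eventually_elim (auto simp: \<tau>_def intro: someI)
  have "eventually (\<lambda>s. norm (\<tau> s *\<^sub>R \<beta> s) \<le> s * norm (\<beta> s)) (at_right 0)"
    using P by eventually_elim (auto simp: P_def intro!: mult_right_mono)
  then have "((\<lambda>s. \<tau> s *\<^sub>R \<beta> s) \<longlongrightarrow> 0) (at_right 0)"
    by (rule Lim_null_comparison[OF _ lim0])
  then have "((\<lambda>s. x0 + \<tau> s *\<^sub>R \<beta> s) \<longlongrightarrow> x0) (at_right 0)"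
    using tendsto_add[OF tendsto_const] by fastforce
  from tendsto_iter_deriv_replicate[OF f x0 this \<beta>, of d]
  have "((\<lambda>s. iter_deriv (replicate d (\<beta> s)) f (x0 + \<tau> s *\<^sub>R \<beta> s) / fact d)
      \<longlongrightarrow> iter_deriv (replicate d v) f x0 / fact d) (at_right 0)"
    by (intro tendsto_intros) auto
  then show ?thesis
    by (rule Lim_transform_eventually) (use P in \<open>eventually_elim, simp add: P_def\<close>)
qed

lemma taylor_tendsto:
  fixes f :: "'a::euclidean_space \<Rightarrow> 'b::euclidean_space"
  assumes f: "smooth_on S f" and x0: "x0 \<in> S" and \<beta>: "(\<beta> \<longlongrightarrow> v) (at_right 0)"
    and vanish: "eventually (\<lambda>s. \<forall>k<d. iter_deriv (replicate k (\<beta> s)) f x0 = 0) (at_right (0::real))"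
  shows "((\<lambda>s. f (x0 + s *\<^sub>R \<beta> s) /\<^sub>R s ^ d) \<longlongrightarrow> iter_deriv (replicate d v) f x0 /\<^sub>R fact d) (at_right 0)"
proof (subst tendsto_componentwise_iff, intro ballI)
  fix b :: 'b
  note comp = iter_deriv_bounded_linear[OF bounded_linear_inner_left f x0, of _ b]
  have "((\<lambda>s. (f (x0 + s *\<^sub>R \<beta> s) \<bullet> b) / s ^ d) \<longlongrightarrow>
      iter_deriv (replicate d v) (\<lambda>x. f x \<bullet> b) x0 / fact d) (at_right 0)"
    by (rule taylor_tendsto_real[OF smooth_on_bounded_linear[OF bounded_linear_inner_left f] x0 \<beta>])
      (use vanish in \<open>simp add: comp eventually_mono\<close>)
  then show "((\<lambda>s. (f (x0 + s *\<^sub>R \<beta> s) /\<^sub>R s ^ d) \<bullet> b) \<longlongrightarrow>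
      (iter_deriv (replicate d v) f x0 /\<^sub>R fact d) \<bullet> b) (at_right 0)"
    by (simp add: comp divide_inverse mult.commute)
qed

text \<open>A mean value point between \<open>y s\<close> and \<open>x s\<close> tends to
  \<open>w\<close>, and the derivative is continuous. Differentiability at \<open>w\<close> alone
  would be too weak: \<open>r s\<close> will be \<open>s^-d\<close>, whereas \<open>x s\<close> and
  \<open>y s\<close> approach \<open>w\<close> only at rate \<open>s\<close>.\<close>

lemma strict_derivative_tendsto_real:
  fixes f :: "'a::euclidean_space \<Rightarrow> real"
  assumes f: "smooth_on S f" and w: "w \<in> S"
    and x: "(x \<longlongrightarrow> w) F" and y: "(y \<longlongrightarrow> w) F" and L: "((\<lambda>s. r s *\<^sub>R (x s - y s)) \<longlongrightarrow> L) F"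
  shows "((\<lambda>s. r s * (f (x s) - f (y s))) \<longlongrightarrow> frechet_derivative f (at w) L) F"
proof -
  obtain e where e: "e > 0" "ball w e \<subseteq> S"
    using smooth_on_open[OF f] w open_contains_ball by blast
  define P where "P s t \<longleftrightarrow> 0 < t \<and> t < 1 \<and>
    f (x s) - f (y s) = frechet_derivative f (at (y s + t *\<^sub>R (x s - y s))) (x s - y s)
    \<and> y s + t *\<^sub>R (x s - y s) \<in> S" for s and t :: real
  have "eventually (\<lambda>s. x s \<in> ball w e) F" "eventually (\<lambda>s. y s \<in> ball w e) F"
    using topological_tendstoD[OF x, of "ball w e"] topological_tendstoD[OF y, of "ball w e"] e by auto
  then have ex: "eventually (\<lambda>s. \<exists>t. P s t) F"
  proof eventually_elim
    case (elim s)
    have inS: "y s + t *\<^sub>R (x s - y s) \<in> S" if "0 \<le> t" "t \<le> 1" for t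
    proof -
      have "(1 - t) *\<^sub>R y s + t *\<^sub>R x s \<in> ball w e"
        using elim that by (intro convexD[OF convex_ball]) auto
      then show ?thesis using e by (auto simp: algebra_simps)
    qed
    have d: "((\<lambda>t. f (y s + t *\<^sub>R (x s - y s))) has_real_derivative
        frechet_derivative f (at (y s + t *\<^sub>R (x s - y s))) (x s - y s)) (at t)"
      if "0 \<le> t" "t \<le> 1" for t
      using smooth_on_line_derivative[OF f inS[OF that]]
      unfolding has_real_derivative_iff_has_vector_derivative .
    obtain t where "0 < t" "t < 1" "f (y s + 1 *\<^sub>R (x s - y s)) - f (y s + 0 *\<^sub>R (x s - y s))
        = (1 - 0) * frechet_derivative f (at (y s + t *\<^sub>R (x s - y s))) (x s - y s)"
      using MVT2[of 0 1 "\<lambda>t. f (y s + t *\<^sub>R (x s - y s))"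
          "\<lambda>t. frechet_derivative f (at (y s + t *\<^sub>R (x s - y s))) (x s - y s)"] d by auto
    then show ?case using inS[of t] by (auto simp: P_def intro!: exI[of _ t])
  qed
  define \<tau> where "\<tau> s = (SOME t. P s t)" for s
  have P: "eventually (\<lambda>s. P s (\<tau> s)) F"
    using ex by eventually_elim (auto simp: \<tau>_def intro: someI)
  have d0: "((\<lambda>s. norm (x s - y s)) \<longlongrightarrow> 0) F"
    using tendsto_norm[OF tendsto_diff[OF x y]] by simp
  have "eventually (\<lambda>s. norm (\<tau> s *\<^sub>R (x s - y s)) \<le> norm (x s - y s)) F"
    using P by eventually_elim (auto simp: P_def mult_left_le_one_le)
  then have "((\<lambda>s. \<tau> s *\<^sub>R (x s - y s)) \<longlongrightarrow> 0) F"
    by (rule Lim_null_comparison[OF _ d0])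
  from tendsto_add[OF y this]
  have "((\<lambda>s. y s + \<tau> s *\<^sub>R (x s - y s)) \<longlongrightarrow> w) F" by simp
  \<comment> \<open>A single direction suffices: the base point and the vector
    \<open>r s *\<^sub>R (x s - y s)\<close> move together.\<close>
  from tendsto_iter_deriv_replicate[OF f w this L, of 1]
  have "((\<lambda>s. frechet_derivative f (at (y s + \<tau> s *\<^sub>R (x s - y s))) (r s *\<^sub>R (x s - y s)))
      \<longlongrightarrow> frechet_derivative f (at w) L) F"
    by simp
  then show ?thesis
  proof (rule Lim_transform_eventually)
    show "eventually (\<lambda>s. frechet_derivative f (at (y s + \<tau> s *\<^sub>R (x s - y s))) (r s *\<^sub>R (x s - y s))
        = r s * (f (x s) - f (y s))) F"
      using P
    proof eventually_elim
      case (elim s)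
      then have "linear (frechet_derivative f (at (y s + \<tau> s *\<^sub>R (x s - y s))))"
        unfolding P_def by (intro linear_frechet_derivative smooth_on_differentiable[OF f]) auto
      then show ?case using elim unfolding P_def by (simp add: linear_scale)
    qed
  qed
qed

lemma strict_derivative_tendsto:
  fixes f :: "'a::euclidean_space \<Rightarrow> 'b::euclidean_space"
  assumes f: "smooth_on S f" and w: "w \<in> S"
    and x: "(x \<longlongrightarrow> w) F" and y: "(y \<longlongrightarrow> w) F" and L: "((\<lambda>s. r s *\<^sub>R (x s - y s)) \<longlongrightarrow> L) F"
  shows "((\<lambda>s. r s *\<^sub>R (f (x s) - f (y s))) \<longlongrightarrow> frechet_derivative f (at w) L) F"
proof (subst tendsto_componentwise_iff, intro ballI)
  fix b :: 'b
  have "((\<lambda>s. r s * (f (x s) \<bullet> b - f (y s) \<bullet> b)) \<longlongrightarrow>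
      frechet_derivative (\<lambda>x. f x \<bullet> b) (at w) L) F"
    by (rule strict_derivative_tendsto_real[OF smooth_on_bounded_linear[OF bounded_linear_inner_left f]
          w x y L])
  moreover have "frechet_derivative (\<lambda>x. f x \<bullet> b) (at w) L = frechet_derivative f (at w) L \<bullet> b"
    using iter_deriv_bounded_linear[OF bounded_linear_inner_left f w, of "[L]" b] by simp
  ultimately show "((\<lambda>s. (r s *\<^sub>R (f (x s) - f (y s))) \<bullet> b) \<longlongrightarrow> frechet_derivative f (at w) L \<bullet> b) F"
    by (simp add: inner_diff_left)
qed

section \<open>Restriction of smooth maps to lines\<close>

lemma iter_deriv_compose_line:
  assumes "smooth_on S f" and I: "open I" "\<And>t. t \<in> I \<Longrightarrow> x + t *\<^sub>R b \<in> S" and "t \<in> I"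
  shows "iter_deriv ss (\<lambda>t. c *\<^sub>R f (x + t *\<^sub>R b)) t
    = (c * prod_list ss) *\<^sub>R iter_deriv (replicate (length ss) b) f (x + t *\<^sub>R b)"
  using assms(1,4)
proof (induction ss arbitrary: c f t)
  case (Cons s ss)
  \<comment> \<open>A direction on the real line is a number, so it contributes just a factor, which
    the generalized constant \<open>c\<close> absorbs.\<close>
  have "frechet_derivative (\<lambda>t. c *\<^sub>R f (x + t *\<^sub>R b)) (at u) s
      = (c * s) *\<^sub>R frechet_derivative f (at (x + u *\<^sub>R b)) b" if u: "u \<in> I" for u
  proof -
    have "((\<lambda>t. f (x + t *\<^sub>R b)) has_derivative
        (\<lambda>s. s *\<^sub>R frechet_derivative f (at (x + u *\<^sub>R b)) b)) (at u)"
      using smooth_on_line_derivative[OF Cons.prems(1) I(2)[OF u]] unfolding has_vector_derivative_def .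
    from has_derivative_scaleR_right[OF this, of c]
    show ?thesis by (simp add: frechet_derivative_at[symmetric])
  qed
  then have "iter_deriv (s # ss) (\<lambda>t. c *\<^sub>R f (x + t *\<^sub>R b)) t
      = iter_deriv ss (\<lambda>u. (c * s) *\<^sub>R frechet_derivative f (at (x + u *\<^sub>R b)) b) t"
    unfolding iter_deriv.simps by (intro iter_deriv_cong_open[OF I(1) Cons.prems(2)])
  also have "\<dots> = (c * prod_list (s # ss)) *\<^sub>R iter_deriv (replicate (length (s # ss)) b) f (x + t *\<^sub>R b)"
    using Cons.IH[OF smooth_on_frechet_derivative[OF Cons.prems(1)] Cons.prems(2)]
    by (simp add: mult.assoc)
  finally show ?case .
qed simp

text \<open>This provides the smoothness that \<open>regular_param\<close> demands of a fibre curve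
  obtained as a coordinate line read in another chart.\<close>

lemma smooth_on_compose_line:
  assumes f: "smooth_on S f" and I: "open I" "\<And>t. t \<in> I \<Longrightarrow> x + t *\<^sub>R b \<in> S"
  shows "smooth_on I (\<lambda>t. f (x + t *\<^sub>R b))"
  unfolding smooth_on_def
proof (intro conjI allI ballI)
  fix ss :: "real list" and t assume t: "t \<in> I"
  let ?g = "iter_deriv (replicate (length ss) b) f"
  have eq: "prod_list ss *\<^sub>R ?g (x + u *\<^sub>R b) = iter_deriv ss (\<lambda>t. f (x + t *\<^sub>R b)) u" if "u \<in> I" for u
    using iter_deriv_compose_line[OF f I that, of ss 1] by simp
  have "((\<lambda>t. ?g (x + t *\<^sub>R b)) has_derivative
      (\<lambda>s. s *\<^sub>R frechet_derivative ?g (at (x + t *\<^sub>R b)) b)) (at t)"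
    using smooth_on_line_derivative[OF smooth_on_iter_deriv[OF f] I(2)[OF t]]
    unfolding has_vector_derivative_def .
  from has_derivative_transform_within_open[OF has_derivative_scaleR_right[OF this] I(1) t eq]
  show "iter_deriv ss (\<lambda>t. f (x + t *\<^sub>R b)) differentiable at t"
    unfolding differentiable_def by auto
qed (rule I(1))

section \<open>Polarization and the Koszul argument\<close>

text \<open>Product rule for \<open>m\<close> equal arguments: the induction splits off one copy of
  \<open>v + t *\<^sub>R x\<close>, and its two summands give the two terms.\<close>

lemma polarization_derivative:
  fixes M :: "'a::real_vector list \<Rightarrow> real"
  assumes perm: "\<And>xs ys. length xs = d \<Longrightarrow> mset xs = mset ys \<Longrightarrow> M xs = M ys"
    and lin: "\<And>xs. Suc (length xs) = d \<Longrightarrow> linear (\<lambda>v. M (v # xs))"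
    and "m + length xs = d"
  shows "((\<lambda>t. M (replicate m (v + t *\<^sub>R x) @ xs)) has_real_derivative
    real m * M (x # replicate (m - 1) v @ xs)) (at 0)"
  using assms(3)
proof (induction m arbitrary: xs)
  case (Suc m)
  have eq: "M (replicate (Suc m) (v + t *\<^sub>R x) @ xs)
      = M (replicate m (v + t *\<^sub>R x) @ v # xs) + t * M (replicate m (v + t *\<^sub>R x) @ x # xs)" for t
  proof -
    let ?r = "replicate m (v + t *\<^sub>R x)"
    have l: "linear (\<lambda>w. M (w # ?r @ xs))" using Suc.prems by (intro lin) simp
    have "M (replicate (Suc m) (v + t *\<^sub>R x) @ xs) = M (v # ?r @ xs) + t * M (x # ?r @ xs)"
      using linear_add[OF l] linear_scale[OF l] by simp
    moreover have "M (w # ?r @ xs) = M (?r @ w # xs)" for w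
      using Suc.prems by (intro perm) auto
    ultimately show ?thesis by simp
  qed
  have 1: "((\<lambda>t. M (replicate m (v + t *\<^sub>R x) @ w # xs)) has_real_derivative
      real m * M (x # replicate (m - 1) v @ w # xs)) (at 0)" for w
    using Suc.IH[of "w # xs"] Suc.prems by simp
  have "((\<lambda>t. M (replicate m (v + t *\<^sub>R x) @ v # xs) + t * M (replicate m (v + t *\<^sub>R x) @ x # xs))
      has_real_derivative (real m * M (x # replicate (m - 1) v @ v # xs)
        + M (replicate m v @ x # xs))) (at 0)"
    by (rule derivative_eq_intros 1 refl)+ simp
  moreover have "real m * M (x # replicate (m - 1) v @ v # xs) + M (replicate m v @ x # xs)
      = real (Suc m) * M (x # replicate m v @ xs)"
  proof -
    have 2: "M (replicate m v @ x # xs) = M (x # replicate m v @ xs)"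
      using Suc.prems by (intro perm) auto
    have "M (x # replicate (m - 1) v @ v # xs) = M (x # replicate m v @ xs)" if "m > 0"
      using Suc.prems that by (intro perm) (auto simp: gr0_conv_Suc)
    then show ?thesis unfolding 2 by (cases "m = 0") (auto simp: algebra_simps)
  qed
  ultimately show ?case unfolding eq by simp
qed simp

text \<open>Polarization by differentiation: if the value at \<open>m + 1\<close> entries
  \<open>v + t *\<^sub>R y\<close> followed by \<open>ys\<close> is 0 for all \<open>t\<close>, its
  derivative at 0 says that the value at \<open>y\<close>, \<open>m\<close> entries \<open>v\<close>
  and \<open>ys\<close> is 0. Each round frees one slot.\<close>

lemma polarization_eq_0:
  fixes M :: "'a::real_vector list \<Rightarrow> real"
  assumes perm: "\<And>xs ys. length xs = d \<Longrightarrow> mset xs = mset ys \<Longrightarrow> M xs = M ys"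
    and lin: "\<And>xs. Suc (length xs) = d \<Longrightarrow> linear (\<lambda>v. M (v # xs))"
    and diag: "\<And>v. M (replicate d v) = 0"
    and "length xs = d"
  shows "M xs = 0"
proof -
  \<comment> \<open>Interpolates between the diagonal, \<open>m = d\<close>, and the claim,
    \<open>m = 0\<close>.\<close>
  have "M (replicate m v @ ys) = 0" if "m + length ys = d" for m v ys
    using that
  proof (induction ys arbitrary: m v)
    case (Cons y ys)
    have "((\<lambda>t. M (replicate (Suc m) (v + t *\<^sub>R y) @ ys)) has_real_derivative
        real (Suc m) * M (y # replicate m v @ ys)) (at 0)"
      using polarization_derivative[OF perm lin, where m = "Suc m" and xs = ys and v = v and x = y]
        Cons.prems by simp
    moreover have "M (replicate (Suc m) (v + t *\<^sub>R y) @ ys) = 0" for t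
      using Cons.prems by (intro Cons.IH) simp
    ultimately have "real (Suc m) * M (y # replicate m v @ ys) = 0"
      using DERIV_unique[OF _ DERIV_const] by (simp only:) blast
    moreover have "M (y # replicate m v @ ys) = M (replicate m v @ y # ys)"
      using Cons.prems by (intro perm) auto
    ultimately show ?case by simp
  qed (use diag in simp)
  from this[of 0 xs] show ?thesis using assms(4) by simp
qed

text \<open>\<open>T i j k l\<close> stands for \<open>G (B (e_i, e_j, e_k, ...)) e_l\<close> with
  the remaining arguments frozen. The form \<open>H\<close> may be indefinite, so traces are taken
  with its inverse matrix \<open>K\<close>.\<close>

lemma koszul_trace_eq_0:
  fixes T :: "'n::finite \<Rightarrow> 'n \<Rightarrow> 'n \<Rightarrow> 'n \<Rightarrow> real" and L H K :: "'n \<Rightarrow> 'n \<Rightarrow> real"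
  assumes n: "CARD('n) \<ge> 3"
    and T: "\<And>i j k l. T i j k l = T j i k l" "\<And>i j k l. T i j k l = T i k j l"
    and TL: "\<And>i j k l. T i j k l + T i j l k = L i j * H k l"
    and H: "\<And>i j. H i j = H j i" and K: "\<And>i k. (\<Sum>j\<in>UNIV. K i j * H j k) = (if i = k then 1 else 0)"
    and K': "\<And>i k. (\<Sum>j\<in>UNIV. H i j * K j k) = (if i = k then 1 else 0)"
  shows "T i j k l = 0"
proof -
  define n where "n = real CARD('n)"
  have n3: "n \<ge> 3" using \<open>CARD('n) \<ge> 3\<close> by (simp add: n_def)
  define t where "t = (\<Sum>x\<in>UNIV. \<Sum>v\<in>UNIV. K v x * L x v)"
  \<comment> \<open>Some entry of \<open>H\<close> is nonzero because \<open>K\<close> inverts it;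
    so the symmetry of \<open>T\<close> in its first two slots passes to \<open>L\<close>.\<close>
  have L: "L i j = L j i" for i j
  proof -
    have "\<exists>k l. H k l \<noteq> 0"
    proof (rule ccontr)
      assume "\<nexists>k l. H k l \<noteq> 0"
      with K[of undefined undefined] show False by simp
    qed
    then obtain k l where "H k l \<noteq> 0" by blast
    moreover have "L i j * H k l = L j i * H k l" using TL T(1) by metis
    ultimately show ?thesis by simp
  qed
  \<comment> \<open>With \<open>y\<close> fixed this is the alternating sum that defines the
    Levi-Civita connection: \<open>T\<close> is symmetric in the first three slots and its
    symmetrization in the last two is prescribed.\<close>
  have Koszul: "2 * T x y u v = L x y * H u v + L y u * H x v - L y v * H x u" for x y u v
    using TL[of x y u v] TL[of y u x v] TL[of y v x u] T(1)[of y u x v] T(2)[of u y x v]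
      T(2)[of x y v u] T by (smt (verit, ccfv_threshold))
  \<comment> \<open>Exchanging \<open>x\<close> and \<open>y\<close> preserves \<open>T\<close> and
    the term \<open>L x y * H u v\<close>, so the remaining terms must agree.\<close>
  have E: "L y u * H x v - L y v * H x u = L x u * H y v - L x v * H y u" for x y u v
    using Koszul[of x y u v] Koszul[of y x u v] T(1)[of x y u v] L[of x y] by simp
  \<comment> \<open>Contraction of \<open>E\<close> over \<open>x\<close> and \<open>v\<close>: the
    four terms become \<open>n * L\<close>, \<open>L\<close>, \<open>L\<close> and
    \<open>t * H\<close>.\<close>
  have Ric: "(n - 2) * L y u = - t * H y u" for y u
  proof -
    have s: "(\<Sum>v\<in>UNIV. \<Sum>x\<in>UNIV. K v x * (L y u * H x v - L y v * H x u))
        = (\<Sum>v\<in>UNIV. \<Sum>x\<in>UNIV. K v x * (L x u * H y v - L x v * H y u))"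
      by (simp only: E)
    have 1: "(\<Sum>v\<in>UNIV. \<Sum>x\<in>UNIV. K v x * (L y u * H x v)) = n * L y u"
    proof -
      have "(\<Sum>v\<in>UNIV. \<Sum>x\<in>UNIV. K v x * (L y u * H x v))
          = (\<Sum>v\<in>UNIV. L y u * (\<Sum>x\<in>UNIV. K v x * H x v))"
        by (simp add: sum_distrib_left mult.left_commute)
      then show ?thesis by (simp add: K n_def)
    qed
    have 2: "(\<Sum>v\<in>UNIV. \<Sum>x\<in>UNIV. K v x * (L y v * H x u)) = L y u"
    proof -
      have "(\<Sum>v\<in>UNIV. \<Sum>x\<in>UNIV. K v x * (L y v * H x u))
          = (\<Sum>v\<in>UNIV. L y v * (\<Sum>x\<in>UNIV. K v x * H x u))"
        by (simp add: sum_distrib_left mult.left_commute)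
      then show ?thesis by (simp add: K if_distrib cong: if_cong)
    qed
    have 3: "(\<Sum>v\<in>UNIV. \<Sum>x\<in>UNIV. K v x * (L x u * H y v)) = L y u"
    proof -
      have "(\<Sum>v\<in>UNIV. \<Sum>x\<in>UNIV. K v x * (L x u * H y v))
          = (\<Sum>x\<in>UNIV. L x u * (\<Sum>v\<in>UNIV. H y v * K v x))"
        by (subst sum.swap) (simp add: sum_distrib_left algebra_simps)
      then show ?thesis by (simp add: K' if_distrib cong: if_cong)
    qed
    have 4: "(\<Sum>v\<in>UNIV. \<Sum>x\<in>UNIV. K v x * (L x v * H y u)) = t * H y u"
      unfolding t_def by (subst sum.swap) (simp add: sum_distrib_right mult.assoc)
    have "n * L y u - L y u = L y u - t * H y u"
      using s unfolding right_diff_distrib sum_subtractf 1 2 3 4 .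
    then show ?thesis by (simp add: algebra_simps)
  qed
  \<comment> \<open>A second trace gives \<open>(n - 2) * t = - t * n\<close>, hence
    \<open>t = 0\<close>; then \<open>Ric\<close> and \<open>n - 2 > 0\<close> give
    \<open>L = 0\<close>.\<close>
  have "(n - 2) * t = (\<Sum>x\<in>UNIV. \<Sum>v\<in>UNIV. K v x * ((n - 2) * L x v))"
    unfolding t_def by (simp add: sum_distrib_left mult.left_commute)
  also have "\<dots> = - t * (\<Sum>v\<in>UNIV. \<Sum>x\<in>UNIV. K v x * H x v)"
    unfolding Ric by (subst sum.swap) (simp add: sum_distrib_left mult.left_commute sum_negf)
  also have "\<dots> = - t * n" by (simp add: K n_def)
  finally have "(n - 2) * t = - t * n" .
  then have "t * (2 * n - 2) = 0" by (simp add: algebra_simps)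
  then have "t = 0" using n3 by simp
  then have "L y u = 0" for y u using Ric[of y u] n3 by simp
  then show ?thesis using Koszul[of i j k l] by simp
qed

lemma linear_eq_0_axis:
  fixes f :: "real ^ 'n::finite \<Rightarrow> 'b::real_vector"
  assumes "linear f" "\<And>i. f (axis i 1) = 0"
  shows "f x = 0"
  using linear_eq_stdbasis[OF assms(1), of "\<lambda>x. 0"] assms(2)
  by (auto simp: Basis_vec_def linear_iff fun_eq_iff)

lemma bilinear_expand_axis:
  fixes f :: "real ^ 'n::finite \<Rightarrow> real ^ 'n \<Rightarrow> real"
  assumes "bilinear f"
  shows "f x y = (\<Sum>i\<in>UNIV. \<Sum>j\<in>UNIV. x $ i * y $ j * f (axis i 1) (axis j 1))"
proof -
  have x: "x = (\<Sum>i\<in>UNIV. x $ i *\<^sub>R axis i 1)" for x :: "real ^ 'n"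
    using basis_expansion[of x] by (simp add: scalar_mult_eq_scaleR)
  have "f x y = f (\<Sum>i\<in>UNIV. x $ i *\<^sub>R axis i 1) (\<Sum>j\<in>UNIV. y $ j *\<^sub>R axis j 1)"
    using x by metis
  also have "\<dots> = (\<Sum>(i,j)\<in>UNIV\<times>UNIV. f (x $ i *\<^sub>R axis i 1) (y $ j *\<^sub>R axis j 1))"
    by (rule bilinear_sum[OF assms])
  finally show ?thesis
    by (simp add: bilinear_lmul[OF assms] bilinear_rmul[OF assms] sum.cartesian_product
        algebra_simps)
qed

text \<open>Non-degeneracy is injectivity of the Gram matrix, and a left inverse of a square matrix
  is also a right inverse.\<close>

lemma nondegenerate_inverse:
  fixes H :: "real ^ 'n::finite \<Rightarrow> real ^ 'n \<Rightarrow> real"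
  assumes H: "bilinear H" and nd: "\<And>u. (\<And>v. H v u = 0) \<Longrightarrow> u = 0"
  obtains K where
    "\<And>i k. (\<Sum>j\<in>UNIV. K i j * H (axis j 1) (axis k 1)) = (if i = k then 1 else 0)"
    "\<And>i k. (\<Sum>j\<in>UNIV. H (axis i 1) (axis j 1) * K j k) = (if i = k then 1 else 0)"
proof -
  define A :: "real ^ 'n ^ 'n" where "A = (\<chi> i j. H (axis i 1) (axis j 1))"
  have "x = 0" if "A *v x = 0" for x
  proof (rule nd)
    fix v
    have "H v x = (\<Sum>i\<in>UNIV. v $ i * (A *v x) $ i)"
      by (subst bilinear_expand_axis[OF H])
        (simp add: A_def matrix_vector_mult_def sum_distrib_left algebra_simps)
    then show "H v x = 0" using that by simp
  qed
  then have "inj ((*v) A)"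
    using matrix_left_invertible_ker matrix_left_invertible_injective by blast
  then obtain B where B: "B ** A = mat 1"
    using matrix_left_invertible_injective[of A] by blast
  then have B': "A ** B = mat 1" by (simp add: matrix_left_right_inverse)
  show thesis
  proof (rule that[of "\<lambda>i j. B $ i $ j"])
    fix i k
    show "(\<Sum>j\<in>UNIV. B $ i $ j * H (axis j 1) (axis k 1)) = (if i = k then 1 else 0)"
      using arg_cong[OF B, of "\<lambda>X. X $ i $ k"] by (simp add: A_def matrix_matrix_mult_def mat_def)
    show "(\<Sum>j\<in>UNIV. H (axis i 1) (axis j 1) * B $ j $ k) = (if i = k then 1 else 0)"
      using arg_cong[OF B', of "\<lambda>X. X $ i $ k"] by (simp add: A_def matrix_matrix_mult_def mat_def)
  qed
qed

text \<open>In terms of prolongations: consider the endomorphisms whose symmetrization with respect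
  to \<open>G\<close> is a multiple of \<open>H\<close>. The \<open>d\<close>-th prolongation of
  this linear space is zero for \<open>d \<ge> 2\<close>.\<close>

lemma generic_prolongation_eq_0:
  fixes G H :: "real ^ 'n::finite \<Rightarrow> real ^ 'n \<Rightarrow> real" and B :: "(real ^ 'n) list \<Rightarrow> real ^ 'n"
  assumes n: "CARD('n) \<ge> 3" and d: "d \<ge> 2"
    and G: "bilinear G" "\<And>u. (\<And>w. G u w = 0) \<Longrightarrow> u = 0"
    and H: "bilinear H" "\<And>u v. H u v = H v u" "\<And>u. (\<And>w. H u w = 0) \<Longrightarrow> u = 0"
    and perm: "\<And>xs ys. length xs = Suc d \<Longrightarrow> mset xs = mset ys \<Longrightarrow> B xs = B ys"
    and lin: "\<And>xs. length xs = d \<Longrightarrow> linear (\<lambda>v. B (v # xs))"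
    and diag: "\<And>v. \<exists>l. \<forall>u w. G (B (u # replicate d v)) w + G (B (w # replicate d v)) u = l * H u w"
    and len: "length xs = Suc d"
  shows "B xs = 0"
proof -
  have nz: "\<exists>u w. H u w \<noteq> 0"
  proof (rule ccontr)
    assume "\<nexists>u w. H u w \<noteq> 0"
    then have "axis undefined 1 = (0 :: real ^ 'n)" by (intro H(3)) auto
    then show False by (simp add: axis_eq_0_iff)
  qed
  then obtain u0 w0 where nz: "H u0 w0 \<noteq> 0" by blast
  define S where "S zs u w = G (B (u # zs)) w + G (B (w # zs)) u" for zs u w
  have Sperm: "S xs u w = S ys u w" if "length xs = d" "mset xs = mset ys" for xs ys u w
    using that perm[of "u # xs" "u # ys"] perm[of "w # xs" "w # ys"] unfolding S_def by simp
  have Slin: "linear (\<lambda>v. S (v # zs) u w)" if "Suc (length zs) = d" for zs u w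
  proof -
    have "linear (\<lambda>v. B (u # v # zs))" for u
      using lin[of "u # zs"] perm[of "_ # u # zs" "u # _ # zs"] that by (simp add: add_mset_commute)
    then have "linear (\<lambda>v. G (B (u # v # zs)) w)" for u w
      using linear_compose[of "\<lambda>v. B (u # v # zs)" "\<lambda>x. G x w"] G(1)
      by (simp add: o_def bilinear_def)
    from linear_compose_add[OF this[of u w] this[of w u]]
    show ?thesis unfolding S_def by simp
  qed
  \<comment> \<open>The hypothesis yields a scalar for each \<open>v\<close>, with no stated
    dependence on \<open>v\<close>. Eliminating it by means of the fixed pair \<open>u0\<close>,
    \<open>w0\<close> leaves an identity that is symmetric and multilinear in \<open>zs\<close> and
    can be polarized; the scalar becomes \<open>S zs u0 w0 / H u0 w0\<close>.\<close>
  have pol: "S zs u w * H u0 w0 = S zs u0 w0 * H u w" if "length zs = d" for zs u w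
  proof -
    have "S zs u w * H u0 w0 - S zs u0 w0 * H u w = 0"
    proof (rule polarization_eq_0[OF _ _ _ that])
      fix xs ys :: "(real ^ 'n) list" assume "length xs = d" "mset xs = mset ys"
      then show "S xs u w * H u0 w0 - S xs u0 w0 * H u w = S ys u w * H u0 w0 - S ys u0 w0 * H u w"
        using Sperm by metis
    next
      fix xs :: "(real ^ 'n) list" assume "Suc (length xs) = d"
      note l = Slin[OF this, of u w] Slin[OF this, of u0 w0]
      show "linear (\<lambda>v. S (v # xs) u w * H u0 w0 - S (v # xs) u0 w0 * H u w)"
        using l by (auto simp: linear_iff algebra_simps)
    next
      fix v
      obtain l where "\<And>u w. S (replicate d v) u w = l * H u w"
        using diag[of v] unfolding S_def by blast
      then show "S (replicate d v) u w * H u0 w0 - S (replicate d v) u0 w0 * H u w = 0" by simp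
    qed
    then show ?thesis by simp
  qed
  have nd: "u = 0" if "\<And>v. H v u = 0" for u
    using that H(2) by (intro H(3)) simp
  obtain K where K:
    "\<And>i k. (\<Sum>j\<in>UNIV. K i j * H (axis j 1) (axis k 1)) = (if i = k then 1 else 0)"
    "\<And>i k. (\<Sum>j\<in>UNIV. H (axis i 1) (axis j 1) * K j k) = (if i = k then 1 else 0)"
    using nondegenerate_inverse[OF H(1) nd] by blast
  \<comment> \<open>With the trailing \<open>zs\<close> frozen, the first three slots and the
    pairing with a fourth axis vector make up the array \<open>T\<close>.\<close>
  have base: "B (axis i 1 # axis j 1 # axis k 1 # zs) = 0" if zs: "Suc (Suc (length zs)) = d" for zs i j k
  proof (rule G(2))
    fix w
    define T where "T i j k l = G (B (axis i 1 # axis j 1 # axis k 1 # zs)) (axis l 1)" for i j k l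
    have "T i j k l = 0" for i j k l
    proof (rule koszul_trace_eq_0[OF n, of T "\<lambda>i j. S (axis i 1 # axis j 1 # zs) u0 w0 / H u0 w0"
          "\<lambda>i j. H (axis i 1) (axis j 1)", OF _ _ _ _ K])
      fix i j k l
      show "T i j k l = T j i k l" "T i j k l = T i k j l"
        unfolding T_def using zs
        by (auto intro!: arg_cong[where f="\<lambda>b. G b (axis l 1)"] perm)
      have "T i j k l + T i j l k = S (axis i 1 # axis j 1 # zs) (axis k 1) (axis l 1)"
        unfolding T_def S_def using zs
        by (auto intro!: arg_cong2[where f="(+)"] arg_cong[where f="\<lambda>b. G b _"] perm)
      then show "T i j k l + T i j l k
          = S (axis i 1 # axis j 1 # zs) u0 w0 / H u0 w0 * H (axis k 1) (axis l 1)"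
        using pol[of "axis i 1 # axis j 1 # zs" "axis k 1" "axis l 1"] zs nz by (simp add: field_simps)
    qed (rule H(2))
    then have "G (B (axis i 1 # axis j 1 # axis k 1 # zs)) (axis l 1) = 0" for l
      unfolding T_def .
    then show "G (B (axis i 1 # axis j 1 # axis k 1 # zs)) w = 0"
      using linear_eq_0_axis G(1) unfolding bilinear_def by blast
  qed
  \<comment> \<open>Here \<open>d \<ge> 2\<close> guarantees the three arguments.\<close>
  obtain x y u zs where xs: "xs = x # y # u # zs" and zs: "Suc (Suc (length zs)) = d"
    using len d by (cases xs; cases "tl xs"; cases "tl (tl xs)") auto
  \<comment> \<open>Linearity is assumed in the first slot, so the axis vectors are replaced by
    arbitrary ones in turn, each after a permutation has moved it to the front.\<close>
  have 1: "B (x # axis j 1 # axis k 1 # zs) = 0" for j k x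
    using linear_eq_0_axis[OF lin[of "axis j 1 # axis k 1 # zs"]] base zs by simp
  have 2: "B (y # x # axis k 1 # zs) = 0" for k x y
  proof (rule linear_eq_0_axis[OF lin])
    fix i show "B (axis i 1 # x # axis k 1 # zs) = 0"
      using 1[of x i k] perm[of "axis i 1 # x # axis k 1 # zs" "x # axis i 1 # axis k 1 # zs"] zs by simp
  qed (use zs in simp)
  have "B (u # x # y # zs) = 0" for x y u
  proof (rule linear_eq_0_axis[OF lin])
    fix i show "B (axis i 1 # x # y # zs) = 0"
      using 2[of y x i] perm[of "axis i 1 # x # y # zs" "y # x # axis i 1 # zs"] zs by simp
  qed (use zs in simp)
  then show ?thesis unfolding xs .
qed

section \<open>Forms in coordinates\<close>

lemma chart_inv_apply: "inj_on (snd \<kappa>) (fst \<kappa>) \<Longrightarrow> x \<in> fst \<kappa> \<Longrightarrow> chart_inv \<kappa> (snd \<kappa> x) = x"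
  unfolding chart_inv_def by (rule the_inv_into_f_f)

lemma local_rep_apply:
  "inj_on (snd \<kappa>) (fst \<kappa>) \<Longrightarrow> x \<in> fst \<kappa> \<Longrightarrow> local_rep \<kappa> \<mu> h (snd \<kappa> x) = snd \<mu> (h x)"
  unfolding local_rep_def by (simp add: chart_inv_apply)

text \<open>\<open>N\<close> is a neighbourhood on which composing local representatives gives the
  representative of the composite; off the chart image the values of \<open>chart_inv\<close> are
  unspecified.\<close>

lemma local_rep_has_derivative_compose:
  assumes inj: "inj_on (snd \<kappa>) (fst \<kappa>)" "inj_on (snd \<mu>) (fst \<mu>)"
    and N: "open (snd \<kappa> ` N)" "N \<subseteq> fst \<kappa>" "h ` N \<subseteq> fst \<mu>" "x \<in> N"
    and h: "(local_rep \<kappa> \<mu> h has_derivative D) (at (snd \<kappa> x))"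
    and g: "(local_rep \<mu> \<nu> g has_derivative E) (at (snd \<mu> (h x)))"
  shows "(local_rep \<kappa> \<nu> (\<lambda>y. g (h y)) has_derivative (\<lambda>v. E (D v))) (at (snd \<kappa> x))"
proof -
  have "x \<in> fst \<kappa>" using N by blast
  then have "(local_rep \<mu> \<nu> g has_derivative E) (at (local_rep \<kappa> \<mu> h (snd \<kappa> x)))"
    using g by (simp add: local_rep_apply[OF inj(1)])
  from has_derivative_compose[OF h this] show ?thesis
  proof (rule has_derivative_transform_within_open[OF _ N(1)])
    show "snd \<kappa> x \<in> snd \<kappa> ` N" using N by blast
  next
    fix y assume "y \<in> snd \<kappa> ` N"
    then obtain z where "z \<in> N" "y = snd \<kappa> z" by blast
    then show "local_rep \<mu> \<nu> g (local_rep \<kappa> \<mu> h y) = local_rep \<kappa> \<nu> (\<lambda>y. g (h y)) y"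
      using N inj by (auto simp: local_rep_apply image_subset_iff subset_iff)
  qed
qed

lemma smooth_atlas_inj: "smooth_atlas A \<Longrightarrow> \<kappa> \<in> A \<Longrightarrow> inj_on (snd \<kappa>) (fst \<kappa>)"
  unfolding smooth_atlas_def by fastforce

lemma smooth_atlas_open: "smooth_atlas A \<Longrightarrow> \<kappa> \<in> A \<Longrightarrow> open (snd \<kappa> ` fst \<kappa>)"
  unfolding smooth_atlas_def by fastforce

lemma smooth_atlas_transition:
  "smooth_atlas A \<Longrightarrow> \<kappa> \<in> A \<Longrightarrow> \<mu> \<in> A \<Longrightarrow>
    smooth_on (snd \<kappa> ` (fst \<kappa> \<inter> fst \<mu>)) (local_rep \<kappa> \<mu> (\<lambda>x. x))"
  unfolding smooth_atlas_def by blast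

lemma smooth_atlas_subset: "smooth_atlas A \<Longrightarrow> B \<subseteq> A \<Longrightarrow> smooth_atlas B"
  unfolding smooth_atlas_def by blast

text \<open>Not tied to an atlas: it serves the transition law of tangent vectors on the base as
  well as the passage between a bundle chart and a contact chart.\<close>

definition trans_deriv ::
  "('m, 'e::euclidean_space) chart \<Rightarrow> ('m, 'e) chart \<Rightarrow> 'm \<Rightarrow> 'e \<Rightarrow> 'e" where
  "trans_deriv \<kappa> \<mu> x = frechet_derivative (local_rep \<kappa> \<mu> (\<lambda>x. x)) (at (snd \<kappa> x))"

lemma trans_has_derivative:
  assumes "smooth_atlas A" "\<kappa> \<in> A" "\<mu> \<in> A" "x \<in> fst \<kappa>" "x \<in> fst \<mu>"
  shows "(local_rep \<kappa> \<mu> (\<lambda>x. x) has_derivative trans_deriv \<kappa> \<mu> x) (at (snd \<kappa> x))"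
  unfolding trans_deriv_def
  by (rule smooth_on_has_derivative[OF smooth_atlas_transition[OF assms(1-3)]]) (use assms in blast)

lemma linear_trans_deriv:
  assumes "smooth_atlas A" "\<kappa> \<in> A" "\<mu> \<in> A" "x \<in> fst \<kappa>" "x \<in> fst \<mu>"
  shows "linear (trans_deriv \<kappa> \<mu> x)"
  using trans_has_derivative[OF assms] by (rule has_derivative_linear)

lemma local_rep_self_derivative:
  assumes A: "smooth_atlas A" "\<kappa> \<in> A" and x: "x \<in> fst \<kappa>"
  shows "(local_rep \<kappa> \<kappa> (\<lambda>x. x) has_derivative (\<lambda>v. v)) (at (snd \<kappa> x))"
proof (rule has_derivative_transform_within_open[OF has_derivative_ident smooth_atlas_open[OF A]])
  show "snd \<kappa> x \<in> snd \<kappa> ` fst \<kappa>" using x by blast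
qed (auto simp: local_rep_apply[OF smooth_atlas_inj[OF A]])

lemma trans_deriv_self:
  assumes "smooth_atlas A" "\<kappa> \<in> A" "x \<in> fst \<kappa>"
  shows "trans_deriv \<kappa> \<kappa> x v = v"
  unfolding trans_deriv_def using frechet_derivative_at[OF local_rep_self_derivative[OF assms]] by metis

text \<open>Together with its counterpart for the target, this makes the arbitrary chart chosen in
  \<open>tangent_map\<close> harmless.\<close>

lemma frechet_derivative_local_rep_source:
  assumes A: "smooth_atlas A" "\<kappa> \<in> A" "\<kappa>' \<in> A" and x: "x \<in> fst \<kappa>" "x \<in> fst \<kappa>'"
    and f: "local_rep \<kappa>' \<mu> f differentiable at (snd \<kappa>' x)"
  shows "frechet_derivative (local_rep \<kappa>' \<mu> f) (at (snd \<kappa>' x)) (trans_deriv \<kappa> \<kappa>' x v)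
    = frechet_derivative (local_rep \<kappa> \<mu> f) (at (snd \<kappa> x)) v"
proof -
  have "(local_rep \<kappa> \<mu> (\<lambda>y. f y) has_derivative (\<lambda>v. frechet_derivative (local_rep \<kappa>' \<mu> f)
      (at (snd \<kappa>' x)) (trans_deriv \<kappa> \<kappa>' x v))) (at (snd \<kappa> x))"
    by (rule local_rep_has_derivative_compose[OF smooth_atlas_inj[OF A(1,2)] smooth_atlas_inj[OF A(1,3)]
          smooth_on_open[OF smooth_atlas_transition[OF A]] _ _ _ trans_has_derivative[OF A x]])
      (use x f frechet_derivative_works in auto)
  from frechet_derivative_at[OF this] show ?thesis by metis
qed

lemma trans_deriv_compose:
  assumes A: "smooth_atlas A" "\<kappa> \<in> A" "\<mu> \<in> A" "\<nu> \<in> A"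
    and x: "x \<in> fst \<kappa>" "x \<in> fst \<mu>" "x \<in> fst \<nu>"
  shows "trans_deriv \<mu> \<nu> x (trans_deriv \<kappa> \<mu> x v) = trans_deriv \<kappa> \<nu> x v"
  using frechet_derivative_local_rep_source[OF A(1,2,3) x(1,2)]
    trans_has_derivative[OF A(1,3,4) x(2,3)]
  unfolding trans_deriv_def[of \<mu> \<nu>] trans_deriv_def[of \<kappa> \<nu>] differentiable_def by blast

lemma smooth_map_has_derivative:
  assumes "smooth_map A B U f" "\<kappa> \<in> A" "\<mu> \<in> B" "x \<in> U" "x \<in> fst \<kappa>" "f x \<in> fst \<mu>"
  shows "(local_rep \<kappa> \<mu> f has_derivative frechet_derivative (local_rep \<kappa> \<mu> f) (at (snd \<kappa> x)))
    (at (snd \<kappa> x))"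
proof -
  have "smooth_on (snd \<kappa> ` {x \<in> U \<inter> fst \<kappa>. f x \<in> fst \<mu>}) (local_rep \<kappa> \<mu> f)"
    using assms unfolding smooth_map_def by blast
  then show ?thesis by (rule smooth_on_has_derivative) (use assms in blast)
qed

lemma frechet_derivative_local_rep_target:
  assumes f: "smooth_map A B U f" and A: "smooth_atlas A" "\<kappa> \<in> A"
    and B: "smooth_atlas B" "\<mu> \<in> B" "\<nu> \<in> B"
    and x: "x \<in> U" "x \<in> fst \<kappa>" "f x \<in> fst \<mu>" "f x \<in> fst \<nu>"
  shows "frechet_derivative (local_rep \<kappa> \<nu> f) (at (snd \<kappa> x)) v
    = trans_deriv \<mu> \<nu> (f x) (frechet_derivative (local_rep \<kappa> \<mu> f) (at (snd \<kappa> x)) v)"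
proof -
  have o: "open (snd \<kappa> ` {x \<in> U \<inter> fst \<kappa>. f x \<in> fst \<mu>})"
    using f A B unfolding smooth_map_def by (meson smooth_on_open)
  have "(local_rep \<kappa> \<nu> (\<lambda>y. f y) has_derivative (\<lambda>v. trans_deriv \<mu> \<nu> (f x)
      (frechet_derivative (local_rep \<kappa> \<mu> f) (at (snd \<kappa> x)) v))) (at (snd \<kappa> x))"
    by (rule local_rep_has_derivative_compose[OF smooth_atlas_inj[OF A] smooth_atlas_inj[OF B(1,2)] o
          _ _ _ smooth_map_has_derivative[OF f A(2) B(2) x(1,2,3)]
          trans_has_derivative[OF B x(3,4)]])
      (use x in auto)
  from frechet_derivative_at[OF this] show ?thesis by metis
qed

section \<open>Tangent vectors and bilinear forms read in a chart\<close>

lemma coord_vec_apply: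
  "coord_vec A x \<kappa> e \<mu> = (if \<mu> \<in> A \<and> x \<in> fst \<mu> then trans_deriv \<kappa> \<mu> x e else 0)"
  by (simp add: coord_vec_def trans_deriv_def)

lemma coord_vec_self:
  "smooth_atlas A \<Longrightarrow> \<kappa> \<in> A \<Longrightarrow> x \<in> fst \<kappa> \<Longrightarrow> coord_vec A x \<kappa> e \<kappa> = e"
  by (simp add: coord_vec_apply trans_deriv_self)

lemma coord_vec_in_tspace:
  assumes "smooth_atlas A" "\<kappa> \<in> A" "x \<in> fst \<kappa>"
  shows "coord_vec A x \<kappa> e \<in> tspace A x"
  using assms trans_deriv_compose[OF assms(1,2)] unfolding tspace_def
  by (auto simp: coord_vec_apply trans_deriv_def[symmetric])

text \<open>The transformation law determines every component from a single one. So
  \<open>coord_vec\<close> identifies the model space with the tangent space, and statements about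
  forms can be checked in coordinates.\<close>

lemma tspace_eq_coord_vec:
  assumes "smooth_atlas A" "\<kappa> \<in> A" "x \<in> fst \<kappa>" "u \<in> tspace A x"
  shows "u = coord_vec A x \<kappa> (u \<kappa>)"
proof (rule ext)
  fix \<mu>
  show "u \<mu> = coord_vec A x \<kappa> (u \<kappa>) \<mu>"
  proof (cases "\<mu> \<in> A \<and> x \<in> fst \<mu>")
    case True
    then have "u \<mu> = trans_deriv \<kappa> \<mu> x (u \<kappa>)"
      using assms(2-4) unfolding tspace_def trans_deriv_def by blast
    then show ?thesis using True by (simp add: coord_vec_apply)
  next
    case False
    then have "u \<mu> = 0" using assms(4) unfolding tspace_def by blast
    then show ?thesis unfolding coord_vec_apply if_not_P[OF False] .
  qed
qed

lemma coord_vec_lincomb: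
  assumes "smooth_atlas A" "\<kappa> \<in> A" "x \<in> fst \<kappa>"
  shows "coord_vec A x \<kappa> (a *\<^sub>R e + b *\<^sub>R e') = (\<lambda>\<mu>. a *\<^sub>R coord_vec A x \<kappa> e \<mu> + b *\<^sub>R coord_vec A x \<kappa> e' \<mu>)"
  using linear_trans_deriv[OF assms(1,2)] assms
  by (auto simp: coord_vec_apply fun_eq_iff linear_add linear_scale)

lemma coord_vec_eq_0_iff:
  assumes "smooth_atlas A" "\<kappa> \<in> A" "x \<in> fst \<kappa>"
  shows "coord_vec A x \<kappa> e = (\<lambda>\<mu>. 0) \<longleftrightarrow> e = 0"
proof
  assume "coord_vec A x \<kappa> e = (\<lambda>\<mu>. 0)"
  then show "e = 0" using coord_vec_self[OF assms] by metis
next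
  assume "e = 0"
  then show "coord_vec A x \<kappa> e = (\<lambda>\<mu>. 0)"
    using linear_trans_deriv[OF assms(1,2)] assms by (auto simp: coord_vec_apply fun_eq_iff linear_0)
qed

lemma tangent_map_coord_vec:
  assumes A: "smooth_atlas A" and f: "smooth_map A A U f" and x: "x \<in> U" "\<kappa> \<in> A" "x \<in> fst \<kappa>"
    and \<mu>: "\<mu> \<in> A" "f x \<in> fst \<mu>"
  shows "tangent_map A A f x (coord_vec A x \<kappa> e)
    = coord_vec A (f x) \<mu> (frechet_derivative (local_rep \<kappa> \<mu> f) (at (snd \<kappa> x)) e)"
proof -
  \<comment> \<open>The chart that \<open>tangent_map\<close> picks. The source change compares it
    with \<open>\<kappa>\<close>, the target change compares \<open>\<mu>\<close> with an arbitrary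
    \<open>\<nu>\<close>.\<close>
  define \<kappa>' where "\<kappa>' = (SOME \<kappa>. \<kappa> \<in> A \<and> x \<in> fst \<kappa>)"
  have \<kappa>': "\<kappa>' \<in> A" "x \<in> fst \<kappa>'"
    using someI[of "\<lambda>\<kappa>. \<kappa> \<in> A \<and> x \<in> fst \<kappa>" \<kappa>] x unfolding \<kappa>'_def by auto
  show ?thesis
  proof (rule ext)
    fix \<nu>
    show "tangent_map A A f x (coord_vec A x \<kappa> e) \<nu>
      = coord_vec A (f x) \<mu> (frechet_derivative (local_rep \<kappa> \<mu> f) (at (snd \<kappa> x)) e) \<nu>"
    proof (cases "\<nu> \<in> A \<and> f x \<in> fst \<nu>")
      case True
      have "local_rep \<kappa>' \<nu> f differentiable at (snd \<kappa>' x)"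
        using smooth_map_has_derivative[OF f \<kappa>'(1) _ x(1) \<kappa>'(2)] True
        unfolding differentiable_def by blast
      from frechet_derivative_local_rep_source[OF A x(2) \<kappa>'(1) x(3) \<kappa>'(2) this, of e]
      have "frechet_derivative (local_rep \<kappa>' \<nu> f) (at (snd \<kappa>' x)) (coord_vec A x \<kappa> e \<kappa>')
        = frechet_derivative (local_rep \<kappa> \<nu> f) (at (snd \<kappa> x)) e"
        using \<kappa>' by (simp add: coord_vec_apply)
      then show ?thesis
        using True frechet_derivative_local_rep_target[OF f A x(2) A \<mu>(1) _ x(1,3) \<mu>(2), of \<nu> e]
        unfolding tangent_map_def \<kappa>'_def[symmetric] by (simp add: coord_vec_apply)
    qed (auto simp: tangent_map_def coord_vec_apply Let_def)
  qed
qed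

text \<open>Turns forms at different base points into bilinear forms on one model space, where they
  can be compared and limits can be taken.\<close>

definition coord_form ::
  "('m, 'e::euclidean_space) chart set \<Rightarrow> 'm \<Rightarrow> ('m, 'e) chart \<Rightarrow> ('m, 'e) tform \<Rightarrow> 'e \<Rightarrow> 'e \<Rightarrow> real" where
  "coord_form A x \<kappa> g e e' = g (coord_vec A x \<kappa> e) (coord_vec A x \<kappa> e')"

lemma coord_form_sym:
  assumes "smooth_atlas A" "\<kappa> \<in> A" "x \<in> fst \<kappa>" "g \<in> Sym A x"
  shows "coord_form A x \<kappa> g e e' = coord_form A x \<kappa> g e' e"
  using assms coord_vec_in_tspace[OF assms(1-3)] unfolding Sym_def coord_form_def by blast

lemma bilinear_coord_form:
  assumes "smooth_atlas A" "\<kappa> \<in> A" "x \<in> fst \<kappa>" "g \<in> Sym A x"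
  shows "bilinear (coord_form A x \<kappa> g)"
proof -
  have l: "coord_form A x \<kappa> g (a *\<^sub>R e + b *\<^sub>R e') w = a * coord_form A x \<kappa> g e w + b * coord_form A x \<kappa> g e' w"
    for a b e e' w
    using assms(4) coord_vec_in_tspace[OF assms(1-3)]
    unfolding coord_form_def coord_vec_lincomb[OF assms(1-3)] Sym_def by blast
  have "linear (\<lambda>e. coord_form A x \<kappa> g e w)" for w
    using l[of 1 _ 1 _ w] l[of _ _ 0 0 w] by (intro linearI) auto
  moreover have "linear (coord_form A x \<kappa> g w)" for w
    using calculation[of w] coord_form_sym[OF assms, of _ w] by simp
  ultimately show ?thesis unfolding bilinear_def by auto
qed

lemma SymI:
  assumes A: "smooth_atlas A" "\<kappa> \<in> A" "x \<in> fst \<kappa>"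
    and "bilinear (coord_form A x \<kappa> g)" "\<And>e e'. coord_form A x \<kappa> g e e' = coord_form A x \<kappa> g e' e"
    and "\<And>u v. u \<notin> tspace A x \<or> v \<notin> tspace A x \<Longrightarrow> g u v = 0"
  shows "g \<in> Sym A x"
proof -
  have g: "g u v = coord_form A x \<kappa> g (u \<kappa>) (v \<kappa>)" if "u \<in> tspace A x" "v \<in> tspace A x" for u v
    using tspace_eq_coord_vec[OF A] that unfolding coord_form_def by metis
  have lin: "(\<lambda>\<mu>. a *\<^sub>R u \<mu> + b *\<^sub>R u' \<mu>) \<in> tspace A x" if "u \<in> tspace A x" "u' \<in> tspace A x" for a b u u'
  proof -
    have "(\<lambda>\<mu>. a *\<^sub>R u \<mu> + b *\<^sub>R u' \<mu>) = coord_vec A x \<kappa> (a *\<^sub>R u \<kappa> + b *\<^sub>R u' \<kappa>)"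
      using tspace_eq_coord_vec[OF A] that unfolding coord_vec_lincomb[OF A] by metis
    then show ?thesis using coord_vec_in_tspace[OF A] by simp
  qed
  show ?thesis
    unfolding Sym_def
  proof (intro CollectI conjI ballI allI impI)
    fix u v assume uv: "u \<in> tspace A x" "v \<in> tspace A x"
    show "g u v = g v u" unfolding g[OF uv] g[OF uv(2,1)] by (rule assms(5))
    fix u' a a' assume u': "u' \<in> tspace A x"
    show "g (\<lambda>\<kappa>. a *\<^sub>R u \<kappa> + a' *\<^sub>R u' \<kappa>) v = a * g u v + a' * g u' v"
      unfolding g[OF uv] g[OF u' uv(2)] g[OF lin[OF uv(1) u'] uv(2)]
        bilinear_ladd[OF assms(4)] bilinear_lmul[OF assms(4)] by simp
  qed (rule assms(6))
qed

lemma Sym_pos_iff: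
  assumes A: "smooth_atlas A" "\<kappa> \<in> A" "x \<in> fst \<kappa>"
  shows "g \<in> Sym_pos A x \<longleftrightarrow> g \<in> Sym A x \<and> (\<forall>e. e \<noteq> 0 \<longrightarrow> coord_form A x \<kappa> g e e > 0)"
proof -
  have "(\<forall>u\<in>tspace A x. u \<noteq> (\<lambda>\<kappa>. 0) \<longrightarrow> g u u > 0) \<longleftrightarrow> (\<forall>e. e \<noteq> 0 \<longrightarrow> coord_form A x \<kappa> g e e > 0)"
    unfolding coord_form_def
    using tspace_eq_coord_vec[OF A] coord_vec_in_tspace[OF A] coord_vec_eq_0_iff[OF A] by metis
  then show ?thesis unfolding Sym_pos_def by blast
qed

lemma coord_form_pull_form:
  assumes A: "smooth_atlas A" and f: "smooth_map A A U f" and x: "x \<in> U" "\<kappa> \<in> A" "x \<in> fst \<kappa>"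
    and fx: "f x \<in> fst \<kappa>"
  defines "D \<equiv> frechet_derivative (local_rep \<kappa> \<kappa> f) (at (snd \<kappa> x))"
  shows "coord_form A x \<kappa> (pull_form A f x g) e e' = coord_form A (f x) \<kappa> g (D e) (D e')"
  unfolding coord_form_def pull_form_def D_def
  using tangent_map_coord_vec[OF A f x x(2) fx] coord_vec_in_tspace[OF A x(2,3)] by simp

text \<open>An injective derivative sends nonzero vectors to nonzero vectors, so positivity is
  inherited. This keeps the pulled-back curve inside the bundle.\<close>

lemma pull_form_Sym_pos:
  assumes A: "smooth_atlas A" and f: "smooth_map A A U f" and x: "x \<in> U" "\<kappa> \<in> A" "x \<in> fst \<kappa>"
    and fx: "f x \<in> fst \<kappa>" and g: "g \<in> Sym_pos A (f x)"
    and inj: "\<And>e. frechet_derivative (local_rep \<kappa> \<kappa> f) (at (snd \<kappa> x)) e = 0 \<Longrightarrow> e = 0"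
  shows "pull_form A f x g \<in> Sym_pos A x"
proof -
  let ?D = "frechet_derivative (local_rep \<kappa> \<kappa> f) (at (snd \<kappa> x))"
  have D: "linear ?D"
    using smooth_map_has_derivative[OF f x(2,2,1,3) fx] by (rule has_derivative_linear)
  have gS: "g \<in> Sym A (f x)" using g by (simp add: Sym_pos_def)
  note c = coord_form_pull_form[OF A f x fx]
  note bg = bilinear_coord_form[OF A x(2) fx gS]
  have "bilinear (coord_form A x \<kappa> (pull_form A f x g))"
    unfolding bilinear_def c
    using D bg by (auto intro!: linearI simp: linear_add linear_scale bilinear_ladd bilinear_lmul
        bilinear_radd bilinear_rmul)
  moreover have "coord_form A x \<kappa> (pull_form A f x g) e e' = coord_form A x \<kappa> (pull_form A f x g) e' e" for e e'
    unfolding c by (rule coord_form_sym[OF A x(2) fx gS])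
  ultimately have "pull_form A f x g \<in> Sym A x"
    by (rule SymI[OF A x(2,3)]) (auto simp: pull_form_def)
  moreover have "\<forall>e. e \<noteq> 0 \<longrightarrow> coord_form A x \<kappa> (pull_form A f x g) e e > 0"
    unfolding c using inj g Sym_pos_iff[OF A x(2) fx] by blast
  ultimately show ?thesis using Sym_pos_iff[OF A x(2,3)] by blast
qed

lemma fst_sym_chart: "(x, g) \<in> fst (sym_chart A \<kappa>) \<longleftrightarrow> x \<in> fst \<kappa> \<and> g \<in> Sym_pos A x"
  unfolding sym_chart_def sym_fiber_def by auto

lemma snd_sym_chart:
  "snd (sym_chart A \<kappa>) (x, g) = (snd \<kappa> x, sym_coords (\<lambda>i j. coord_form A x \<kappa> g (axis i 1) (axis j 1)))"
  unfolding sym_chart_def coord_form_def by simp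

section \<open>Contact charts\<close>

text \<open>For \<open>K \<subseteq> Basis\<close> this is the orthogonal projection onto
  \<open>span K\<close>, so \<open>w - span_proj K w\<close> measures the departure of
  \<open>w\<close> from \<open>span K\<close>.\<close>

definition span_proj :: "'f::euclidean_space set \<Rightarrow> 'f \<Rightarrow> 'f" where
  "span_proj K w = (\<Sum>i\<in>K. (w \<bullet> i) *\<^sub>R i)"

lemma bounded_linear_span_proj: "bounded_linear (span_proj K)"
  unfolding span_proj_def by (intro bounded_linear_intros)

lemma span_proj_in_span: "span_proj K w \<in> span K"
  unfolding span_proj_def by (intro span_sum span_scale span_base)

lemma span_proj_span:
  assumes "K \<subseteq> Basis" "w \<in> span K"
  shows "span_proj K w = w"
proof (rule linear_eq_on_span[OF bounded_linear.linear[OF bounded_linear_span_proj] linear_ident _ assms(2)])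
  fix x assume x: "x \<in> K"
  have "finite K" using assms(1) finite_Basis finite_subset by blast
  moreover have "(x \<bullet> i) *\<^sub>R i = (if i = x then x else 0)" if "i \<in> K" for i
    using assms(1) x that inner_not_same_Basis[of x i] inner_same_Basis[of x] by auto
  ultimately show "span_proj K x = x"
    unfolding span_proj_def using x by simp
qed

lemma span_proj_complement:
  assumes "K \<subseteq> Basis" "w \<in> span (Basis - K)"
  shows "span_proj K w = 0"
proof (rule linear_eq_on_span[OF bounded_linear.linear[OF bounded_linear_span_proj] linear_zero _ assms(2)])
  fix x :: 'a assume x: "x \<in> Basis - K"
  show "span_proj K x = 0"
    unfolding span_proj_def
  proof (intro sum.neutral ballI)
    fix i assume "i \<in> K"
    then show "(x \<bullet> i) *\<^sub>R i = 0" using x assms(1) inner_not_same_Basis[of x i] by auto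
  qed
qed

text \<open>Dimension count: lifts of the \<open>n\<close> axis vectors, \<open>h\<close>, and a
  \<open>z\<close> not proportional to \<open>h\<close> would be \<open>n + 2\<close> independent
  vectors in \<open>T\<close>. The injective linear map \<open>F\<close> packages them.\<close>

lemma fst_kernel_dim_1:
  fixes T :: "((real ^ 'n::finite) \<times> 'b::euclidean_space) set"
  assumes T: "subspace T" "dim T \<le> CARD('n) + 1"
    and onto: "\<And>v. \<exists>z. (v, z) \<in> T" and h: "(0, h) \<in> T" "h \<noteq> 0" and z: "(0, z) \<in> T"
  shows "\<exists>l. z = l *\<^sub>R h"
proof (rule ccontr)
  assume no: "\<nexists>l. z = l *\<^sub>R h"
  have "\<forall>i. \<exists>z. (axis i 1, z) \<in> T" using onto by blast
  then obtain t where t: "\<And>i. (axis i 1, t i) \<in> T" unfolding choice_iff by blast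
  define F :: "(real ^ 'n) \<times> real \<times> real \<Rightarrow> (real ^ 'n) \<times> 'b" where
    "F = (\<lambda>(v, a, c). (\<Sum>i\<in>UNIV. v $ i *\<^sub>R (axis i 1, t i)) + a *\<^sub>R (0, h) + c *\<^sub>R (0, z))"
  have F: "F (v, a, c) = (v, (\<Sum>i\<in>UNIV. v $ i *\<^sub>R t i) + a *\<^sub>R h + c *\<^sub>R z)" for v a c
  proof -
    have "fst (\<Sum>i\<in>UNIV. v $ i *\<^sub>R (axis i (1::real), t i)) = v"
      unfolding fst_sum using basis_expansion[of v] by (simp add: scalar_mult_eq_scaleR)
    moreover have "snd (\<Sum>i\<in>UNIV. v $ i *\<^sub>R (axis i (1::real), t i)) = (\<Sum>i\<in>UNIV. v $ i *\<^sub>R t i)"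
      unfolding snd_sum by simp
    ultimately show ?thesis unfolding F_def by (simp add: prod_eq_iff)
  qed
  have lin: "linear F"
    unfolding linear_iff
    by (auto simp: F scaleR_add_left scaleR_add_right sum.distrib scaleR_sum_right)
  have "inj F"
  proof (subst linear_injective_0[OF lin], intro allI impI)
    fix x assume "F x = 0"
    moreover obtain v a c where x: "x = (v, a, c)" by (cases x)
    ultimately have "F (v, a, c) = 0" by simp
    then have v: "v = 0" and "a *\<^sub>R h + c *\<^sub>R z = 0" by (auto simp: F zero_prod_def)
    have "c = 0"
    proof (rule ccontr)
      assume "c \<noteq> 0"
      have "c *\<^sub>R z = (- a) *\<^sub>R h"
        using \<open>a *\<^sub>R h + c *\<^sub>R z = 0\<close> by (simp add: add_eq_0_iff)
      then have "(1 / c) *\<^sub>R (c *\<^sub>R z) = (1 / c) *\<^sub>R ((- a) *\<^sub>R h)" by (rule arg_cong)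
      then have "z = (- a / c) *\<^sub>R h" using \<open>c \<noteq> 0\<close> by simp
      with no show False by blast
    qed
    with \<open>a *\<^sub>R h + c *\<^sub>R z = 0\<close> h(2) v x show "x = 0" by (auto simp: zero_prod_def)
  qed
  then have "dim (range F) = DIM((real ^ 'n) \<times> real \<times> real)"
    using dim_image_eq[OF lin, of UNIV] by (simp add: inj_on_subset)
  moreover have "range F \<subseteq> T"
    unfolding F_def using T(1) t h(1) z
    by (auto intro!: subspace_add subspace_scale subspace_sum simp del: scaleR_Pair)
  ultimately show False using dim_subset[of "range F" T] T(2) by simp
qed

lemma chart_inv_euclidean: "chart_inv (UNIV, \<lambda>x. x) = (\<lambda>x. x)"
  unfolding chart_inv_def by (auto simp: the_inv_into_def)

lemma smooth_curve_has_velocity: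
  assumes c: "smooth_map euclidean_atlas B I c" and \<mu>: "\<mu> \<in> B" "c t \<in> fst \<mu>" and t: "t \<in> I"
  shows "open {s \<in> I. c s \<in> fst \<mu>}"
    "((\<lambda>s. snd \<mu> (c s)) has_vector_derivative velocity B c t \<mu>) (at t)"
proof -
  define \<epsilon> :: "(real, real) chart" where "\<epsilon> = (UNIV, \<lambda>x. x)"
  have "\<epsilon> \<in> euclidean_atlas" by (simp add: \<epsilon>_def euclidean_atlas_def)
  moreover have "\<forall>\<kappa>\<in>euclidean_atlas. \<forall>\<mu>\<in>B.
      smooth_on (snd \<kappa> ` {x \<in> I \<inter> fst \<kappa>. c x \<in> fst \<mu>}) (local_rep \<kappa> \<mu> c)"
    using c unfolding smooth_map_def by (elim conjE)
  ultimately have "smooth_on (snd \<epsilon> ` {x \<in> I \<inter> fst \<epsilon>. c x \<in> fst \<mu>}) (local_rep \<epsilon> \<mu> c)"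
    using \<mu>(1) by blast
  then have s: "smooth_on {s \<in> I. c s \<in> fst \<mu>} (\<lambda>s. snd \<mu> (c s))"
    by (simp add: \<epsilon>_def local_rep_def chart_inv_euclidean o_def)
  then show "open {s \<in> I. c s \<in> fst \<mu>}" by (rule smooth_on_open)
  have "(\<lambda>s. snd \<mu> (c s)) differentiable (at t)"
    using smooth_on_differentiable[OF s] t \<mu> by blast
  then show "((\<lambda>s. snd \<mu> (c s)) has_vector_derivative velocity B c t \<mu>) (at t)"
    using \<mu> by (simp add: vector_derivative_works velocity_def o_def)
qed

lemma uprod_vec_eq_0I:
  fixes z :: "real ^ ('n::finite uprod)"
  assumes "\<And>i j. z $ Upair i j = 0"
  shows "z = 0"
proof -
  have "z $ q = 0" for q by (cases q) (use assms in metis)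
  then show ?thesis by (simp add: vec_eq_iff)
qed

text \<open>In \<open>d_isometry\<close> the first submanifold of the contact is the pull-back and
  the second is \<open>C\<close>: so the pull-back is the linear model \<open>span K\<close>, and
  \<open>C\<close> is the graph of \<open>f\<close>. Here \<open>\<kappa>\<close> is the base chart
  in which the jet is computed, and \<open>\<psi>\<close> is the contact chart around one chosen
  point of the fibre.\<close>

locale contact_chart =
  fixes M :: "('m, real ^ 'n::finite) chart set" and C :: "('m, 'n) bpoint set"
    and U :: "'m set" and \<phi> :: "'m \<Rightarrow> 'm" and d :: nat and p :: 'm
    and \<kappa> :: "('m, real ^ 'n) chart" and g\<^sub>0 :: "('m, real ^ 'n) tform"
    and \<psi> :: "(('m, 'n) bpoint, (real ^ 'n) \<times> (real ^ ('n uprod))) chart"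
    and K :: "((real ^ 'n) \<times> (real ^ ('n uprod))) set"
    and b :: "(real ^ 'n) \<times> (real ^ ('n uprod))"
    and f :: "(real ^ 'n) \<times> (real ^ ('n uprod)) \<Rightarrow> (real ^ 'n) \<times> (real ^ ('n uprod))"
  assumes M: "smooth_atlas M" and gen: "generic_gcs M C" and d: "d \<ge> 2"
    and \<phi>: "local_diffeo M U \<phi>" "p \<in> U" "\<phi> p = p" and jet: "trivial_jet M d \<phi> p"
    and \<kappa>: "\<kappa> \<in> M" "p \<in> fst \<kappa>" and g\<^sub>0: "(p, g\<^sub>0) \<in> C"
    and \<psi>: "\<psi> \<in> maximal_atlas (sym_bundle M)" "(p, g\<^sub>0) \<in> fst \<psi>"
    and K: "K \<subseteq> Basis" "b \<in> K" "card K = CARD('n) + 1"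
    and pull: "snd \<psi> ` (pull_gcs M U \<phi> C \<inter> fst \<psi>) = span K \<inter> snd \<psi> ` fst \<psi>"
    and fib: "snd \<psi> ` (({p} \<times> fiber C p) \<inter> fst \<psi>) = span {b} \<inter> snd \<psi> ` fst \<psi>"
    and f: "smooth_on UNIV f" "f ` span K \<subseteq> span (Basis - K)"
    and graph: "snd \<psi> ` (C \<inter> fst \<psi>) = (\<lambda>x. x + f x) ` span K \<inter> snd \<psi> ` fst \<psi>"
    and flat: "\<forall>x\<in>snd \<psi> ` (({p} \<times> fiber C p) \<inter> fst \<psi>). \<forall>vs. set vs \<subseteq> span K \<longrightarrow> length vs \<le> d \<longrightarrow>
      iter_deriv vs f x = 0"
begin

abbreviation "\<sigma> \<equiv> sym_chart M \<kappa>"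
abbreviation "q\<^sub>0 \<equiv> (p, g\<^sub>0)"
abbreviation "y\<^sub>0 \<equiv> snd \<psi> q\<^sub>0"
text \<open>Two charts at \<open>q\<^sub>0\<close> have to be related: in \<open>\<sigma>\<close> a
  point is its base coordinates and Gram matrix, in \<open>\<psi>\<close> the contact condition is
  visible.\<close>

definition "\<Psi> = local_rep \<sigma> \<psi> (\<lambda>x. x)"
definition "\<Phi> = local_rep \<psi> \<sigma> (\<lambda>x. x)"
abbreviation "D\<Psi> \<equiv> trans_deriv \<sigma> \<psi> q\<^sub>0"
abbreviation "D\<Phi> \<equiv> trans_deriv \<psi> \<sigma> q\<^sub>0"

lemma atlas: "smooth_atlas (insert \<psi> (sym_bundle M))"
  using \<psi>(1) unfolding maximal_atlas_def by blast

lemma bundle_atlas: "smooth_atlas (sym_bundle M)"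
  using smooth_atlas_subset[OF atlas] by blast

lemma \<sigma>: "\<sigma> \<in> sym_bundle M" "\<sigma> \<in> insert \<psi> (sym_bundle M)"
  unfolding sym_bundle_def using \<kappa> by auto

lemma gcs: "gcs M C"
  using gen unfolding generic_gcs_def by blast

lemma C_Sym_pos: "(x, g) \<in> C \<Longrightarrow> g \<in> Sym_pos M x"
  using gcs unfolding gcs_def submanifold_def mcarrier_def sym_bundle_def
  by (fastforce simp: fst_sym_chart)

lemma p: "p \<in> mcarrier M"
  using \<kappa> unfolding mcarrier_def by blast

lemma q\<^sub>0: "q\<^sub>0 \<in> fst \<sigma>"
  using C_Sym_pos[OF g\<^sub>0] \<kappa> by (simp add: fst_sym_chart)

lemma inj_\<psi>: "inj_on (snd \<psi>) (fst \<psi>)" and inj_\<sigma>: "inj_on (snd \<sigma>) (fst \<sigma>)"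
  and inj_\<kappa>: "inj_on (snd \<kappa>) (fst \<kappa>)"
  using smooth_atlas_inj[OF atlas] smooth_atlas_inj[OF M \<kappa>(1)] \<sigma> by auto

lemma smooth_\<Psi>: "smooth_on (snd \<sigma> ` (fst \<sigma> \<inter> fst \<psi>)) \<Psi>"
  and smooth_\<Phi>: "smooth_on (snd \<psi> ` (fst \<psi> \<inter> fst \<sigma>)) \<Phi>"
  unfolding \<Psi>_def \<Phi>_def using smooth_atlas_transition[OF atlas] \<sigma> by auto

lemma \<Psi>_apply: "q \<in> fst \<sigma> \<Longrightarrow> \<Psi> (snd \<sigma> q) = snd \<psi> q"
  unfolding \<Psi>_def by (rule local_rep_apply[OF inj_\<sigma>])

lemma \<Phi>_apply: "q \<in> fst \<psi> \<Longrightarrow> \<Phi> (snd \<psi> q) = snd \<sigma> q"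
  unfolding \<Phi>_def by (rule local_rep_apply[OF inj_\<psi>])

lemma D\<Psi>_D\<Phi>: "D\<Psi> (D\<Phi> w) = w" and D\<Phi>_D\<Psi>: "D\<Phi> (D\<Psi> w) = w"
  using trans_deriv_compose[OF atlas] trans_deriv_self[OF atlas] \<sigma> q\<^sub>0 \<psi>(2) by auto

lemma linear_D\<Psi>: "linear D\<Psi>" and linear_D\<Phi>: "linear D\<Phi>"
  using linear_trans_deriv[OF atlas] \<sigma> q\<^sub>0 \<psi>(2) by auto

lemma y\<^sub>0_fib: "y\<^sub>0 \<in> snd \<psi> ` (({p} \<times> fiber C p) \<inter> fst \<psi>)"
  using \<psi>(2) g\<^sub>0 by (auto simp: fiber_def)

lemma y\<^sub>0_span_b: "y\<^sub>0 \<in> span {b}"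
  using y\<^sub>0_fib fib by blast

lemma y\<^sub>0_span: "y\<^sub>0 \<in> span K"
  using y\<^sub>0_span_b span_mono[of "{b}" K] K by blast

text \<open>Genericity speaks of regular parametrizations, so the coordinate line through
  \<open>y\<^sub>0\<close> in direction \<open>b\<close> is converted into one. Its derivative at 0
  is a non-degenerate form, and the same derivative in bundle coordinates is
  \<open>D\<Phi> b\<close>.\<close>

lemma fiber_direction:
  obtains H :: "real ^ 'n \<Rightarrow> real ^ 'n \<Rightarrow> real" where "bilinear H" "\<And>u v. H u v = H v u" "\<And>u. (\<And>w. H u w = 0) \<Longrightarrow> u = 0"
    "D\<Phi> b = (0, sym_coords (\<lambda>i j. H (axis i 1) (axis j 1)))"
proof -
  note \<Omega> = smooth_on_open[OF smooth_\<Phi>]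
  have y0: "y\<^sub>0 \<in> snd \<psi> ` (fst \<psi> \<inter> fst \<sigma>)" using q\<^sub>0 \<psi>(2) by blast
  have "((\<lambda>t. y\<^sub>0 + t *\<^sub>R b) \<longlongrightarrow> y\<^sub>0 + 0 *\<^sub>R b) (at 0)"
    by (intro tendsto_intros)
  then have "eventually (\<lambda>t. y\<^sub>0 + t *\<^sub>R b \<in> snd \<psi> ` (fst \<psi> \<inter> fst \<sigma>)) (at 0)"
    using \<Omega> y0 by (intro topological_tendstoD) auto
  then obtain \<delta> where \<delta>: "\<delta> > 0"
    and "\<And>t. t \<noteq> 0 \<Longrightarrow> dist t 0 < \<delta> \<Longrightarrow> y\<^sub>0 + t *\<^sub>R b \<in> snd \<psi> ` (fst \<psi> \<inter> fst \<sigma>)"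
    unfolding eventually_at by auto
  then have in\<Omega>: "y\<^sub>0 + t *\<^sub>R b \<in> snd \<psi> ` (fst \<psi> \<inter> fst \<sigma>)" if "t \<in> {-\<delta><..<\<delta>}" for t
    using that y0 by (cases "t = 0") (auto simp: dist_norm)
  define I where "I = {-\<delta><..<\<delta>}"
  have oI: "open I" by (simp add: I_def)
  \<comment> \<open>Points of the line belong to \<open>span {b}\<close>, which the contact chart
    identifies with the fibre; hence their base component is \<open>p\<close>, and the second
    component is a curve of forms.\<close>
  define c where "c t = snd (chart_inv \<psi> (y\<^sub>0 + t *\<^sub>R b))" for t
  have c: "(p, c t) \<in> fst \<psi> \<inter> fst \<sigma>" "c t \<in> fiber C p" "snd \<psi> (p, c t) = y\<^sub>0 + t *\<^sub>R b"
    if t: "t \<in> I" for t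
  proof -
    obtain q where q: "q \<in> fst \<psi>" "q \<in> fst \<sigma>" "y\<^sub>0 + t *\<^sub>R b = snd \<psi> q"
      using in\<Omega>[of t] t unfolding I_def by auto
    have "y\<^sub>0 + t *\<^sub>R b \<in> span {b}"
      using y\<^sub>0_span_b by (intro span_add span_scale) (auto intro: span_base)
    with q have "snd \<psi> q \<in> snd \<psi> ` (({p} \<times> fiber C p) \<inter> fst \<psi>)"
      unfolding fib by auto
    then have "q \<in> {p} \<times> fiber C p"
      using inj_\<psi> q(1) by (auto dest: inj_onD)
    moreover have "chart_inv \<psi> (y\<^sub>0 + t *\<^sub>R b) = q"
      unfolding q(3) by (rule chart_inv_apply[OF inj_\<psi> q(1)])
    ultimately show "(p, c t) \<in> fst \<psi> \<inter> fst \<sigma>" "c t \<in> fiber C p" "snd \<psi> (p, c t) = y\<^sub>0 + t *\<^sub>R b"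
      using q unfolding c_def by auto
  qed
  have cSym: "c t \<in> Sym M p" if "t \<in> I" for t
    using c(1)[OF that] by (simp add: fst_sym_chart Sym_pos_def)
  have \<Phi>c: "\<Phi> (y\<^sub>0 + t *\<^sub>R b) = (snd \<kappa> p, sym_coords (\<lambda>i j. coord_form M p \<kappa> (c t) (axis i 1) (axis j 1)))"
    if "t \<in> I" for t
    using \<Phi>_apply[of "(p, c t)"] c[OF that] by (simp add: snd_sym_chart)
  \<comment> \<open>Evaluates at \<open>u\<close>, \<open>v\<close> the form whose Gram matrix is
    the second bundle coordinate. Being linear in \<open>w\<close>, it reduces smoothness and
    derivatives of \<open>c t u v\<close> to those of \<open>\<Phi>\<close> along the line.\<close>
  define L where "L u v w = (\<Sum>i\<in>UNIV. \<Sum>j\<in>UNIV. (u $ i * v $ j) *\<^sub>R (snd w $ Upair i j))"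
    for u v :: "real ^ 'n" and w :: "(real ^ 'n) \<times> (real ^ ('n uprod))"
  have L: "bounded_linear (L u v)" for u v
    unfolding L_def
    by (intro bounded_linear_sum bounded_linear_const_scaleR
        bounded_linear_compose[OF bounded_linear_vec_nth bounded_linear_snd])
  have Lc: "L u v (\<Phi> (y\<^sub>0 + t *\<^sub>R b)) = coord_form M p \<kappa> (c t) u v" if t: "t \<in> I" for t u v
    unfolding L_def \<Phi>c[OF t] bilinear_expand_axis[OF bilinear_coord_form[OF M \<kappa> cSym[OF t]], of u v]
    by (simp add: sym_coords_Upair coord_form_sym[OF M \<kappa> cSym[OF t]])
  have cL: "c t u v = L (u \<kappa>) (v \<kappa>) (\<Phi> (y\<^sub>0 + t *\<^sub>R b))"
    if "t \<in> I" "u \<in> tspace M p" "v \<in> tspace M p" for t u v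
    unfolding Lc[OF that(1)] coord_form_def using tspace_eq_coord_vec[OF M \<kappa>] that by metis
  define D where "D t = frechet_derivative \<Phi> (at (y\<^sub>0 + t *\<^sub>R b)) b" for t
  have der: "((\<lambda>t. \<Phi> (y\<^sub>0 + t *\<^sub>R b)) has_vector_derivative D t) (at t)" if "t \<in> I" for t
    unfolding D_def using that by (intro smooth_on_line_derivative[OF smooth_\<Phi>] in\<Omega>) (simp add: I_def)
  have fd: "form_deriv c t u v = L (u \<kappa>) (v \<kappa>) (D t)"
    if t: "t \<in> I" and uv: "u \<in> tspace M p" "v \<in> tspace M p" for t u v
  proof -
    have "((\<lambda>t. L (u \<kappa>) (v \<kappa>) (\<Phi> (y\<^sub>0 + t *\<^sub>R b))) has_real_derivative L (u \<kappa>) (v \<kappa>) (D t)) (at t)"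
      unfolding has_real_derivative_iff_has_vector_derivative
      by (rule bounded_linear.has_vector_derivative[OF L der[OF t]])
    then have "((\<lambda>t. c t u v) has_real_derivative L (u \<kappa>) (v \<kappa>) (D t)) (at t)"
      by (rule has_field_derivative_transform_within_open[OF _ oI t]) (simp add: cL uv)
    then show ?thesis unfolding form_deriv_def by (rule DERIV_imp_deriv)
  qed
  have L_axis: "L (axis i 1) (axis j 1) w = snd w $ Upair i j" for i j w
    unfolding L_def by (simp add: axis_def if_distrib[of "\<lambda>x. x * _"] if_distrib[of "\<lambda>x. _ * x"]
        if_distrib[of "\<lambda>x. x *\<^sub>R _"] cong: if_cong)
  have fD: "fst (D t) = 0" if t: "t \<in> I" for t
  proof -
    have "((\<lambda>t. fst (\<Phi> (y\<^sub>0 + t *\<^sub>R b))) has_vector_derivative fst (D t)) (at t)"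
      by (rule bounded_linear.has_vector_derivative[OF bounded_linear_fst der[OF t]])
    moreover have "((\<lambda>t. fst (\<Phi> (y\<^sub>0 + t *\<^sub>R b))) has_vector_derivative 0) (at t)"
      by (rule has_vector_derivative_transform_within_open[OF has_vector_derivative_const oI t,
            of "snd \<kappa> p"]) (simp add: \<Phi>c)
    ultimately show ?thesis by (rule vector_derivative_unique_at)
  qed
  \<comment> \<open>A coordinate change has invertible derivative and \<open>b\<close> is a basis
    vector. As the base part of \<open>D t\<close> vanishes, the form part is nonzero, which is the
    regularity required.\<close>
  have D0: "D t \<noteq> 0" if t: "t \<in> I" for t
  proof
    assume "D t = 0"
    then have "trans_deriv \<psi> \<sigma> (p, c t) b = 0"
      unfolding D_def trans_deriv_def \<Phi>_def c(3)[OF t] .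
    moreover have "trans_deriv \<sigma> \<psi> (p, c t) (trans_deriv \<psi> \<sigma> (p, c t) b) = b"
      using trans_deriv_compose[OF atlas, of \<psi> \<sigma> \<psi> "(p, c t)" b] c(1)[OF t] \<sigma>
        trans_deriv_self[OF atlas, of \<psi> "(p, c t)" b] by auto
    moreover have "linear (trans_deriv \<sigma> \<psi> (p, c t))"
      using linear_trans_deriv[OF atlas] c(1)[OF t] \<sigma> by auto
    ultimately have "b = 0" by (metis linear_0)
    with K show False using nonzero_Basis by blast
  qed
  have nz: "form_deriv c t \<noteq> (\<lambda>u v. 0)" if t: "t \<in> I" for t
  proof
    assume 0: "form_deriv c t = (\<lambda>u v. 0)"
    have "snd (D t) $ Upair i j = 0" for i j
      using fd[OF t coord_vec_in_tspace[OF M \<kappa>] coord_vec_in_tspace[OF M \<kappa>], of "axis i 1" "axis j 1"]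
      by (simp add: 0 coord_vec_self[OF M \<kappa>] L_axis)
    then have "snd (D t) = 0" by (rule uprod_vec_eq_0I)
    with fD[OF t] D0[OF t] show False by (simp add: prod_eq_iff)
  qed
  have "regular_param M C p I c"
    unfolding regular_param_def
  proof (intro conjI ballI)
    show "\<exists>a b. I = {a<..<b}" unfolding I_def by blast
    show "c ` I \<subseteq> fiber C p" using c(2) by blast
    fix u v assume uv: "u \<in> tspace M p" "v \<in> tspace M p"
    have "smooth_on I (\<lambda>t. L (u \<kappa>) (v \<kappa>) (\<Phi> (y\<^sub>0 + t *\<^sub>R b)))"
      by (rule smooth_on_compose_line[OF smooth_on_bounded_linear[OF L smooth_\<Phi>] oI])
        (simp add: in\<Omega> I_def)
    then show "smooth_on I (\<lambda>t. c t u v)"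
      by (rule smooth_on_cong) (simp add: cL uv)
  qed (rule nz)
  moreover have I0: "0 \<in> I" using \<delta> by (simp add: I_def)
  ultimately have h: "form_deriv c 0 \<in> Sym_nondeg M p"
    using gen p unfolding generic_gcs_def by blast
  then have hS: "form_deriv c 0 \<in> Sym M p" unfolding Sym_nondeg_def by blast
  define H where "H = coord_form M p \<kappa> (form_deriv c 0)"
  show thesis
  proof (rule that[of H])
    show "bilinear H" unfolding H_def by (rule bilinear_coord_form[OF M \<kappa> hS])
    show s: "H u v = H v u" for u v unfolding H_def by (rule coord_form_sym[OF M \<kappa> hS])
    show "u = 0" if "\<And>w. H u w = 0" for u
    proof -
      have "form_deriv c 0 (coord_vec M p \<kappa> u) v = 0" if "v \<in> tspace M p" for v
        using \<open>\<And>w. H u w = 0\<close>[of "v \<kappa>"] tspace_eq_coord_vec[OF M \<kappa> that]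
        unfolding H_def coord_form_def by metis
      then have "coord_vec M p \<kappa> u = (\<lambda>\<kappa>. 0)"
        using h coord_vec_in_tspace[OF M \<kappa>] unfolding Sym_nondeg_def by blast
      then show "u = 0" using coord_vec_eq_0_iff[OF M \<kappa>] by blast
    qed
    have D: "D 0 = D\<Phi> b" unfolding D_def trans_deriv_def \<Phi>_def by simp
    have Hij: "H (axis i 1) (axis j 1) = snd (D 0) $ Upair i j" for i j
      using fd[OF I0 coord_vec_in_tspace[OF M \<kappa>] coord_vec_in_tspace[OF M \<kappa>], of "axis i 1" "axis j 1"]
      unfolding H_def coord_form_def by (simp add: coord_vec_self[OF M \<kappa>] L_axis)
    have "snd (D 0) - sym_coords (\<lambda>i j. H (axis i 1) (axis j 1)) = 0"
      by (rule uprod_vec_eq_0I)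
        (simp add: sym_coords_Upair[of "\<lambda>i j. H (axis i 1) (axis j 1)", OF s] Hij[symmetric])
    then show "D\<Phi> b = (0, sym_coords (\<lambda>i j. H (axis i 1) (axis j 1)))"
      using fD[OF I0] by (simp add: D prod_eq_iff)
  qed
qed

end

lemma has_vector_derivative_quotient:
  fixes g :: "real \<Rightarrow> 'a::real_normed_vector"
  assumes "(g has_vector_derivative w) (at 0)"
  shows "((\<lambda>s. (g s - g 0) /\<^sub>R s) \<longlongrightarrow> w) (at 0)"
proof -
  have "((\<lambda>s. norm (g s - g 0 - s *\<^sub>R w) / norm s) \<longlongrightarrow> 0) (at 0)"
    using assms unfolding has_vector_derivative_def has_derivative_at by simp
  then have "((\<lambda>s. norm ((g s - g 0) /\<^sub>R s - w)) \<longlongrightarrow> 0) (at 0)"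
  proof (rule Lim_transform_eventually)
    have "eventually (\<lambda>s. s \<noteq> 0) (at (0::real))" by (simp add: eventually_at_filter)
    then show "eventually (\<lambda>s. norm (g s - g 0 - s *\<^sub>R w) / norm s = norm ((g s - g 0) /\<^sub>R s - w)) (at 0)"
    proof eventually_elim
      case (elim s)
      then have "(g s - g 0) /\<^sub>R s - w = (g s - g 0 - s *\<^sub>R w) /\<^sub>R s"
        by (simp add: scaleR_diff_right)
      then show ?case by (simp add: divide_inverse)
    qed
  qed
  then show ?thesis by (simp add: tendsto_norm_zero_iff Lim_null[of _ w])
qed

section \<open>Curves in the structure and its tangent space at the chosen point\<close>

context contact_chart
begin

text \<open>Transversality splits the lift \<open>(v, 0)\<close> of \<open>v\<close> into the
  velocity of a curve in \<open>C\<close> and that of a curve in the fibre. The latter does not move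
  the base point, so the curve in \<open>C\<close> carries all of \<open>v\<close>.\<close>

lemma horizontal_curve:
  obtains c w where "c 0 = q\<^sub>0" "((\<lambda>t. snd \<sigma> (c t)) has_vector_derivative w) (at 0)" "fst w = v"
    "eventually (\<lambda>t. c t \<in> C \<inter> fst \<sigma>) (at (0::real))"
proof -
  have "q\<^sub>0 \<in> C \<inter> sym_fiber M p"
    using g\<^sub>0 C_Sym_pos[OF g\<^sub>0] by (simp add: sym_fiber_def)
  moreover have "coord_vec (sym_bundle M) q\<^sub>0 \<sigma> (v, 0) \<in> tspace (sym_bundle M) q\<^sub>0"
    by (rule coord_vec_in_tspace[OF bundle_atlas \<sigma>(1) q\<^sub>0])
  ultimately obtain u u' where u: "u \<in> sub_tspace (sym_bundle M) C q\<^sub>0"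
    and u': "u' \<in> sub_tspace (sym_bundle M) (sym_fiber M p) q\<^sub>0"
    and sum: "\<And>\<mu>. coord_vec (sym_bundle M) q\<^sub>0 \<sigma> (v, 0) \<mu> = u \<mu> + u' \<mu>"
    using gcs p unfolding gcs_def transverse_def by blast
  obtain c \<epsilon> where c: "u = velocity (sym_bundle M) c 0" "\<epsilon> > 0" "c 0 = q\<^sub>0" "c ` {-\<epsilon><..<\<epsilon>} \<subseteq> C"
    "smooth_map euclidean_atlas (sym_bundle M) {-\<epsilon><..<\<epsilon>} c"
    using u unfolding sub_tspace_def by blast
  obtain c' \<epsilon>' where c': "u' = velocity (sym_bundle M) c' 0" "\<epsilon>' > 0" "c' 0 = q\<^sub>0"
    "c' ` {-\<epsilon>'<..<\<epsilon>'} \<subseteq> sym_fiber M p"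
    "smooth_map euclidean_atlas (sym_bundle M) {-\<epsilon>'<..<\<epsilon>'} c'"
    using u' unfolding sub_tspace_def by blast
  note D = smooth_curve_has_velocity[OF c(5) \<sigma>(1), of 0]
  note D' = smooth_curve_has_velocity[OF c'(5) \<sigma>(1), of 0]
  have "((\<lambda>t. fst (snd \<sigma> (c' t))) has_vector_derivative fst (u' \<sigma>)) (at 0)"
    using bounded_linear.has_vector_derivative[OF bounded_linear_fst D'(2)] c' q\<^sub>0 by simp
  moreover have "((\<lambda>t. fst (snd \<sigma> (c' t))) has_vector_derivative 0) (at 0)"
  proof (rule has_vector_derivative_transform_within_open[OF has_vector_derivative_const,
        of "{-\<epsilon>'<..<\<epsilon>'}" _ "snd \<kappa> p"])
    fix t assume "t \<in> {-\<epsilon>'<..<\<epsilon>'}"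
    then have "c' t \<in> sym_fiber M p" using c'(4) by blast
    then have "fst (c' t) = p" by (auto simp: sym_fiber_def)
    then show "snd \<kappa> p = fst (snd \<sigma> (c' t))"
      by (cases "c' t") (simp add: snd_sym_chart)
  qed (use c' in auto)
  ultimately have "fst (u' \<sigma>) = 0" by (rule vector_derivative_unique_at)
  then have "fst (u \<sigma>) = v"
    using arg_cong[OF sum[of \<sigma>], of fst] coord_vec_self[OF bundle_atlas \<sigma>(1) q\<^sub>0] by simp
  moreover have "eventually (\<lambda>t. t \<in> {t \<in> {-\<epsilon><..<\<epsilon>}. c t \<in> fst \<sigma>}) (at 0)"
    using D(1) c q\<^sub>0 by (intro eventually_at_in_open') auto
  then have "eventually (\<lambda>t. c t \<in> C \<inter> fst \<sigma>) (at 0)"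
    by (rule eventually_mono) (use c in auto)
  ultimately show thesis
    using that[of c "u \<sigma>"] c D(2) q\<^sub>0 by auto
qed

abbreviation "P \<equiv> span_proj K"

lemma span_iff_proj: "w \<in> span K \<longleftrightarrow> w - P w = 0"
  using span_proj_span[OF K(1), of w] span_proj_in_span[of K w] by (metis eq_iff_diff_eq_0)

lemma flat': "set vs \<subseteq> span K \<Longrightarrow> length vs \<le> d \<Longrightarrow> iter_deriv vs f y\<^sub>0 = 0"
  using flat y\<^sub>0_fib by blast

text \<open>\<open>f\<close> takes values in the complementary span, so the projection recovers the
  parameter of the graph point.\<close>

lemma graph_defect:
  assumes "q \<in> C \<inter> fst \<psi>"
  shows "snd \<psi> q - P (snd \<psi> q) = f (P (snd \<psi> q))"
proof -
  obtain x where x: "x \<in> span K" "snd \<psi> q = x + f x"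
    using graph assms by blast
  have "P (snd \<psi> q) = P x + P (f x)"
    unfolding x(2) by (rule linear_add[OF bounded_linear.linear[OF bounded_linear_span_proj]])
  also have "\<dots> = x"
    using span_proj_span[OF K(1) x(1)] span_proj_complement[OF K(1), of "f x"] f(2) x(1) by auto
  finally show ?thesis using x(2) by simp
qed

lemma eventually_in_\<psi>:
  assumes q: "((\<lambda>s. snd \<sigma> (q s)) \<longlongrightarrow> snd \<sigma> q\<^sub>0) F" and "eventually (\<lambda>s. q s \<in> fst \<sigma>) F"
  shows "eventually (\<lambda>s. q s \<in> fst \<psi>) F"
proof -
  have "eventually (\<lambda>s. snd \<sigma> (q s) \<in> snd \<sigma> ` (fst \<sigma> \<inter> fst \<psi>)) F"
    using q\<^sub>0 \<psi>(2) by (intro topological_tendstoD[OF q smooth_on_open[OF smooth_\<Psi>]]) auto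
  then show ?thesis
    using assms(2) by eventually_elim (use inj_\<sigma> in \<open>auto dest: inj_onD\<close>)
qed

text \<open>The projection of \<open>c s\<close> is \<open>y\<^sub>0 + s *\<^sub>R \<beta> s\<close>
  with \<open>\<beta> s\<close> in \<open>span K\<close>, and the defect is \<open>f\<close> at this
  point. Flatness includes order \<open>d\<close> itself, so the Taylor limit at order
  \<open>d\<close> is 0 as well.\<close>

lemma graph_defect_small:
  assumes c: "c 0 = q\<^sub>0" "((\<lambda>t. snd \<sigma> (c t)) has_vector_derivative w) (at 0)"
    "eventually (\<lambda>t. c t \<in> C \<inter> fst \<sigma>) (at (0::real))"
  shows "((\<lambda>s. (snd \<psi> (c s) - P (snd \<psi> (c s))) /\<^sub>R s ^ d) \<longlongrightarrow> 0) (at_right 0)"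
    and "((\<lambda>s. (snd \<psi> (c s) - y\<^sub>0) /\<^sub>R s) \<longlongrightarrow> D\<Psi> w) (at_right 0)"
    and "((\<lambda>s. snd \<sigma> (c s)) \<longlongrightarrow> snd \<sigma> q\<^sub>0) (at_right 0)"
    and "eventually (\<lambda>s. c s \<in> C \<inter> fst \<sigma> \<inter> fst \<psi>) (at_right 0)"
proof -
  have Pl: "linear P" by (rule bounded_linear.linear[OF bounded_linear_span_proj])
  have le: "at_right 0 \<le> at (0::real)" by (simp add: at_le)
  have lim: "((\<lambda>s. snd \<sigma> (c s)) \<longlongrightarrow> snd \<sigma> (c 0)) (at 0)"
    using has_vector_derivative_continuous[OF c(2)] by (simp add: continuous_at)
  then show lim': "((\<lambda>s. snd \<sigma> (c s)) \<longlongrightarrow> snd \<sigma> q\<^sub>0) (at_right 0)"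
    unfolding c(1) by (rule tendsto_mono[OF le])
  have ev: "eventually (\<lambda>t. c t \<in> C \<inter> fst \<sigma>) (at_right 0)"
    using c(3) le by (simp add: filter_leD)
  then have "eventually (\<lambda>s. c s \<in> fst \<psi>) (at_right 0)"
    by (intro eventually_in_\<psi>[OF lim']) (auto elim: eventually_mono)
  with ev show ev\<psi>: "eventually (\<lambda>s. c s \<in> C \<inter> fst \<sigma> \<inter> fst \<psi>) (at_right 0)"
    by eventually_elim auto
  have "((\<lambda>s. \<Psi> (snd \<sigma> (c s))) has_vector_derivative D\<Psi> w) (at 0)"
    using vector_derivative_diff_chain_within[OF c(2), of \<Psi> "D\<Psi>"]
      trans_has_derivative[OF atlas \<sigma>(2) _ q\<^sub>0 \<psi>(2)] c(1)
    unfolding \<Psi>_def[symmetric] by (auto simp: o_def intro: has_derivative_at_withinI)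
  then have "((\<lambda>s. (\<Psi> (snd \<sigma> (c s)) - \<Psi> (snd \<sigma> (c 0))) /\<^sub>R s) \<longlongrightarrow> D\<Psi> w) (at 0)"
    by (rule has_vector_derivative_quotient)
  then have "((\<lambda>s. (\<Psi> (snd \<sigma> (c s)) - y\<^sub>0) /\<^sub>R s) \<longlongrightarrow> D\<Psi> w) (at_right 0)"
    unfolding c(1) \<Psi>_apply[OF q\<^sub>0] by (rule tendsto_mono[OF le])
  then show lim1: "((\<lambda>s. (snd \<psi> (c s) - y\<^sub>0) /\<^sub>R s) \<longlongrightarrow> D\<Psi> w) (at_right 0)"
    by (rule Lim_transform_eventually)
      (use ev in \<open>eventually_elim, auto simp: \<Psi>_apply\<close>)
  define \<beta> where "\<beta> s = P ((snd \<psi> (c s) - y\<^sub>0) /\<^sub>R s)" for s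
  have \<beta>: "(\<beta> \<longlongrightarrow> P (D\<Psi> w)) (at_right 0)"
    unfolding \<beta>_def by (rule bounded_linear.tendsto[OF bounded_linear_span_proj lim1])
  have \<beta>K: "\<beta> s \<in> span K" for s unfolding \<beta>_def by (rule span_proj_in_span)
  have "((\<lambda>s. f (y\<^sub>0 + s *\<^sub>R \<beta> s) /\<^sub>R s ^ d) \<longlongrightarrow> iter_deriv (replicate d (P (D\<Psi> w))) f y\<^sub>0 /\<^sub>R fact d) (at_right 0)"
    by (rule taylor_tendsto[OF f(1) _ \<beta>]) (auto intro!: flat' \<beta>K always_eventually)
  moreover have "iter_deriv (replicate d (P (D\<Psi> w))) f y\<^sub>0 = 0"
    by (rule flat') (auto simp: span_proj_in_span)
  ultimately have "((\<lambda>s. f (y\<^sub>0 + s *\<^sub>R \<beta> s) /\<^sub>R s ^ d) \<longlongrightarrow> 0) (at_right 0)" by simp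
  then show "((\<lambda>s. (snd \<psi> (c s) - P (snd \<psi> (c s))) /\<^sub>R s ^ d) \<longlongrightarrow> 0) (at_right 0)"
  proof (rule Lim_transform_eventually)
    have "eventually (\<lambda>s. s > 0) (at_right (0::real))"
      by (rule eventually_at_right_less)
    with ev\<psi> show "eventually (\<lambda>s. f (y\<^sub>0 + s *\<^sub>R \<beta> s) /\<^sub>R s ^ d =
        (snd \<psi> (c s) - P (snd \<psi> (c s))) /\<^sub>R s ^ d) (at_right 0)"
    proof eventually_elim
      case (elim s)
      have "y\<^sub>0 + s *\<^sub>R \<beta> s = P (snd \<psi> (c s))"
        using elim span_proj_span[OF K(1) y\<^sub>0_span]
        by (simp add: \<beta>_def linear_scale[OF Pl] linear_diff[OF Pl])
      then show ?case using graph_defect[of "c s"] elim by simp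
    qed
  qed
qed

text \<open>Curves in \<open>C\<close> leave \<open>span K\<close> only at order o(s^d), so their
  velocities lie in \<open>span K\<close>; horizontal curves supply every base direction.\<close>

lemma tangent_space_onto: "\<exists>z. D\<Psi> (v, z) \<in> span K"
proof -
  obtain c w where c: "c 0 = q\<^sub>0" "((\<lambda>t. snd \<sigma> (c t)) has_vector_derivative w) (at 0)" "fst w = v"
    "eventually (\<lambda>t. c t \<in> C \<inter> fst \<sigma>) (at (0::real))"
    by (rule horizontal_curve)
  note g = graph_defect_small[OF c(1,2,4)]
  have Pl: "linear P" by (rule bounded_linear.linear[OF bounded_linear_span_proj])
  have bl: "bounded_linear (\<lambda>x. x - P x)"
    by (intro bounded_linear_sub bounded_linear_ident bounded_linear_span_proj)
  \<comment> \<open>Multiplying by \<open>s ^ (d - 1)\<close> turns the division by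
    \<open>s ^ d\<close> into the division by \<open>s\<close> that computes the velocity.\<close>
  have "((\<lambda>s. s ^ (d - 1) *\<^sub>R ((snd \<psi> (c s) - P (snd \<psi> (c s))) /\<^sub>R s ^ d)) \<longlongrightarrow> 0 ^ (d - 1) *\<^sub>R 0) (at_right 0)"
    by (intro tendsto_intros g(1))
  then have "((\<lambda>s. ((\<lambda>x. x - P x) ((snd \<psi> (c s) - y\<^sub>0) /\<^sub>R s))) \<longlongrightarrow> 0) (at_right 0)"
  proof (rule Lim_transform_eventually[OF _ eventually_mono, OF _ eventually_at_right_less, THEN tendsto_eq_rhs])
    fix s :: real assume s: "0 < s"
    have "s ^ d = s * s ^ (d - 1)" using d by (cases d) auto
    then have e: "s ^ (d - 1) * inverse (s ^ d) = inverse s" using s by simp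
    show "s ^ (d - 1) *\<^sub>R ((snd \<psi> (c s) - P (snd \<psi> (c s))) /\<^sub>R s ^ d)
        = (snd \<psi> (c s) - y\<^sub>0) /\<^sub>R s - P ((snd \<psi> (c s) - y\<^sub>0) /\<^sub>R s)"
      unfolding scaleR_scaleR e using span_proj_span[OF K(1) y\<^sub>0_span]
      by (simp add: linear_scale[OF Pl] linear_diff[OF Pl] scaleR_diff_right)
  qed simp
  moreover have "((\<lambda>s. ((\<lambda>x. x - P x) ((snd \<psi> (c s) - y\<^sub>0) /\<^sub>R s))) \<longlongrightarrow> (\<lambda>x. x - P x) (D\<Psi> w)) (at_right 0)"
    by (rule bounded_linear.tendsto[OF bl g(2)])
  ultimately have "D\<Psi> w - P (D\<Psi> w) = 0"
    using tendsto_unique[OF trivial_limit_at_right_real] by blast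
  then have "D\<Psi> (v, snd w) \<in> span K"
    unfolding span_iff_proj using c(3) by (metis prod.collapse)
  then show ?thesis by blast
qed

text \<open>\<open>T\<close>, the tangent space of \<open>C\<close> in bundle coordinates, has
  dimension at most \<open>n + 1\<close> and projects onto the base directions. Its vertical part is
  therefore a line, spanned by the vertical vector \<open>D\<Phi> b\<close>.\<close>

lemma vertical_tangent:
  assumes "D\<Psi> (0, z) \<in> span K"
  shows "\<exists>l. z = l *\<^sub>R snd (D\<Phi> b)"
proof -
  obtain H :: "real ^ 'n \<Rightarrow> real ^ 'n \<Rightarrow> real"
    where "D\<Phi> b = (0, sym_coords (\<lambda>i j. H (axis i 1) (axis j 1)))"
    by (rule fiber_direction)
  then have H: "fst (D\<Phi> b) = 0" by simp
  define T where "T = D\<Phi> ` span K"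
  have T: "w \<in> T \<longleftrightarrow> D\<Psi> w \<in> span K" for w
    unfolding T_def using D\<Psi>_D\<Phi> D\<Phi>_D\<Psi>[of w] by (auto intro: rev_image_eqI)
  have "subspace T"
    unfolding T_def using linear_D\<Phi> by (intro linear_subspace_image subspace_span)
  moreover have "dim T \<le> CARD('n) + 1"
  proof -
    have "dim T \<le> dim (span K)"
      unfolding T_def by (rule dim_image_le[OF linear_D\<Phi>])
    also have "\<dots> \<le> card K"
      unfolding dim_span by (rule dim_le_card[OF span_superset]) (use K finite_Basis finite_subset in blast)
    finally show ?thesis using K(3) by simp
  qed
  moreover have "\<exists>z. (v, z) \<in> T" for v unfolding T by (rule tangent_space_onto)
  moreover have "(0, snd (D\<Phi> b)) \<in> T"
    unfolding T_def using K(2) H by (intro image_eqI[of _ _ b] span_base) (auto simp: prod_eq_iff)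
  moreover have "snd (D\<Phi> b) \<noteq> 0"
  proof
    assume "snd (D\<Phi> b) = 0"
    then have "D\<Phi> b = 0" using H by (simp add: prod_eq_iff)
    then have "b = 0" using D\<Psi>_D\<Phi>[of b] linear_0[OF linear_D\<Psi>] by simp
    then show False using K nonzero_Basis by blast
  qed
  moreover have "(0, z) \<in> T" using assms T by blast
  ultimately show ?thesis by (rule fst_kernel_dim_1)
qed

end

section \<open>The jet of the isometry\<close>

lemma smooth_on_ident:
  assumes "open S"
  shows "smooth_on S (\<lambda>x. x)"
  unfolding smooth_on_def
proof (intro conjI allI ballI)
  fix vs :: "'a list" and x
  show "iter_deriv vs (\<lambda>x. x) differentiable at x"
  proof (cases vs)
    case (Cons v us)
    have "smooth_on UNIV (\<lambda>x::'a. v)" by (rule smooth_on_const) simp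
    then show ?thesis unfolding Cons by (simp add: smooth_on_def)
  qed simp
qed (rule assms)

text \<open>A bilinear form is a polynomial in its matrix entries and its arguments, so entrywise
  convergence gives joint convergence.\<close>

lemma tendsto_bilinear_axis:
  fixes G :: "real ^ 'n::finite \<Rightarrow> real ^ 'n \<Rightarrow> real"
  assumes G: "bilinear G" and Gs: "eventually (\<lambda>s. bilinear (Gs s)) F"
    and lim: "\<And>i j. ((\<lambda>s. Gs s (axis i 1) (axis j 1)) \<longlongrightarrow> G (axis i 1) (axis j 1)) F"
    and x: "(x \<longlongrightarrow> x0) F" and y: "(y \<longlongrightarrow> y0) F"
  shows "((\<lambda>s. Gs s (x s) (y s)) \<longlongrightarrow> G x0 y0) F"
proof -
  have "((\<lambda>s. \<Sum>i\<in>UNIV. \<Sum>j\<in>UNIV. x s $ i * y s $ j * Gs s (axis i 1) (axis j 1)) \<longlongrightarrow> G x0 y0) F"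
    unfolding bilinear_expand_axis[OF G, of x0 y0] by (intro tendsto_intros x y lim)
  then show ?thesis
    by (rule Lim_transform_eventually)
      (use Gs in \<open>eventually_elim, simp add: bilinear_expand_axis[of "Gs _" "x _"]\<close>)
qed

section \<open>Deviation of the isometry from the identity\<close>

context contact_chart
begin

abbreviation "x\<^sub>0 \<equiv> snd \<kappa> p"
definition "F = local_rep \<kappa> \<kappa> \<phi>"
text \<open>Measured in the chart \<open>\<kappa>\<close>: a trivial \<open>d\<close>-jet makes the
  derivatives of \<open>R\<close> up to order \<open>d\<close> vanish at \<open>x\<^sub>0\<close>,
  and those of order \<open>d + 1\<close> are the unknowns.\<close>

definition "R x = F x - x"
definition "S\<^sub>F = snd \<kappa> ` {x \<in> U \<inter> fst \<kappa>. \<phi> x \<in> fst \<kappa>}"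

lemma smooth_\<phi>: "smooth_map M M U \<phi>" and inj_\<phi>: "inj_on \<phi> U"
  and smooth_inv: "smooth_map M M (\<phi> ` U) (the_inv_into U \<phi>)"
  using \<phi>(1) unfolding local_diffeo_def by auto

lemma smooth_F: "smooth_on S\<^sub>F F"
  using smooth_\<phi> \<kappa>(1) unfolding smooth_map_def F_def S\<^sub>F_def by blast

lemma x\<^sub>0: "x\<^sub>0 \<in> S\<^sub>F"
  unfolding S\<^sub>F_def using \<kappa> \<phi> by auto

lemma smooth_uminus: "smooth_on S\<^sub>F (\<lambda>x. - x)"
  using smooth_on_bounded_linear[OF bounded_linear_minus[OF bounded_linear_ident] smooth_on_ident]
    smooth_on_open[OF smooth_F] by blast

lemma smooth_R: "smooth_on S\<^sub>F R"
  unfolding R_def using smooth_on_add[OF smooth_F smooth_uminus] by simp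

lemma iter_deriv_R: "iter_deriv vs R x\<^sub>0 = iter_deriv vs F x\<^sub>0 - iter_deriv vs (\<lambda>x. x) x\<^sub>0"
proof -
  have "iter_deriv vs R x\<^sub>0 = iter_deriv vs F x\<^sub>0 + iter_deriv vs (\<lambda>x. - x) x\<^sub>0"
    unfolding R_def using iter_deriv_add[OF smooth_F smooth_uminus x\<^sub>0] by simp
  also have "iter_deriv vs (\<lambda>x. - x) x\<^sub>0 = - iter_deriv vs (\<lambda>x. x) x\<^sub>0"
    by (rule iter_deriv_bounded_linear[OF bounded_linear_minus[OF bounded_linear_ident]
          smooth_on_ident[OF smooth_on_open[OF smooth_F]] x\<^sub>0])
  finally show ?thesis by simp
qed

lemma R_flat: "length vs \<le> d \<Longrightarrow> iter_deriv vs R x\<^sub>0 = 0"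
  using jet \<kappa> unfolding iter_deriv_R F_def trivial_jet_def by simp

lemma F_derivative: "x \<in> S\<^sub>F \<Longrightarrow> frechet_derivative F (at x) u = u + frechet_derivative R (at x) u"
proof -
  assume x: "x \<in> S\<^sub>F"
  have "(R has_derivative (\<lambda>u. frechet_derivative F (at x) u - u)) (at x)"
    unfolding R_def[abs_def]
    by (intro has_derivative_diff smooth_on_has_derivative[OF smooth_F x] has_derivative_ident)
  then show ?thesis by (simp add: frechet_derivative_at[symmetric])
qed

abbreviation "inv\<phi> \<equiv> the_inv_into U \<phi>"
definition "N = {y \<in> \<phi> ` U \<inter> fst \<kappa>. inv\<phi> y \<in> fst \<kappa>}"

lemma inv\<phi>: "y \<in> U \<Longrightarrow> inv\<phi> (\<phi> y) = y"
  by (rule the_inv_into_f_f[OF inj_\<phi>])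

lemma inv\<phi>_p: "inv\<phi> p = p"
  using inv\<phi>[of p] \<phi> by simp

lemma p_image: "p \<in> \<phi> ` U"
  using \<phi> by (metis image_eqI)

lemma N: "open (snd \<kappa> ` N)" "p \<in> N"
  unfolding N_def using smooth_inv \<kappa> p_image inv\<phi>_p unfolding smooth_map_def
  by (blast intro: smooth_on_open, auto)

text \<open>The derivative of the inverse exists by smoothness; composing with
  \<open>\<phi>\<close>, whose derivative at \<open>p\<close> is the identity, forces it to be the
  identity too.\<close>

lemma inverse_derivative:
  "(local_rep \<kappa> \<kappa> (the_inv_into U \<phi>) has_derivative (\<lambda>v. v)) (at x\<^sub>0)"
proof -
  let ?E = "frechet_derivative (local_rep \<kappa> \<kappa> inv\<phi>) (at x\<^sub>0)"
  have E: "(local_rep \<kappa> \<kappa> inv\<phi> has_derivative ?E) (at x\<^sub>0)"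
    by (rule smooth_map_has_derivative[OF smooth_inv \<kappa>(1) \<kappa>(1) p_image]) (use \<kappa> inv\<phi>_p in auto)
  have id: "frechet_derivative F (at x\<^sub>0) = (\<lambda>v. v)"
  proof (rule ext)
    fix u show "frechet_derivative F (at x\<^sub>0) u = u"
      using F_derivative[OF x\<^sub>0, of u] R_flat[of "[u]"] d by simp
  qed
  have "(F has_derivative (\<lambda>v. v)) (at x\<^sub>0)"
    using smooth_on_has_derivative[OF smooth_F x\<^sub>0] unfolding id .
  then have "(local_rep \<kappa> \<kappa> (\<lambda>y. \<phi> (inv\<phi> y)) has_derivative (\<lambda>v. ?E v)) (at x\<^sub>0)"
    unfolding F_def
    by (intro local_rep_has_derivative_compose[OF inj_\<kappa> inj_\<kappa> N(1) _ _ N(2) E])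
      (auto simp: N_def inv\<phi>_p)
  moreover have "(local_rep \<kappa> \<kappa> (\<lambda>y. \<phi> (inv\<phi> y)) has_derivative (\<lambda>v. v)) (at x\<^sub>0)"
  proof (rule has_derivative_transform_within_open[OF has_derivative_ident N(1)])
    fix z assume "z \<in> snd \<kappa> ` N"
    then obtain y where "y \<in> N" "z = snd \<kappa> y" by blast
    then show "z = local_rep \<kappa> \<kappa> (\<lambda>y. \<phi> (inv\<phi> y)) z"
      by (auto simp: N_def local_rep_apply[OF inj_\<kappa>] inv\<phi>)
  qed (use N in blast)
  ultimately have "?E = (\<lambda>v. v)" by (rule has_derivative_unique)
  with E show ?thesis by simp
qed

text \<open>The pull-back of a form over \<open>x t\<close> sits over the preimage
  \<open>m t\<close>. The one-sided quotient obtained here is the moving direction that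
  \<open>taylor_tendsto\<close> takes as input.\<close>

lemma preimage_curve:
  assumes x: "eventually (\<lambda>t. x t \<in> fst \<kappa>) (at_right (0::real))"
    "(a has_vector_derivative v) (at 0)" "a 0 = x\<^sub>0"
    "eventually (\<lambda>t. a t = snd \<kappa> (x t)) (at_right 0)"
  defines "m \<equiv> \<lambda>t. the_inv_into U \<phi> (x t)"
  shows "eventually (\<lambda>s. m s \<in> U \<and> m s \<in> fst \<kappa> \<and> \<phi> (m s) = x s) (at_right 0)"
    and "((\<lambda>s. (snd \<kappa> (m s) - x\<^sub>0) /\<^sub>R s) \<longlongrightarrow> v) (at_right 0)"
proof -
  have le: "at_right 0 \<le> at (0::real)" by (simp add: at_le)
  have "(a \<longlongrightarrow> a 0) (at 0)"
    using has_vector_derivative_continuous[OF x(2)] by (simp add: continuous_at)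
  then have "(a \<longlongrightarrow> x\<^sub>0) (at_right 0)"
    unfolding x(3) by (rule tendsto_mono[OF le])
  then have "eventually (\<lambda>s. a s \<in> snd \<kappa> ` N) (at_right 0)"
    by (rule topological_tendstoD) (use N in auto)
  with x(1,4) have ev: "eventually (\<lambda>s. x s \<in> N \<and> a s = snd \<kappa> (x s)) (at_right 0)"
  proof eventually_elim
    case (elim s)
    then obtain y where "y \<in> N" "snd \<kappa> (x s) = snd \<kappa> y" by auto
    then have "x s = y" using elim inj_\<kappa> by (auto simp: N_def dest: inj_onD)
    then show ?case using \<open>y \<in> N\<close> elim by simp
  qed
  then show "eventually (\<lambda>s. m s \<in> U \<and> m s \<in> fst \<kappa> \<and> \<phi> (m s) = x s) (at_right 0)"
    by eventually_elim (auto simp: N_def m_def inv\<phi>)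
  have "(local_rep \<kappa> \<kappa> inv\<phi> has_derivative (\<lambda>v. v)) (at (a 0))"
    using inverse_derivative x(3) by simp
  then have "((\<lambda>s. local_rep \<kappa> \<kappa> inv\<phi> (a s)) has_vector_derivative v) (at 0)"
    using vector_derivative_diff_chain_within[OF x(2), of "local_rep \<kappa> \<kappa> inv\<phi>" "\<lambda>v. v"]
    by (auto simp: o_def intro: has_derivative_at_withinI)
  from has_vector_derivative_quotient[OF this]
  have "((\<lambda>s. (local_rep \<kappa> \<kappa> inv\<phi> (a s) - x\<^sub>0) /\<^sub>R s) \<longlongrightarrow> v) (at_right 0)"
    using le inv\<phi>_p by (simp add: x(3) local_rep_apply[OF inj_\<kappa> \<kappa>(2)] tendsto_mono)
  then show "((\<lambda>s. (snd \<kappa> (m s) - x\<^sub>0) /\<^sub>R s) \<longlongrightarrow> v) (at_right 0)"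
    by (rule Lim_transform_eventually)
      (use ev in \<open>eventually_elim, auto simp: m_def N_def local_rep_apply[OF inj_\<kappa>]\<close>)
qed

section \<open>The relation satisfied by the derivative of order \<open>d + 1\<close>\<close>

abbreviation "G \<equiv> coord_form M p \<kappa> g\<^sub>0"

lemma g\<^sub>0_Sym: "g\<^sub>0 \<in> Sym M p"
  using C_Sym_pos[OF g\<^sub>0] by (simp add: Sym_pos_def)

lemmas bilinear_G = bilinear_coord_form[OF M \<kappa> g\<^sub>0_Sym]
lemmas sym_G = coord_form_sym[OF M \<kappa> g\<^sub>0_Sym]

text \<open>Stated on axis vectors because bundle coordinates consist of the entries
  \<open>Upair i j\<close>. One scalar \<open>l\<close> serves all entries, since the limiting
  difference \<open>Z\<close> as a whole is a multiple of the fibre direction.\<close>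

lemma jet_relation_axis:
  "\<exists>l. \<forall>i j. G (iter_deriv (axis i 1 # replicate d v) R x\<^sub>0) (axis j 1)
      + G (axis i 1) (iter_deriv (axis j 1 # replicate d v) R x\<^sub>0) = l * snd (D\<Phi> b) $ Upair i j"
proof -
  \<comment> \<open>The Taylor coefficient of order \<open>d\<close> of the derivative of
    \<open>R\<close> in direction \<open>axis i 1\<close>; the factor \<open>fact d\<close> is
    restored at the end.\<close>
  define B where "B i = iter_deriv (axis i 1 # replicate d v) R x\<^sub>0 /\<^sub>R fact d" for i :: 'n
  obtain c w where c0: "c 0 = q\<^sub>0" and cw: "((\<lambda>t. snd \<sigma> (c t)) has_vector_derivative w) (at 0)"
    and w: "fst w = v" and evC: "eventually (\<lambda>t. c t \<in> C \<inter> fst \<sigma>) (at (0::real))"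
    by (rule horizontal_curve)
  note defect = graph_defect_small[OF c0 cw evC]
  define x g a where "x s = fst (c s)" and "g s = snd (c s)" and "a s = fst (snd \<sigma> (c s))" for s
  define m where "m s = inv\<phi> (x s)" for s
  have cxg: "c s = (x s, g s)" for s by (simp add: x_def g_def)
  have ev1: "eventually (\<lambda>s. (x s, g s) \<in> C \<and> x s \<in> fst \<kappa> \<and> g s \<in> Sym_pos M (x s) \<and> c s \<in> fst \<psi>) (at_right 0)"
    using defect(4) by eventually_elim (auto simp: cxg fst_sym_chart)
  have a: "(a has_vector_derivative v) (at 0)"
    unfolding a_def[abs_def] w[symmetric]
    by (rule bounded_linear.has_vector_derivative[OF bounded_linear_fst cw])
  have a_eq: "a s = snd \<kappa> (x s)" for s by (simp add: a_def cxg snd_sym_chart)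
  have a0: "a 0 = x\<^sub>0" by (simp add: a_def c0 snd_sym_chart)
  have xev: "eventually (\<lambda>s. x s \<in> fst \<kappa>) (at_right 0)" using ev1 by eventually_elim simp
  define \<beta> where "\<beta> s = (snd \<kappa> (m s) - x\<^sub>0) /\<^sub>R s" for s
  have m: "eventually (\<lambda>s. m s \<in> U \<and> m s \<in> fst \<kappa> \<and> \<phi> (m s) = x s) (at_right 0)"
    and \<beta>: "(\<beta> \<longlongrightarrow> v) (at_right 0)"
    using preimage_curve[OF xev a a0] a_eq unfolding m_def \<beta>_def by auto
  have pos: "eventually (\<lambda>s. s > 0) (at_right (0::real))" by (rule eventually_at_right_less)
  have m_eq: "snd \<kappa> (m s) = x\<^sub>0 + s *\<^sub>R \<beta> s" if "s > 0" for s
    using that by (simp add: \<beta>_def)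
  have ev2: "eventually (\<lambda>s. x\<^sub>0 + s *\<^sub>R \<beta> s \<in> S\<^sub>F \<and> F (x\<^sub>0 + s *\<^sub>R \<beta> s) = a s) (at_right 0)"
    using m pos xev
  proof eventually_elim
    case (elim s)
    then have "snd \<kappa> (m s) \<in> S\<^sub>F" unfolding S\<^sub>F_def by auto
    moreover have "F (snd \<kappa> (m s)) = a s"
      unfolding F_def a_eq using elim by (simp add: local_rep_apply[OF inj_\<kappa>])
    ultimately show ?case using m_eq elim by simp
  qed
  \<comment> \<open>By flatness of \<open>R\<close> the base points of the curve and of its
    pull-back differ by o(s^d).\<close>
  have lim_base: "((\<lambda>s. R (x\<^sub>0 + s *\<^sub>R \<beta> s) /\<^sub>R s ^ d) \<longlongrightarrow> 0) (at_right 0)"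
    using taylor_tendsto[OF smooth_R x\<^sub>0 \<beta>, of d] by (simp add: R_flat)
  define A where "A u s = frechet_derivative R (at (x\<^sub>0 + s *\<^sub>R \<beta> s)) u" for u s
  \<comment> \<open>One derivative of \<open>R\<close> is spent on \<open>axis i 1\<close>, so the
    remaining ones vanish below order \<open>d\<close> and order \<open>d\<close> gives
    \<open>B i\<close>.\<close>
  have lim_A: "((\<lambda>s. A (axis i 1) s /\<^sub>R s ^ d) \<longlongrightarrow> B i) (at_right 0)" for i
  proof -
    have "iter_deriv (replicate k u) (\<lambda>x. frechet_derivative R (at x) (axis i 1)) x\<^sub>0 = 0" if "k < d" for k u
      using R_flat[of "axis i 1 # replicate k u"] that by simp
    then show ?thesis
      using taylor_tendsto[OF smooth_on_frechet_derivative[OF smooth_R] x\<^sub>0 \<beta>, of d "axis i 1"]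
      unfolding A_def B_def by simp
  qed
  have sd: "((\<lambda>s. s ^ d) \<longlongrightarrow> 0) (at_right (0::real))"
  proof -
    have "((\<lambda>s. s ^ d) \<longlongrightarrow> 0 ^ d) (at_right (0::real))" by (intro tendsto_intros)
    then show ?thesis using d by (simp add: power_0_left)
  qed
  have unscale: "(h \<longlongrightarrow> 0) (at_right 0)" if "((\<lambda>s. h s /\<^sub>R s ^ d) \<longlongrightarrow> l) (at_right 0)"
    for h :: "real \<Rightarrow> 'c::real_normed_vector" and l
  proof -
    have "((\<lambda>s. s ^ d *\<^sub>R (h s /\<^sub>R s ^ d)) \<longlongrightarrow> 0 *\<^sub>R l) (at_right 0)"
      by (rule tendsto_scaleR[OF sd that])
    then show ?thesis
      by (rule Lim_transform_eventually[THEN tendsto_eq_rhs])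
        (use pos in \<open>eventually_elim, simp\<close>, simp)
  qed
  have lim_A0: "((\<lambda>s. A (axis i 1) s) \<longlongrightarrow> 0) (at_right 0)" for i
    by (rule unscale[OF lim_A])
  define D where "D u s = frechet_derivative F (at (x\<^sub>0 + s *\<^sub>R \<beta> s)) u" for u s
  have D_eq: "eventually (\<lambda>s. \<forall>u. D u s = u + A u s) (at_right 0)"
    using ev2 by eventually_elim (simp add: D_def A_def F_derivative)
  have lim_D: "((\<lambda>s. D (axis i 1) s) \<longlongrightarrow> axis i 1) (at_right 0)" for i
  proof -
    have "((\<lambda>s. axis i 1 + A (axis i 1) s) \<longlongrightarrow> axis i 1 + 0) (at_right 0)"
      by (intro tendsto_intros lim_A0)
    then show ?thesis
      by (rule Lim_transform_eventually[THEN tendsto_eq_rhs])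
        (use D_eq in \<open>eventually_elim, simp\<close>, simp)
  qed
  \<comment> \<open>The derivative of \<open>\<phi>\<close> at \<open>m s\<close> is the identity
    plus \<open>A\<close>, and once the norms of \<open>A\<close> on the axes add up to less than 1
    it has no kernel. So the pulled-back form is positive definite, a point of the bundle.\<close>
  have inj_D: "eventually (\<lambda>s. \<forall>u. D u s = 0 \<longrightarrow> u = 0) (at_right 0)"
  proof -
    have "((\<lambda>s. \<Sum>i\<in>UNIV. norm (A (axis i 1) s)) \<longlongrightarrow> (\<Sum>i\<in>(UNIV::'n set). norm (0 :: real ^ 'n))) (at_right 0)"
      by (intro tendsto_intros lim_A0)
    then have "eventually (\<lambda>s. (\<Sum>i\<in>UNIV. norm (A (axis i 1) s)) < 1) (at_right 0)"
      by (intro order_tendstoD(2)) auto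
    then show ?thesis
      using D_eq ev2
    proof eventually_elim
      case (elim s)
      have lin: "linear (\<lambda>u. A u s)"
        unfolding A_def
        by (rule linear_frechet_derivative[OF smooth_on_differentiable[OF smooth_R]]) (use elim in blast)
      show ?case
      proof (intro allI impI)
        fix u assume "D u s = 0"
        then have "norm u = norm (A u s)" using elim by (metis add_eq_0_iff norm_minus_cancel)
        also have "A u s = (\<Sum>i\<in>UNIV. u $ i *\<^sub>R A (axis i 1) s)"
        proof -
          have "u = (\<Sum>i\<in>UNIV. u $ i *\<^sub>R axis i 1)"
            using basis_expansion[of u] by (simp add: scalar_mult_eq_scaleR)
          then have "A u s = A (\<Sum>i\<in>UNIV. u $ i *\<^sub>R axis i 1) s" by (rule arg_cong)
          then show ?thesis unfolding linear_sum[OF lin] linear_scale[OF lin] .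
        qed
        also have "norm \<dots> \<le> (\<Sum>i\<in>UNIV. norm u * norm (A (axis i 1) s))"
          by (intro order_trans[OF norm_sum] sum_mono)
            (auto intro!: mult_right_mono component_le_norm_cart)
        also have "\<dots> = norm u * (\<Sum>i\<in>UNIV. norm (A (axis i 1) s))" by (simp add: sum_distrib_left)
        finally have "norm u * (1 - (\<Sum>i\<in>UNIV. norm (A (axis i 1) s))) \<le> 0" by (simp add: algebra_simps)
        then show "u = 0" using elim by (simp add: mult_le_0_iff)
      qed
    qed
  qed
  define Gs where "Gs s = coord_form M (x s) \<kappa> (g s)" for s
  have bil: "eventually (\<lambda>s. bilinear (Gs s)) (at_right 0)"
    using ev1 by eventually_elim
      (auto simp: Gs_def Sym_pos_def intro!: bilinear_coord_form[OF M \<kappa>(1)])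
  have lim_Gs: "((\<lambda>s. Gs s (axis i 1) (axis j 1)) \<longlongrightarrow> G (axis i 1) (axis j 1)) (at_right 0)" for i j
  proof -
    have "((\<lambda>s. snd (snd \<sigma> (c s)) $ Upair i j) \<longlongrightarrow> snd (snd \<sigma> q\<^sub>0) $ Upair i j) (at_right 0)"
      by (intro tendsto_intros defect(3))
    moreover have "snd (snd \<sigma> q\<^sub>0) $ Upair i j = G (axis i 1) (axis j 1)"
      by (simp add: snd_sym_chart sym_coords_Upair sym_G)
    moreover have "eventually (\<lambda>s. snd (snd \<sigma> (c s)) $ Upair i j = Gs s (axis i 1) (axis j 1)) (at_right 0)"
      using ev1
    proof eventually_elim
      case (elim s)
      have "g s \<in> Sym M (x s)" using elim by (simp add: Sym_pos_def)
      then show ?case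
        using coord_form_sym[OF M \<kappa>(1) _ \<open>g s \<in> Sym M (x s)\<close>] elim
        by (simp add: cxg snd_sym_chart Gs_def sym_coords_Upair)
    qed
    ultimately show ?thesis using Lim_transform_eventually by fastforce
  qed
  define \<tau> where "\<tau> s = (m s, pull_form M \<phi> (m s) (g s))" for s
  have \<tau>: "eventually (\<lambda>s. \<tau> s \<in> pull_gcs M U \<phi> C \<inter> fst \<sigma> \<and>
      snd \<sigma> (\<tau> s) = (x\<^sub>0 + s *\<^sub>R \<beta> s, sym_coords (\<lambda>i j. Gs s (D (axis i 1) s) (D (axis j 1) s)))) (at_right 0)"
    using m ev1 inj_D pos
  proof eventually_elim
    case (elim s)
    have mU: "m s \<in> U" "m s \<in> fst \<kappa>" "\<phi> (m s) \<in> fst \<kappa>" "g s \<in> Sym_pos M (\<phi> (m s))"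
      using elim by auto
    have fr: "frechet_derivative (local_rep \<kappa> \<kappa> \<phi>) (at (snd \<kappa> (m s))) u = D u s" for u
      using m_eq[of s] elim by (simp add: D_def F_def)
    have "pull_form M \<phi> (m s) (g s) \<in> Sym_pos M (m s)"
      by (rule pull_form_Sym_pos[OF M smooth_\<phi> mU(1) \<kappa>(1) mU(2,3,4)]) (use elim fr in auto)
    moreover have "(m s, pull_form M \<phi> (m s) (g s)) \<in> pull_gcs M U \<phi> C"
      unfolding pull_gcs_def using elim by auto
    moreover have "coord_form M (m s) \<kappa> (pull_form M \<phi> (m s) (g s)) e e' = Gs s (D e s) (D e' s)" for e e'
      using coord_form_pull_form[OF M smooth_\<phi> mU(1) \<kappa>(1) mU(2,3)] elim by (simp add: fr Gs_def)
    ultimately show ?case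
      using mU elim m_eq[of s] by (simp add: \<tau>_def fst_sym_chart snd_sym_chart)
  qed
  define Z where "Z = sym_coords (\<lambda>i j. G (B i) (axis j 1) + G (axis i 1) (B j))"
  have Zij: "Z $ Upair i j = G (B i) (axis j 1) + G (axis i 1) (B j)" for i j
    unfolding Z_def by (rule sym_coords_Upair) (simp add: sym_G[of "B _"])
  \<comment> \<open>The base part of the difference is \<open>- R\<close>. The entries satisfy the
    exact identity \<open>Gs(D e_i, D e_j) - Gs(e_i, e_j) = Gs(A e_i, e_j) + Gs(D e_i, A
    e_j)\<close>, where each term on the right has one factor \<open>A\<close> of order
    \<open>s^d\<close>.\<close>
  have lim_Z: "((\<lambda>s. inverse (s ^ d) *\<^sub>R (snd \<sigma> (\<tau> s) - snd \<sigma> (c s))) \<longlongrightarrow> (0, Z)) (at_right 0)"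
  proof -
    have "((\<lambda>s. fst (inverse (s ^ d) *\<^sub>R (snd \<sigma> (\<tau> s) - snd \<sigma> (c s)))) \<longlongrightarrow> 0) (at_right 0)"
    proof (rule Lim_transform_eventually)
      show "((\<lambda>s. - (R (x\<^sub>0 + s *\<^sub>R \<beta> s) /\<^sub>R s ^ d)) \<longlongrightarrow> 0) (at_right 0)"
        using tendsto_minus[OF lim_base] by simp
      show "eventually (\<lambda>s. - (R (x\<^sub>0 + s *\<^sub>R \<beta> s) /\<^sub>R s ^ d) =
          fst (inverse (s ^ d) *\<^sub>R (snd \<sigma> (\<tau> s) - snd \<sigma> (c s)))) (at_right 0)"
        using \<tau> ev2
      proof eventually_elim
        case (elim s)
        then have "fst (snd \<sigma> (\<tau> s)) = x\<^sub>0 + s *\<^sub>R \<beta> s" "fst (snd \<sigma> (c s)) = F (x\<^sub>0 + s *\<^sub>R \<beta> s)"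
          by (auto simp: a_def)
        then show ?case by (simp add: R_def scaleR_diff_right)
      qed
    qed
    moreover have "((\<lambda>s. snd (inverse (s ^ d) *\<^sub>R (snd \<sigma> (\<tau> s) - snd \<sigma> (c s)))) \<longlongrightarrow> Z) (at_right 0)"
    proof (rule vec_tendstoI)
      fix q :: "'n uprod"
      obtain i j where q: "q = Upair i j" by (cases q) auto
      have "((\<lambda>s. Gs s (A (axis i 1) s /\<^sub>R s ^ d) (axis j 1) + Gs s (D (axis i 1) s) (A (axis j 1) s /\<^sub>R s ^ d))
          \<longlongrightarrow> G (B i) (axis j 1) + G (axis i 1) (B j)) (at_right 0)"
        by (intro tendsto_add tendsto_bilinear_axis[OF bilinear_G bil lim_Gs] lim_A lim_D tendsto_const)
      then show "((\<lambda>s. snd (inverse (s ^ d) *\<^sub>R (snd \<sigma> (\<tau> s) - snd \<sigma> (c s))) $ q) \<longlongrightarrow> Z $ q) (at_right 0)"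
        unfolding q Zij
      proof (rule Lim_transform_eventually)
        show "eventually (\<lambda>s. Gs s (A (axis i 1) s /\<^sub>R s ^ d) (axis j 1)
            + Gs s (D (axis i 1) s) (A (axis j 1) s /\<^sub>R s ^ d)
            = snd (inverse (s ^ d) *\<^sub>R (snd \<sigma> (\<tau> s) - snd \<sigma> (c s))) $ Upair i j) (at_right 0)"
          using \<tau> ev1 bil D_eq
        proof eventually_elim
          case (elim s)
          have "g s \<in> Sym M (x s)" using elim by (simp add: Sym_pos_def)
          then have sym: "Gs s u u' = Gs s u' u" for u u'
            using coord_form_sym[OF M \<kappa>(1)] elim unfolding Gs_def by blast
          have "snd (snd \<sigma> (\<tau> s)) $ Upair i j = Gs s (D (axis i 1) s) (D (axis j 1) s)"
            using elim by (simp add: sym_coords_Upair[OF sym])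
          moreover have "snd (snd \<sigma> (c s)) $ Upair i j = Gs s (axis i 1) (axis j 1)"
            by (simp add: cxg snd_sym_chart Gs_def[symmetric] sym_coords_Upair[OF sym])
          ultimately show ?case
            using elim(3,4)
            by (simp add: bilinear_lmul bilinear_rmul bilinear_ladd bilinear_radd algebra_simps)
        qed
      qed
    qed
    ultimately show ?thesis
      using tendsto_Pair by (subst prod.collapse[symmetric]) blast
  qed
  have "((\<lambda>s. snd \<sigma> (\<tau> s) - snd \<sigma> (c s)) \<longlongrightarrow> 0) (at_right 0)"
    by (rule unscale) (use lim_Z in simp)
  from tendsto_add[OF this defect(3)]
  have lim_\<tau>: "((\<lambda>s. snd \<sigma> (\<tau> s)) \<longlongrightarrow> snd \<sigma> q\<^sub>0) (at_right 0)" by simp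
  have "eventually (\<lambda>s. \<tau> s \<in> fst \<psi>) (at_right 0)"
    by (rule eventually_in_\<psi>[OF lim_\<tau>]) (use \<tau> in \<open>eventually_elim, blast\<close>)
  \<comment> \<open>The pulled-back curve lies in the linear model exactly, not only to some
    order.\<close>
  with \<tau> have \<tau>K: "eventually (\<lambda>s. \<Psi> (snd \<sigma> (\<tau> s)) \<in> span K) (at_right 0)"
  proof eventually_elim
    case (elim s)
    then have "snd \<psi> (\<tau> s) \<in> snd \<psi> ` (pull_gcs M U \<phi> C \<inter> fst \<psi>)" by blast
    then show ?case unfolding pull using elim \<Psi>_apply[of "\<tau> s"] by auto
  qed
  have Pl: "linear P" by (rule bounded_linear.linear[OF bounded_linear_span_proj])
  have bl: "bounded_linear (\<lambda>x. x - P x)"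
    by (intro bounded_linear_sub bounded_linear_ident bounded_linear_span_proj)
  have "((\<lambda>s. inverse (s ^ d) *\<^sub>R (\<Psi> (snd \<sigma> (\<tau> s)) - \<Psi> (snd \<sigma> (c s)))) \<longlongrightarrow> D\<Psi> (0, Z)) (at_right 0)"
    using strict_derivative_tendsto[OF smooth_\<Psi> _ lim_\<tau> defect(3) lim_Z] q\<^sub>0 \<psi>(2)
    unfolding trans_deriv_def \<Psi>_def by blast
  from bounded_linear.tendsto[OF bl this]
  have "((\<lambda>s. (\<lambda>x. x - P x) (inverse (s ^ d) *\<^sub>R (\<Psi> (snd \<sigma> (\<tau> s)) - \<Psi> (snd \<sigma> (c s)))))
      \<longlongrightarrow> D\<Psi> (0, Z) - P (D\<Psi> (0, Z))) (at_right 0)" .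
  \<comment> \<open>Off \<open>span K\<close> the pulled-back curve contributes nothing and the
    curve in \<open>C\<close> only its graph defect, which is o(s^d).\<close>
  moreover have "((\<lambda>s. (\<lambda>x. x - P x) (inverse (s ^ d) *\<^sub>R (\<Psi> (snd \<sigma> (\<tau> s)) - \<Psi> (snd \<sigma> (c s)))))
      \<longlongrightarrow> 0) (at_right 0)"
  proof (rule Lim_transform_eventually)
    show "((\<lambda>s. - ((snd \<psi> (c s) - P (snd \<psi> (c s))) /\<^sub>R s ^ d)) \<longlongrightarrow> 0) (at_right 0)"
      using tendsto_minus[OF defect(1)] by simp
    show "eventually (\<lambda>s. - ((snd \<psi> (c s) - P (snd \<psi> (c s))) /\<^sub>R s ^ d) =
        (\<lambda>x. x - P x) (inverse (s ^ d) *\<^sub>R (\<Psi> (snd \<sigma> (\<tau> s)) - \<Psi> (snd \<sigma> (c s))))) (at_right 0)"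
      using \<tau>K defect(4)
    proof eventually_elim
      case (elim s)
      then have "P (\<Psi> (snd \<sigma> (\<tau> s))) = \<Psi> (snd \<sigma> (\<tau> s))" "\<Psi> (snd \<sigma> (c s)) = snd \<psi> (c s)"
        by (auto simp: span_proj_span[OF K(1)] \<Psi>_apply)
      then show ?case
        by (simp add: linear_scale[OF Pl] linear_diff[OF Pl] scaleR_diff_right)
    qed
  qed
  ultimately have "D\<Psi> (0, Z) - P (D\<Psi> (0, Z)) = 0"
    using tendsto_unique[OF trivial_limit_at_right_real] by blast
  then have "D\<Psi> (0, Z) \<in> span K" unfolding span_iff_proj .
  then obtain l where l: "Z = l *\<^sub>R snd (D\<Phi> b)" using vertical_tangent by blast
  show ?thesis
  proof (intro exI allI)
    fix i j
    have "G (B i) (axis j 1) + G (axis i 1) (B j) = l * snd (D\<Phi> b) $ Upair i j"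
      using Zij[of i j] unfolding l by simp
    then show "G (iter_deriv (axis i 1 # replicate d v) R x\<^sub>0) (axis j 1)
        + G (axis i 1) (iter_deriv (axis j 1 # replicate d v) R x\<^sub>0) = fact d * l * snd (D\<Phi> b) $ Upair i j"
      unfolding B_def by (simp add: bilinear_lmul[OF bilinear_G] bilinear_rmul[OF bilinear_G] field_simps)
  qed
qed

lemma next_jet_trivial:
  assumes n: "CARD('n) \<ge> 3" and vs: "length vs \<le> d + 1"
  shows "iter_deriv vs F x\<^sub>0 = iter_deriv vs (\<lambda>x. x) x\<^sub>0"
proof -
  obtain H :: "real ^ 'n \<Rightarrow> real ^ 'n \<Rightarrow> real" where H: "bilinear H" "\<And>u v. H u v = H v u"
    "\<And>u. (\<And>w. H u w = 0) \<Longrightarrow> u = 0" "D\<Phi> b = (0, sym_coords (\<lambda>i j. H (axis i 1) (axis j 1)))"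
    by (rule fiber_direction) blast
  have HD: "snd (D\<Phi> b) $ Upair i j = H (axis i 1) (axis j 1)" for i j
    unfolding H(4) using sym_coords_Upair[of "\<lambda>i j. H (axis i 1) (axis j 1)", OF H(2)] by simp
  have "iter_deriv vs R x\<^sub>0 = 0"
  proof (cases "length vs \<le> d")
    case False
    then have len: "length vs = Suc d" using vs by simp
    show ?thesis
    proof (rule generic_prolongation_eq_0[OF n d bilinear_G _ H(1,2,3) _ _ _ len])
      show "u = 0" if "\<And>w. G u w = 0" for u
        using that[of u] C_Sym_pos[OF g\<^sub>0] Sym_pos_iff[OF M \<kappa>] by (metis less_irrefl)
      show "iter_deriv xs R x\<^sub>0 = iter_deriv ys R x\<^sub>0" if "mset xs = mset ys" for xs ys
        by (rule iter_deriv_perm[OF smooth_R x\<^sub>0 that])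
      show lin: "linear (\<lambda>v. iter_deriv (v # xs) R x\<^sub>0)" for xs
        by (rule iter_deriv_Cons_linear[OF smooth_R x\<^sub>0])
      fix v
      let ?B = "\<lambda>u. iter_deriv (u # replicate d v) R x\<^sub>0"
      obtain l where l: "\<And>i j. G (?B (axis i 1)) (axis j 1) + G (axis i 1) (?B (axis j 1))
          = l * snd (D\<Phi> b) $ Upair i j"
        using jet_relation_axis[of v] by blast
      \<comment> \<open>Because \<open>l\<close> is common to all pairs of axis vectors, the error
        in the relation is a single bilinear form, which is determined by its entries.\<close>
      define E where "E u w = G (?B u) w + G u (?B w) - l * H u w" for u w
      have "bilinear E"
        unfolding bilinear_def E_def
        using lin[of "replicate d v"] bilinear_G H(1)
        by (auto intro!: linearI simp: linear_add[of ?B] linear_scale[of ?B] bilinear_ladd bilinear_radd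
            bilinear_lmul bilinear_rmul algebra_simps simp del: iter_deriv.simps)
      moreover have "E (axis i 1) (axis j 1) = 0" for i j
        using l[of i j] by (simp add: E_def HD)
      ultimately have "E u w = 0" for u w
        by (subst bilinear_expand_axis) auto
      then show "\<exists>l. \<forall>u w. G (?B u) w + G (?B w) u = l * H u w"
        unfolding E_def using sym_G by (metis eq_iff_diff_eq_0)
    qed
  qed (rule R_flat)
  then show ?thesis by (simp add: iter_deriv_R)
qed

end

theorem theorem1p1:
  fixes M :: "('m, real ^ 'n) chart set"
    and C :: "('m, 'n::finite) bpoint set"
  assumes "smooth_manifold M"
    and "CARD('n) \<ge> 3"
    and "generic_gcs M C"
  shows "\<forall>d\<ge>2. d_rigid M C d"
  unfolding d_rigid_def
proof (intro allI impI ballI)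
  fix d p U \<phi>
  assume d: "2 \<le> d" and p: "p \<in> mcarrier M" and iso: "d_isometry M C (d + 1) U \<phi> p"
    and jet: "trivial_jet M d \<phi> p"
  \<comment> \<open>A \<open>(d + 1)\<close>-isometry has contact of order
    \<open>(d + 1) - 1 = d\<close>.\<close>
  have \<phi>: "local_diffeo M U \<phi>" "p \<in> U" "\<phi> p = p"
    and con: "contact (sym_bundle M) (CARD('n) + 1) d ({p} \<times> fiber C p) (pull_gcs M U \<phi> C) C"
    using iso unfolding d_isometry_def by auto
  \<comment> \<open>The contact condition is exploited at a single point of the fibre, which exists
    because fibres are non-empty.\<close>
  have "fiber C p \<noteq> {}"
    using assms(3) p unfolding generic_gcs_def gcs_def by blast
  then obtain g\<^sub>0 where g\<^sub>0: "(p, g\<^sub>0) \<in> C" unfolding fiber_def by blast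
  then have "(p, g\<^sub>0) \<in> {p} \<times> fiber C p" by (simp add: fiber_def)
  from bspec[OF conjunct2[OF con[unfolded contact_def]] this] obtain \<psi> K b f where \<psi>: "\<psi> \<in> maximal_atlas (sym_bundle M)" "(p, g\<^sub>0) \<in> fst \<psi>"
    and K: "K \<subseteq> Basis" "b \<in> K" "card K = CARD('n) + 1"
    and pull: "snd \<psi> ` (pull_gcs M U \<phi> C \<inter> fst \<psi>) = span K \<inter> snd \<psi> ` fst \<psi>"
    and fib: "snd \<psi> ` (({p} \<times> fiber C p) \<inter> fst \<psi>) = span {b} \<inter> snd \<psi> ` fst \<psi>"
    and f: "smooth_on UNIV f" "f ` span K \<subseteq> span (Basis - K)"
    and graph: "snd \<psi> ` (C \<inter> fst \<psi>) = (\<lambda>x. x + f x) ` span K \<inter> snd \<psi> ` fst \<psi>"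
    and flat: "\<forall>x\<in>snd \<psi> ` (({p} \<times> fiber C p) \<inter> fst \<psi>). \<forall>vs. set vs \<subseteq> span K \<longrightarrow> length vs \<le> d \<longrightarrow>
      iter_deriv vs f x = 0"
    unfolding case_prod_unfold by (elim bexE exE conjE) blast
  show "trivial_jet M (d + 1) \<phi> p"
    unfolding trivial_jet_def
  proof (intro conjI ballI impI allI)
    fix \<kappa> and vs :: "(real ^ 'n) list"
    assume \<kappa>: "\<kappa> \<in> M" "p \<in> fst \<kappa>" and vs: "length vs \<le> d + 1"
    \<comment> \<open>The contact chart stays fixed while \<open>trivial_jet\<close> ranges over all
      base charts at \<open>p\<close>, so the locale is interpreted anew for each
      \<open>\<kappa>\<close>.\<close>
    interpret contact_chart M C U \<phi> d p \<kappa> g\<^sub>0 \<psi> K b f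
      using assms(1,3) d \<phi> jet \<kappa> g\<^sub>0 \<psi> K pull fib f graph flat
      unfolding smooth_manifold_def by unfold_locales blast+
    show "iter_deriv vs (local_rep \<kappa> \<kappa> \<phi>) (snd \<kappa> p) = iter_deriv vs (\<lambda>x. x) (snd \<kappa> p)"
      using next_jet_trivial[OF assms(2) vs] unfolding F_def .
  qed (rule \<phi>(3))
qed

end
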